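(* Let $m\ge 3$ be odd and let $G(m)$ be the dihedral Artin group. Then the (uniform) twisted conjugacy problem $\mathrm{TCP}(G(m))$ is solvable in linear time.
   Context: For $m\ge 2$ the dihedral Artin group is $G(m)=\langle a,b \mid {}_m(a,b)={}_m(b,a)\rangle$, where ${}_m(a,b)$ is the alternating word $abab\cdots$ of length $m$. For $m=2k+1\geq 3$ odd it is isomorphic to the torus knot group $\langle x,y\mid x^2=y^m\rangle$; one works with the inverse-closed generating set $X=\{x^{\pm1},y^{\pm1}\}$. For a group $G$ with finite inverse-closed generating set $X$ and $\psi\in\mathrm{Aut}(G)$, words $u,v\in X^*$ are $\psi$-twisted conjugate if there is $w\in G$ with $v=\psi(w)^{-1}uw$ in $G$. The (uniform) twisted conjugacy problem $\mathrm{TCP}(G)$ takes as input two words $u,v\in X^*$ and an automorphism $\psi\in\mathrm{Aut}(G)$, and asks to decide whether $u$ and $v$ represent $\psi$-twisted conjugate elements of $G$. Time is measured on a RAM machine; "linear time" means linear in the length of the input words (the automorphism being given by words for the images of the generators). *)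

theory Defs
  imports "HOL-Algebra.Algebra" "HOL-Library.Landau_Symbols"
begin

section \<open>Groups given by presentations\<close>

text \<open>The letter \<open>(s, False)\<close> stands for \<open>s\<close> and \<open>(s, True)\<close> for its formal inverse.\<close>

type_synonym 'a word = "('a \<times> bool) list"

text \<open>The congruence on words that presents the group with relators \<open>R\<close>, a pair \<open>(r, s) \<in> R\<close>
  being the relation \<open>r = s\<close>.\<close>

inductive pres_eq :: "('a word \<times> 'a word) set \<Rightarrow> 'a word \<Rightarrow> 'a word \<Rightarrow> bool"
  for R :: "('a word \<times> 'a word) set" where
  refl: "pres_eq R u u"
| sym: "pres_eq R u v \<Longrightarrow> pres_eq R v u"
| trans: "pres_eq R u v \<Longrightarrow> pres_eq R v w \<Longrightarrow> pres_eq R u w"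
| app: "pres_eq R u u' \<Longrightarrow> pres_eq R v v' \<Longrightarrow> pres_eq R (u @ v) (u' @ v')"
| cancel: "pres_eq R [(s, e), (s, \<not> e)] []"
| rel: "(r, s) \<in> R \<Longrightarrow> pres_eq R r s"

definition pres_class :: "('a word \<times> 'a word) set \<Rightarrow> 'a word \<Rightarrow> 'a word set" where
  "pres_class R u = {v. pres_eq R u v}"

definition presented_group :: "('a word \<times> 'a word) set \<Rightarrow> 'a word set monoid" where
  "presented_group R =
     \<lparr>carrier = range (pres_class R),
      monoid.mult = (\<lambda>U V. \<Union>u\<in>U. \<Union>v\<in>V. pres_class R (u @ v)),
      one = pres_class R []\<rparr>"

lemma pres_class_eq_iff: "pres_class R u = pres_class R v \<longleftrightarrow> pres_eq R u v"
  unfolding pres_class_def by (auto intro: pres_eq.refl pres_eq.sym pres_eq.trans)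

lemma pres_class_mult:
  "pres_class R u \<otimes>\<^bsub>presented_group R\<^esub> pres_class R v = pres_class R (u @ v)"
proof -
  have "pres_class R (u' @ v') = pres_class R (u @ v)"
    if "u' \<in> pres_class R u" "v' \<in> pres_class R v" for u' v'
    using that unfolding pres_class_eq_iff by (simp add: pres_class_def pres_eq.app pres_eq.sym)
  then have "(\<Union>u'\<in>pres_class R u. \<Union>v'\<in>pres_class R v. pres_class R (u' @ v')) =
    (\<Union>u'\<in>pres_class R u. \<Union>v'\<in>pres_class R v. pres_class R (u @ v))"
    by (intro SUP_cong HOL.refl) blast
  moreover have "u \<in> pres_class R u" "v \<in> pres_class R v"
    by (simp_all add: pres_class_def pres_eq.refl)
  ultimately show ?thesis
    unfolding presented_group_def monoid.simps by blast
qed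

lemma pres_class_left_inv: "\<exists>v. pres_eq R (v @ u) []"
proof (induction u)
  case Nil
  show ?case by (metis append_Nil pres_eq.refl)
next
  case (Cons l u)
  obtain s e where l: "l = (s, e)" by fastforce
  obtain v where v: "pres_eq R (v @ u) []" using Cons by blast
  have "pres_eq R [(s, \<not> e), (s, e)] []" using pres_eq.cancel[of R s "\<not> e"] by simp
  then have "pres_eq R (v @ ([(s, \<not> e), (s, e)] @ u)) (v @ ([] @ u))"
    by (intro pres_eq.app pres_eq.refl)
  then have "pres_eq R ((v @ [(s, \<not> e)]) @ l # u) []"
    using v l by (auto intro: pres_eq.trans)
  then show ?case by blast
qed

lemma group_presented_group: "group (presented_group R)"
proof (rule groupI)
  have car: "carrier (presented_group R) = range (pres_class R)"
    and one: "\<one>\<^bsub>presented_group R\<^esub> = pres_class R []"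
    by (simp_all add: presented_group_def)
  show "\<exists>y\<in>carrier (presented_group R). y \<otimes>\<^bsub>presented_group R\<^esub> x = \<one>\<^bsub>presented_group R\<^esub>"
    if "x \<in> carrier (presented_group R)" for x
    using that pres_class_left_inv[of R]
    by (fastforce simp: car one pres_class_mult pres_class_eq_iff)
next
  fix U V
  assume "U \<in> carrier (presented_group R)" "V \<in> carrier (presented_group R)"
  then obtain u v where "U = pres_class R u" "V = pres_class R v"
    by (auto simp: presented_group_def)
  then show "U \<otimes>\<^bsub>presented_group R\<^esub> V \<in> carrier (presented_group R)"
    by (simp add: pres_class_mult) (simp add: presented_group_def)
next
  fix U V W
  assume "U \<in> carrier (presented_group R)" "V \<in> carrier (presented_group R)"
    "W \<in> carrier (presented_group R)"
  then obtain u v w where "U = pres_class R u" "V = pres_class R v" "W = pres_class R w"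
    by (auto simp: presented_group_def)
  then show "U \<otimes>\<^bsub>presented_group R\<^esub> V \<otimes>\<^bsub>presented_group R\<^esub> W =
    U \<otimes>\<^bsub>presented_group R\<^esub> (V \<otimes>\<^bsub>presented_group R\<^esub> W)"
    by (simp add: pres_class_mult)
next
  have one: "\<one>\<^bsub>presented_group R\<^esub> = pres_class R []"
    by (simp add: presented_group_def)
  then show "\<one>\<^bsub>presented_group R\<^esub> \<in> carrier (presented_group R)"
    by (simp add: presented_group_def)
  fix U
  assume "U \<in> carrier (presented_group R)"
  then obtain u where "U = pres_class R u"
    by (auto simp: presented_group_def)
  then show "\<one>\<^bsub>presented_group R\<^esub> \<otimes>\<^bsub>presented_group R\<^esub> U = U"
    by (simp add: one pres_class_mult)
qed


section \<open>Dihedral Artin groups\<close>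

fun alternating :: "nat \<Rightarrow> 'a \<Rightarrow> 'a \<Rightarrow> 'a word" where
  "alternating 0 s t = []"
| "alternating (Suc n) s t = (s, False) # alternating n t s"

datatype artin_gen = A | B

definition artin_rels :: "nat \<Rightarrow> (artin_gen word \<times> artin_gen word) set" where
  "artin_rels m = {(alternating m A B, alternating m B A)}"

definition dihedral_artin_group :: "nat \<Rightarrow> artin_gen word set monoid" where
  "dihedral_artin_group m = presented_group (artin_rels m)"

text \<open>For odd \<open>m\<close> the isomorphism from the torus knot group \<open>\<langle>x, y | x\<^sup>2 = y\<^sup>m\<rangle>\<close> sends \<open>x\<close> to
  the alternating product \<open>aba\<dots>a\<close> of length \<open>m\<close> and \<open>y\<close> to \<open>ab\<close>. With \<open>m = 2k + 1\<close>, its inverse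
  sends \<open>a\<close> to \<open>y\<^sup>-\<^sup>kx\<close> and \<open>b\<close> to \<open>x\<^sup>-\<^sup>1y\<^sup>k\<^sup>+\<^sup>1\<close>.\<close>

definition torus_x :: "nat \<Rightarrow> artin_gen word set" where
  "torus_x m = pres_class (artin_rels m) (alternating m A B)"

definition torus_y :: "nat \<Rightarrow> artin_gen word set" where
  "torus_y m = pres_class (artin_rels m) [(A, False), (B, False)]"

lemma generate_torus:
  assumes "odd m"
  shows "generate (dihedral_artin_group m) {torus_x m, torus_y m} = carrier (dihedral_artin_group m)"
proof -
  define G where "G = dihedral_artin_group m"
  define c where "c = pres_class (artin_rels m)"
  define H where "H = generate G {torus_x m, torus_y m}"
  interpret group G unfolding G_def dihedral_artin_group_def by (rule group_presented_group)
  have car: "carrier G = range c"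
    by (simp add: G_def c_def dihedral_artin_group_def presented_group_def)
  have cl: "c u \<in> carrier G" for u by (simp add: car)
  have mult: "c u \<otimes>\<^bsub>G\<^esub> c v = c (u @ v)" for u v
    by (simp add: G_def c_def dihedral_artin_group_def pres_class_mult)
  have one: "\<one>\<^bsub>G\<^esub> = c []"
    by (simp add: G_def c_def dihedral_artin_group_def presented_group_def)
  have x: "torus_x m = c (alternating m A B)" and y: "torus_y m = c [(A, False), (B, False)]"
    by (simp_all add: torus_x_def torus_y_def c_def)
  have "subgroup H G"
    unfolding H_def by (rule generate_is_subgroup) (simp add: x y cl)
  then interpret H: subgroup H G .
  have xH: "torus_x m \<in> H" and yH: "torus_y m \<in> H"
    by (simp_all add: H_def generate.incl)
  have cancel: "c v \<in> H" if "c u \<in> H" "c (u @ v) \<in> H" for u v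
  proof -
    have "c v = inv\<^bsub>G\<^esub> (c u) \<otimes>\<^bsub>G\<^esub> c (u @ v)"
      by (simp add: mult[symmetric] inv_solve_left cl)
    then show ?thesis using that by simp
  qed
  have A_aux: "c [(A, False)] \<in> H" if "c (alternating (2 * k + 1) A B) \<in> H" for k
    using that
  proof (induction k)
    case (Suc k)
    then have "c ([(A, False), (B, False)] @ alternating (2 * k + 1) A B) \<in> H" by simp
    then have "c (alternating (2 * k + 1) A B) \<in> H"
      by (rule cancel[rotated]) (use yH y in simp)
    then show ?case by (rule Suc.IH)
  qed simp
  obtain k where "m = 2 * k + 1" using assms by (auto elim: oddE)
  then have AH: "c [(A, False)] \<in> H" using A_aux xH x by simp
  have BH: "c [(B, False)] \<in> H"
    using cancel[OF AH, of "[(B, False)]"] yH y by simp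
  have pos: "c [(s, False)] \<in> H" for s using AH BH by (cases s) auto
  have "c [(s, False), (s, True)] = c []" for s
    unfolding c_def pres_class_eq_iff using pres_eq.cancel[of _ s False] by simp
  then have neg: "c [(s, True)] \<in> H" for s
    using cancel[OF pos, of s "[(s, True)]"] by (simp add: one[symmetric])
  have "c u \<in> H" for u
  proof (induction u)
    case Nil
    show ?case by (simp add: one[symmetric])
  next
    case (Cons l u)
    have "c [l] \<in> H" using pos neg by (metis (full_types) surj_pair)
    then have "c [l] \<otimes>\<^bsub>G\<^esub> c u \<in> H" using Cons by simp
    then show ?case by (simp add: mult)
  qed
  then have "H = carrier G" using H.subset by (auto simp: car)
  then show ?thesis by (simp add: H_def G_def)
qed


section \<open>Random access machines\<close>

text \<open>Registers \<open>0, 1, 2, \<dots>\<close> hold natural numbers and are initially \<open>0\<close>; subtraction is truncated.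
  The input is a read-only, one-way tape of natural numbers, on which reading past the end yields
  \<open>0\<close>. Every instruction takes one unit of time, and there is no multiplication.\<close>

datatype instr =
  Const nat nat        \<comment> \<open>\<open>Const i c\<close>: \<open>R\<^sub>i := c\<close>\<close>
| Add nat nat nat      \<comment> \<open>\<open>Add i j k\<close>: \<open>R\<^sub>i := R\<^sub>j + R\<^sub>k\<close>\<close>
| Sub nat nat nat      \<comment> \<open>\<open>Sub i j k\<close>: \<open>R\<^sub>i := max 0 (R\<^sub>j - R\<^sub>k)\<close>\<close>
| Load nat nat         \<comment> \<open>\<open>Load i j\<close>: \<open>R\<^sub>i := R[R\<^sub>j]\<close>\<close>
| Store nat nat        \<comment> \<open>\<open>Store i j\<close>: \<open>R[R\<^sub>i] := R\<^sub>j\<close>\<close>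
| Read nat             \<comment> \<open>\<open>Read i\<close>: \<open>R\<^sub>i :=\<close> next input symbol\<close>
| Jump nat
| JumpZero nat nat     \<comment> \<open>\<open>JumpZero i l\<close>: go to \<open>l\<close> if \<open>R\<^sub>i = 0\<close>\<close>
| Halt bool            \<comment> \<open>stop with the given answer\<close>

text \<open>Program counter, registers, unread input.\<close>

type_synonym config = "nat \<times> (nat \<Rightarrow> nat) \<times> nat list"

fun exec :: "instr \<Rightarrow> config \<Rightarrow> config" where
  "exec (Const i c) (pc, R, inp) = (Suc pc, R(i := c), inp)"
| "exec (Add i j k) (pc, R, inp) = (Suc pc, R(i := R j + R k), inp)"
| "exec (Sub i j k) (pc, R, inp) = (Suc pc, R(i := R j - R k), inp)"
| "exec (Load i j) (pc, R, inp) = (Suc pc, R(i := R (R j)), inp)"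
| "exec (Store i j) (pc, R, inp) = (Suc pc, R(R i := R j), inp)"
| "exec (Read i) (pc, R, inp) =
     (Suc pc, R(i := (case inp of [] \<Rightarrow> 0 | c # _ \<Rightarrow> c)), tl inp)"
| "exec (Jump l) (pc, R, inp) = (l, R, inp)"
| "exec (JumpZero i l) (pc, R, inp) = (if R i = 0 then l else Suc pc, R, inp)"
| "exec (Halt b) c = c"

definition ram_step :: "instr list \<Rightarrow> config \<Rightarrow> config" where
  "ram_step P c = (if fst c < length P then exec (P ! fst c) c else c)"

text \<open>A halted configuration is a fixed point of \<open>ram_step\<close>, so the answer is unique. A machine
  whose program counter leaves the program never answers.\<close>

definition ram_answers_within :: "instr list \<Rightarrow> nat list \<Rightarrow> bool \<Rightarrow> nat \<Rightarrow> bool" where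
  "ram_answers_within P inp b t \<longleftrightarrow>
     (\<exists>n\<le>t. let (pc, _, _) = (ram_step P ^^ n) (0, \<lambda>_. 0, inp)
            in pc < length P \<and> P ! pc = Halt b)"

text \<open>A (promise) decision problem consists of a set of instances, a length and an input encoding
  for the instances, and the set of yes-instances. Nothing is required of the machine on inputs
  that do not encode an instance.\<close>

definition linear_time_decidable ::
  "'i set \<Rightarrow> ('i \<Rightarrow> nat) \<Rightarrow> ('i \<Rightarrow> nat list) \<Rightarrow> ('i \<Rightarrow> bool) \<Rightarrow> bool" where
  "linear_time_decidable I len enc yes \<longleftrightarrow>
     (\<exists>P T. (\<lambda>n. real (T n)) \<in> O(\<lambda>n. real n) \<and>
            (\<forall>i\<in>I. ram_answers_within P (enc i) (yes i) (T (len i))))"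


section \<open>The uniform twisted conjugacy problem\<close>

definition twisted_conjugate ::
  "('g, 'b) monoid_scheme \<Rightarrow> ('g \<Rightarrow> 'g) \<Rightarrow> 'g \<Rightarrow> 'g \<Rightarrow> bool" where
  "twisted_conjugate G \<psi> u v \<longleftrightarrow>
     (\<exists>w\<in>carrier G. v = inv\<^bsub>G\<^esub> (\<psi> w) \<otimes>\<^bsub>G\<^esub> u \<otimes>\<^bsub>G\<^esub> w)"

text \<open>Let \<open>gs\<close> be a list of generators of \<open>G\<close>. Words over the inverse-closed set
  \<open>X = {g, g\<^sup>-\<^sup>1 | g \<in> gs}\<close> are words over the positions in \<open>gs\<close>.\<close>

definition words_over :: "'g list \<Rightarrow> nat word set" where
  "words_over gs = {w. \<forall>(i, e)\<in>set w. i < length gs}"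

primrec word_value :: "('g, 'b) monoid_scheme \<Rightarrow> 'g list \<Rightarrow> nat word \<Rightarrow> 'g" where
  "word_value G gs [] = \<one>\<^bsub>G\<^esub>"
| "word_value G gs (l # w) =
     (case l of (i, e) \<Rightarrow> if e then inv\<^bsub>G\<^esub> (gs ! i) else gs ! i) \<otimes>\<^bsub>G\<^esub> word_value G gs w"

text \<open>In an instance \<open>(u, v, \<psi>, ws)\<close> the words \<open>ws\<close> represent the images under \<open>\<psi>\<close> of the
  generators, in the order of \<open>gs\<close>. The machine only sees \<open>u\<close>, \<open>v\<close> and \<open>ws\<close>; when \<open>gs\<close> generates
  \<open>G\<close> these determine \<open>\<psi>\<close>.\<close>

type_synonym 'g tcp_instance = "nat word \<times> nat word \<times> ('g \<Rightarrow> 'g) \<times> nat word list"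

definition tcp_instances :: "('g, 'b) monoid_scheme \<Rightarrow> 'g list \<Rightarrow> 'g tcp_instance set" where
  "tcp_instances G gs =
     {(u, v, \<psi>, ws). u \<in> words_over gs \<and> v \<in> words_over gs \<and> \<psi> \<in> auto G \<and>
        set ws \<subseteq> words_over gs \<and> map (word_value G gs) ws = map \<psi> gs}"

fun tcp_size :: "'g tcp_instance \<Rightarrow> nat" where
  "tcp_size (u, v, \<psi>, ws) = length u + length v + sum_list (map length ws)"

text \<open>One input symbol per letter, and \<open>0\<close> as an end marker after each word.\<close>

definition encode_word :: "nat word \<Rightarrow> nat list" where
  "encode_word w = map (\<lambda>(i, e). if e then 2 * i + 2 else 2 * i + 1) w @ [0]"

fun tcp_encode :: "'g tcp_instance \<Rightarrow> nat list" where
  "tcp_encode (u, v, \<psi>, ws) = encode_word u @ encode_word v @ concat (map encode_word ws)"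

fun tcp_yes :: "('g, 'b) monoid_scheme \<Rightarrow> 'g list \<Rightarrow> 'g tcp_instance \<Rightarrow> bool" where
  "tcp_yes G gs (u, v, \<psi>, ws) \<longleftrightarrow>
     twisted_conjugate G \<psi> (word_value G gs u) (word_value G gs v)"

definition tcp_linear_time :: "('g, 'b) monoid_scheme \<Rightarrow> 'g list \<Rightarrow> bool" where
  "tcp_linear_time G gs \<longleftrightarrow>
     linear_time_decidable (tcp_instances G gs) tcp_size tcp_encode (tcp_yes G gs)"

end

theory Submission
  imports Defs
begin

text \<open>
  For odd \<open>m = 2 k + 1\<close> the dihedral Artin group is \<open>G = \<langle>x, y | x\<^sup>2 = y\<^sup>m\<rangle>\<close>. Its centre is generated by
  \<open>z = x\<^sup>2 = y\<^sup>m\<close> and the quotient is the free product \<open>C\<^sub>2 * C\<^sub>m\<close>, in which elements have normal forms. An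
  element of \<open>G\<close> is determined by its normal form \<open>N\<close> and its image \<open>ab\<close> in the abelianization \<open>\<int>\<close>
  (\<open>x \<mapsto> m\<close>, \<open>y \<mapsto> 2\<close>), since \<open>ab z \<noteq> 0\<close>; this is the setting of the locale \<open>torus_knot\<close>, and
  \<open>torus_knot_dihedral_artin\<close> provides it for the presented group, through an action of the Artin
  generators on normal forms.

  Every automorphism \<open>\<psi>\<close> is an inner automorphism composed with the identity or with the
  automorphism that inverts \<open>x\<close> and \<open>y\<close> (\<open>automorphism_inner\<close>). Indeed, the images of the generators
  are torsion modulo the centre, hence conjugate into the factors of the free product, and two
  conjugates \<open>x\<close> and \<open>q y q\<^sup>-\<^sup>1\<close> can generate the free product only for trivial reasons
  (\<open>not_surjective\<close>). If \<open>\<psi>\<close> conjugates by \<open>g\<close>, then \<open>\<psi>\<close>-twisted conjugacy of \<open>u\<close> and \<open>v\<close> is conjugacy of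
  \<open>g\<^sup>-\<^sup>1 u\<close> and \<open>g\<^sup>-\<^sup>1 v\<close>, possibly twisted by the inverting automorphism; and the normal form of \<open>g\<^sup>-\<^sup>1\<close> is,
  up to a factor \<open>x\<close>, half of that of \<open>\<psi> x = g x\<^bsup>\<plusminus>1\<^esup> g\<^sup>-\<^sup>1\<close> (\<open>N_inverse_half\<close>).

  It remains to decide the two special relations. Modulo the centre, cyclic reduction (\<open>core\<close>) brings
  both elements to cyclic words, and these are conjugate if and only if one is a (twisted) rotation of
  the other (\<open>rotation_complete\<close>). For ordinary conjugacy the centre is controlled by the
  equality of the abelianizations. For twisted conjugacy, \<open>z\<close> itself changes an element by \<open>z\<^sup>2\<close>, so that
  only a parity is left, and it can be read off modulo \<open>4\<close> from the abelianizations and the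
  number of letters \<open>x\<close> in the conjugating element. This gives the test \<open>accepts\<close>
  (\<open>twisted_conjugate_iff_accepts\<close>).

  All of this takes linear time: normal forms are computed on a stack with one operation per
  letter, cyclic reduction works inwards from the two ends, and the rotations of a cyclic word are
  enumerated with a number in base \<open>m\<close> that encodes the current rotation, is updated in a bounded number
  of steps, and is compared with the number of the other word. The machine adds numbers of any size
  in one unit of time, and so these comparisons take the place of string matching.
  The programs are written in a small language without jumps whose compiler preserves running times
  exactly (\<open>compile_correct\<close>).\<close>

section \<open>Normal forms in the free product\<close>

text \<open>The list \<open>[j\<^sub>0, j\<^sub>1, \<dots>, j\<^sub>k]\<close> stands for \<open>y\<^bsup>j\<^sub>0\<^esup> x y\<^bsup>j\<^sub>1\<^esup> x \<dots> x y\<^bsup>j\<^sub>k\<^esup>\<close>.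
  Writing down every exponent of \<open>y\<close>, also a zero at either end, makes each of the two right
  multiplications \<open>push_x\<close> and \<open>push_y\<close> a change at the end of the list, so that the list can be
  kept as a stack.\<close>

definition nf :: "nat \<Rightarrow> nat list \<Rightarrow> bool" where
  "nf m l \<longleftrightarrow> l \<noteq> [] \<and> (\<forall>d\<in>set l. d < m) \<and> 0 \<notin> set (butlast (tl l))"

definition push_x :: "nat list \<Rightarrow> nat list" where
  "push_x l = (if last l = 0 \<and> length l \<ge> 2 then butlast l else l @ [0])"

definition push_y :: "nat \<Rightarrow> nat \<Rightarrow> nat list \<Rightarrow> nat list" where
  "push_y m j l = butlast l @ [(last l + j) mod m]"

lemma list_ends_cases:
  obtains "l = []" | d where "l = [d]" | a l' b where "l = a # l' @ [b]"
proof (cases l)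
  case (Cons a t)
  then show thesis using that by (cases t rule: rev_cases) auto
qed (use that in auto)

lemma nf_single [simp]: "nf m [d] \<longleftrightarrow> d < m"
  by (simp add: nf_def)

lemma nf_ends [simp]: "nf m (a # l @ [b]) \<longleftrightarrow> a < m \<and> b < m \<and> (\<forall>d\<in>set l. 0 < d \<and> d < m)"
  by (auto simp: nf_def butlast_append intro: gr0I)

text \<open>These instances have list patterns that simplification produces but \<open>nf_ends\<close> does not match.\<close>

lemma nf_ends2 [simp]:
  "nf m [a, b] \<longleftrightarrow> a < m \<and> b < m"
  "nf m (a # l @ [c, b]) \<longleftrightarrow> a < m \<and> b < m \<and> 0 < c \<and> c < m \<and> (\<forall>d\<in>set l. 0 < d \<and> d < m)"
  using nf_ends[of m a "[]" b] nf_ends[of m a "l @ [c]" b] by auto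

lemma nf_Nil [simp]: "\<not> nf m []"
  by (simp add: nf_def)

lemma nf_middle_nonzero: "nf m (a @ e # b) \<Longrightarrow> a \<noteq> [] \<Longrightarrow> b \<noteq> [] \<Longrightarrow> 0 < e"
  by (cases a) (auto simp: nf_def butlast_append)

lemma nf_push_x:
  assumes "nf m l"
  shows "nf m (push_x l)"
proof (cases l rule: list_ends_cases)
  case (3 a l' b)
  show ?thesis
  proof (cases "b = 0")
    case True
    then show ?thesis using 3 assms
      by (cases l' rule: rev_cases) (auto simp: push_x_def butlast_append)
  next
    case False
    then show ?thesis using 3 assms nf_ends[of m a "l' @ [b]" 0]
      by (auto simp: push_x_def)
  qed
qed (use assms in \<open>auto simp: push_x_def nf_def\<close>)

lemma nf_push_y: "nf m l \<Longrightarrow> nf m (push_y m j l)"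
  by (cases l rule: list_ends_cases) (auto simp: push_y_def butlast_append)

lemma push_x_push_x: "nf m l \<Longrightarrow> push_x (push_x l) = l"
proof (cases l rule: list_ends_cases)
  case (3 a l' b)
  moreover assume "nf m l"
  ultimately show ?thesis
    by (cases l' rule: rev_cases) (auto simp: push_x_def butlast_append)
qed (auto simp: push_x_def)

lemma push_y_push_y: "l \<noteq> [] \<Longrightarrow> push_y m j (push_y m i l) = push_y m (i + j) l"
  by (simp add: push_y_def mod_simps add.assoc)

lemma push_y_multiple: "nf m l \<Longrightarrow> push_y m (m * i) l = l"
  by (simp add: push_y_def nf_def)

lemma push_nonempty [simp]: "push_x l \<noteq> []" "push_y m j l \<noteq> []"
proof -
  show "push_x l \<noteq> []"
    by (cases l rule: list_ends_cases) (auto simp: push_x_def)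
qed (simp add: push_y_def)

text \<open>The exponent of the inverse of \<open>y\<^bsup>j\<^esup>\<close>; it is \<open>0\<close> for \<open>j = 0\<close>.\<close>

definition neg_mod :: "nat \<Rightarrow> nat \<Rightarrow> nat" where
  "neg_mod m j = (m - j) mod m"

text \<open>The product of two normal forms when at most one entry has to be recomputed: no cancellation
  goes past the place where they meet.\<close>

definition join_nf :: "nat \<Rightarrow> nat list \<Rightarrow> nat list \<Rightarrow> nat list" where
  "join_nf m l1 l2 = butlast l1 @ (last l1 + hd l2) mod m # tl l2"

section \<open>The torus knot group\<close>

text \<open>The group is described through its image in \<open>(C\<^sub>2 * C\<^sub>m) \<times> \<int>\<close>: \<open>N\<close> gives the normal form of an
  element modulo the centre, \<open>ab\<close> is the abelianization. The pair determines the element, which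
  replaces any explicit count of powers of the central element \<open>z = x\<^sup>2 = y\<^sup>m\<close>.\<close>

locale torus_knot = group G for G (structure) +
  fixes m :: nat and x y and N :: "'a \<Rightarrow> nat list" and ab :: "'a \<Rightarrow> int"
  assumes m_ge: "3 \<le> m" and m_odd: "odd m"
    and x_closed [simp]: "x \<in> carrier G" and y_closed [simp]: "y \<in> carrier G"
    and x_square: "x \<otimes> x = y [^] m"
    and generated: "generate G {x, y} = carrier G"
    and N_one: "N \<one> = [0]"
    and nf_N: "g \<in> carrier G \<Longrightarrow> nf m (N g)"
    and N_mult_x: "g \<in> carrier G \<Longrightarrow> N (g \<otimes> x) = push_x (N g)"
    and N_mult_y: "g \<in> carrier G \<Longrightarrow> N (g \<otimes> y) = push_y m 1 (N g)"
    and ab_mult: "g \<in> carrier G \<Longrightarrow> h \<in> carrier G \<Longrightarrow> ab (g \<otimes> h) = ab g + ab h"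
    and ab_x: "ab x = int m" and ab_y: "ab y = 2"
begin

lemma m_pos [simp]: "0 < m" using m_ge by simp

lemma inv_cancel [simp]:
  "g \<in> carrier G \<Longrightarrow> h \<in> carrier G \<Longrightarrow> inv g \<otimes> (g \<otimes> h) = h"
  "g \<in> carrier G \<Longrightarrow> h \<in> carrier G \<Longrightarrow> g \<otimes> (inv g \<otimes> h) = h"
  by (simp_all add: m_assoc[symmetric])

definition z where "z = y [^] m"

lemma z_closed [simp]: "z \<in> carrier G" by (simp add: z_def)

lemma x_x: "x \<otimes> x = z" by (simp add: x_square z_def)

lemma generated_induct [consumes 1, case_names one x y x_inv y_inv mult]:
  assumes "g \<in> carrier G" "P \<one>" "P x" "P y" "P (inv x)" "P (inv y)"
    "\<And>g h. g \<in> carrier G \<Longrightarrow> h \<in> carrier G \<Longrightarrow> P g \<Longrightarrow> P h \<Longrightarrow> P (g \<otimes> h)"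
  shows "P g"
proof -
  have "g \<in> generate G {x, y}" using assms(1) generated by simp
  then show ?thesis
  proof (induction rule: generate.induct)
    case (eng h1 h2)
    then show ?case using assms(7) generated by simp
  qed (use assms in auto)
qed

lemma commute_inv: "a \<in> carrier G \<Longrightarrow> b \<in> carrier G \<Longrightarrow> a \<otimes> b = b \<otimes> a \<Longrightarrow> a \<otimes> inv b = inv b \<otimes> a"
  by (metis inv_closed inv_solve_left' inv_solve_right m_assoc m_closed)

lemma z_comm: "g \<in> carrier G \<Longrightarrow> z \<otimes> g = g \<otimes> z"
proof (induction g rule: generated_induct)
  case x show ?case by (simp add: x_x[symmetric] m_assoc)
next
  case y show ?case unfolding z_def by (metis nat_pow_comm nat_pow_eone y_closed)
next
  case x_inv show ?case by (rule commute_inv) (simp_all add: x_x[symmetric] m_assoc)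
next
  case y_inv show ?case unfolding z_def
    by (rule commute_inv) (simp_all, metis nat_pow_comm nat_pow_eone y_closed)
next
  case (mult g h) then show ?case by (metis m_assoc z_closed)
qed simp

lemma zc_comm: "g \<in> carrier G \<Longrightarrow> z [^] (c::int) \<otimes> g = g \<otimes> z [^] c"
proof -
  assume g: "g \<in> carrier G"
  have nat: "z [^] (n::nat) \<otimes> g = g \<otimes> z [^] n" for n
    using g group_commutes_pow[OF z_comm[OF g]] by simp
  show ?thesis
  proof (cases c rule: int_cases2)
    case (nonneg n) then show ?thesis using nat by (simp add: int_pow_int)
  next
    case (nonpos n)
    then show ?thesis using nat[of n] g by (simp add: int_pow_neg_int commute_inv[symmetric])
  qed
qed

lemma zc_left_comm: "g \<in> carrier G \<Longrightarrow> h \<in> carrier G \<Longrightarrow> z [^] (c::int) \<otimes> (g \<otimes> h) = g \<otimes> (z [^] c \<otimes> h)"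
  by (metis zc_comm m_assoc int_pow_closed z_closed)

lemma N_nonempty [simp]: "g \<in> carrier G \<Longrightarrow> N g \<noteq> []"
  using nf_N[of g] by (auto simp: nf_def)

lemma N_mult_y_pow: "g \<in> carrier G \<Longrightarrow> N (g \<otimes> y [^] (j::nat)) = push_y m j (N g)"
proof (induction j)
  case 0 then show ?case using push_y_multiple[OF nf_N, of g 0] by simp
next
  case (Suc j) then show ?case
    by (simp add: m_assoc[symmetric] N_mult_y push_y_push_y)
qed

text \<open>Negative powers need no separate computation: the claim for \<open>z\<^sup>n\<close>, applied to
  \<open>g \<otimes> z\<^sup>-\<^sup>n\<close>, says that \<open>g\<close> and \<open>g \<otimes> z\<^sup>-\<^sup>n\<close> have the same normal form.\<close>

lemma N_mult_z: "g \<in> carrier G \<Longrightarrow> N (g \<otimes> z [^] (c::int)) = N g"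
proof -
  have nat: "N (g \<otimes> z [^] (n::nat)) = N g" if "g \<in> carrier G" for n g
    using that N_mult_y_pow[of g "m * n"] push_y_multiple[OF nf_N, of g n]
    by (simp add: z_def nat_pow_pow)
  assume g: "g \<in> carrier G"
  show ?thesis
  proof (cases c rule: int_cases2)
    case (nonneg n) then show ?thesis using nat[OF g] by (simp add: int_pow_int)
  next
    case (nonpos n)
    then show ?thesis using nat[of "g \<otimes> z [^] c" n] g by (simp add: int_pow_neg_int m_assoc)
  qed
qed

fun el :: "nat list \<Rightarrow> 'a" where
  "el [] = \<one>"
| "el [j] = y [^] j"
| "el (j # l) = y [^] j \<otimes> x \<otimes> el l"

lemma el_Cons: "l \<noteq> [] \<Longrightarrow> el (j # l) = y [^] j \<otimes> x \<otimes> el l"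
  by (cases l) auto

lemma el_closed [simp]: "el l \<in> carrier G"
  by (induction l rule: el.induct) auto

lemma el_append: "l \<noteq> [] \<Longrightarrow> l' \<noteq> [] \<Longrightarrow> el (l @ l') = el l \<otimes> x \<otimes> el l'"
  by (induction l rule: el.induct) (auto simp: el_Cons m_assoc)

lemma y_pow_add: "y [^] (i::nat) \<otimes> y [^] (j::nat) = y [^] (i + j)"
  by (simp add: nat_pow_mult)

lemma y_pow_add_left: "g \<in> carrier G \<Longrightarrow> y [^] (i::nat) \<otimes> (y [^] (j::nat) \<otimes> g) = y [^] (i + j) \<otimes> g"
  by (simp add: nat_pow_mult m_assoc[symmetric])

lemma x_x_left: "g \<in> carrier G \<Longrightarrow> x \<otimes> (x \<otimes> g) = z \<otimes> g"
  by (simp add: m_assoc[symmetric] x_x)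

lemma el_mult_Cons: "el [i] \<otimes> el (j # l) = el ((i + j) # l)"
  by (cases l) (simp_all add: y_pow_add y_pow_add_left m_assoc)

lemma el_mult:
  assumes "l \<noteq> []" "l' \<noteq> []"
  shows "el l \<otimes> el l' = el (butlast l @ (last l + hd l') # tl l')"
proof -
  obtain a i where l: "l = a @ [i]" using assms(1) by (cases l rule: rev_cases) auto
  obtain j b where l': "l' = j # b" using assms(2) by (cases l') auto
  show ?thesis
  proof (cases "a = []")
    case True then show ?thesis using el_mult_Cons l l' by simp
  next
    case False
    then show ?thesis using l l' el_append[of a "(i + j) # b"] el_append[of a "[i]"]
      by (simp add: m_assoc el_mult_Cons[symmetric])
  qed
qed

lemma y_pow_mod: "y [^] (j::nat) = y [^] (j mod m) \<otimes> z [^] (int (j div m))"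
  by (simp add: z_def int_pow_int nat_pow_pow nat_pow_mult)

lemma normal_form_closed_step:
  assumes "nf m l"
  shows "\<exists>c::int. el l \<otimes> x = el (push_x l) \<otimes> z [^] c"
    "\<exists>c::int. el l \<otimes> y [^] j = el (push_y m j l) \<otimes> z [^] c"
proof -
  have ne: "l \<noteq> []" using assms by auto
  show "\<exists>c::int. el l \<otimes> x = el (push_x l) \<otimes> z [^] c"
  proof (cases "last l = 0 \<and> length l \<ge> 2")
    case True
    then obtain l' where l': "l = l' @ [0]" "l' \<noteq> []"
      by (metis One_nat_def Suc_1 append_Nil append_butlast_last_id length_0_conv length_append_singleton list.size(3) not_less_eq_eq le_numeral_extra(1) zero_le)
    then have "el l \<otimes> x = el (push_x l) \<otimes> z [^] (1::int)"
      by (simp add: push_x_def el_append m_assoc x_x Suc_le_eq)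
    then show ?thesis by blast
  next
    case False
    then have "push_x l = l @ [0]" unfolding push_x_def by (rule if_not_P)
    then have "el l \<otimes> x = el (push_x l) \<otimes> z [^] (0::int)"
      using ne by (simp add: el_append)
    then show ?thesis by blast
  qed
  have "el l \<otimes> y [^] j = el (butlast l @ [last l + j])"
    using el_mult[of l "[j]"] ne by simp
  also have "\<dots> = el (push_y m j l) \<otimes> z [^] int ((last l + j) div m)"
    by (cases "butlast l = []")
      (simp_all add: push_y_def el_append m_assoc y_pow_mod[of "last l + j", symmetric])
  finally show "\<exists>c::int. el l \<otimes> y [^] j = el (push_y m j l) \<otimes> z [^] c" by blast
qed

text \<open>The elements of this shape are closed under right multiplication by \<open>x\<close> and \<open>y\<close>. They are also
  closed under right multiplication by the inverses, which are \<open>x z\<^sup>-\<^sup>1\<close> and \<open>y\<^sup>m\<^sup>-\<^sup>1 z\<^sup>-\<^sup>1\<close>.\<close>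

lemma normal_form_exists:
  assumes "g \<in> carrier G"
  shows "\<exists>l (c::int). nf m l \<and> g = el l \<otimes> z [^] c"
proof -
  define K where "K = {el l \<otimes> z [^] c | l (c::int). nf m l}"
  have Kz: "k \<otimes> z [^] c \<in> K" if k: "k \<in> K" for k and c :: int
  proof -
    obtain l and c' :: int where l: "nf m l" "k = el l \<otimes> z [^] c'" using k unfolding K_def by blast
    then have "k \<otimes> z [^] c = el l \<otimes> z [^] (c' + c)" by (simp add: m_assoc int_pow_mult)
    then show ?thesis using l(1) unfolding K_def by blast
  qed
  have Kx: "k \<otimes> x \<in> K" if k: "k \<in> K" for k
  proof -
    obtain l and c :: int where l: "nf m l" "k = el l \<otimes> z [^] c" using k unfolding K_def by blast
    obtain c' :: int where "el l \<otimes> x = el (push_x l) \<otimes> z [^] c'"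
      using normal_form_closed_step(1)[OF l(1)] by blast
    then have "k \<otimes> x = el (push_x l) \<otimes> z [^] c' \<otimes> z [^] c"
      using l zc_comm[of _ c] by (metis el_closed int_pow_closed m_assoc nat_pow_closed x_closed y_closed z_closed)
    moreover have "el (push_x l) \<otimes> z [^] c' \<in> K" using nf_push_x[OF l(1)] unfolding K_def by blast
    ultimately show ?thesis using Kz by simp
  qed
  have Ky: "k \<otimes> y [^] j \<in> K" if k: "k \<in> K" for k and j :: nat
  proof -
    obtain l and c :: int where l: "nf m l" "k = el l \<otimes> z [^] c" using k unfolding K_def by blast
    obtain c' :: int where "el l \<otimes> y [^] j = el (push_y m j l) \<otimes> z [^] c'"
      using normal_form_closed_step(2)[OF l(1)] by blast
    then have "k \<otimes> y [^] j = el (push_y m j l) \<otimes> z [^] c' \<otimes> z [^] c"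
      using l zc_comm[of _ c] by (metis el_closed int_pow_closed m_assoc nat_pow_closed x_closed y_closed z_closed)
    moreover have "el (push_y m j l) \<otimes> z [^] c' \<in> K" using nf_push_y[OF l(1)] unfolding K_def by blast
    ultimately show ?thesis using Kz by simp
  qed
  have K_closed: "k \<in> carrier G" if "k \<in> K" for k using that unfolding K_def by auto
  have "\<forall>k\<in>K. k \<otimes> g \<in> K" using assms
  proof (induction g rule: generated_induct)
    case one then show ?case using K_closed by simp
  next
    case x then show ?case using Kx by simp
  next
    case y then show ?case using Ky[of _ 1] by simp
  next
    case x_inv
    have "inv x = x \<otimes> z [^] (-1::int)"
    proof (rule inv_equality)
      have "x \<otimes> z [^] (-1::int) \<otimes> x = x \<otimes> x \<otimes> z [^] (-1::int)"
        by (simp only: m_assoc zc_comm x_closed int_pow_closed z_closed)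
      then show "x \<otimes> z [^] (-1::int) \<otimes> x = \<one>" by (simp add: int_pow_neg x_x)
    qed simp_all
    then show ?case using Kx Kz K_closed by (simp add: m_assoc[symmetric])
  next
    case y_inv
    have "inv y = y [^] (m - 1) \<otimes> z [^] (-1::int)"
    proof (rule inv_equality)
      have "y [^] (m - 1) \<otimes> z [^] (-1::int) \<otimes> y = y [^] (m - 1) \<otimes> y \<otimes> z [^] (-1::int)"
        by (simp only: m_assoc zc_comm y_closed int_pow_closed nat_pow_closed z_closed)
      also have "y [^] (m - 1) \<otimes> y = z"
        using nat_pow_Suc[of y "m - 1"] by (simp add: z_def del: nat_pow_Suc)
      finally show "y [^] (m - 1) \<otimes> z [^] (-1::int) \<otimes> y = \<one>" by (simp add: int_pow_neg)
    qed simp_all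
    then show ?case using Ky Kz K_closed by (simp add: m_assoc[symmetric])
  next
    case (mult g h)
    then show ?case using K_closed by (simp add: m_assoc[symmetric])
  qed
  moreover have "\<one> \<in> K"
    unfolding K_def by (rule CollectI, rule exI[of _ "[0]"], rule exI[of _ 0]) simp
  ultimately have "g \<in> K" using assms by force
  then show ?thesis unfolding K_def by blast
qed

text \<open>The word \<open>el l\<close> is appended letter by letter. If the joined list is in normal form, then none
  of these letters cancels.\<close>

lemma N_mult_el:
  assumes "g \<in> carrier G" "l \<noteq> []" "nf m (join_nf m (N g) l)" "\<forall>d\<in>set (tl l). d < m"
  shows "N (g \<otimes> el l) = join_nf m (N g) l"
  using assms
proof (induction l arbitrary: g)
  case (Cons j l)
  have N1: "N (g \<otimes> y [^] j) = butlast (N g) @ [(last (N g) + j) mod m]"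
    using Cons.prems by (simp add: N_mult_y_pow push_y_def)
  show ?case
  proof (cases "l = []")
    case True then show ?thesis using N1 by (simp add: join_nf_def)
  next
    case False
    then obtain i l' where l: "l = i # l'" by (cases l) auto
    have "\<not> (last (N (g \<otimes> y [^] j)) = 0 \<and> length (N (g \<otimes> y [^] j)) \<ge> 2)"
      using nf_middle_nonzero[of m "butlast (N g)" "(last (N g) + j) mod m" l] Cons.prems(3) False
      by (cases "butlast (N g) = []") (simp_all add: N1 join_nf_def)
    then have N2: "N (g \<otimes> y [^] j \<otimes> x) = N (g \<otimes> y [^] j) @ [0]"
      using Cons.prems(1) by (auto simp: N_mult_x push_x_def)
    have "join_nf m (N (g \<otimes> y [^] j \<otimes> x)) l = join_nf m (N g) (j # l)"
      using Cons.prems by (simp add: N2 N1 join_nf_def l butlast_append)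
    then show ?thesis using Cons.IH[of "g \<otimes> y [^] j \<otimes> x"] Cons.prems False
      by (simp add: el_Cons m_assoc l)
  qed
qed simp

lemma N_el: "nf m l \<Longrightarrow> N (el l) = l"
  using N_mult_el[of \<one> l] by (cases l) (auto simp: N_one join_nf_def nf_def)

lemma normal_form: "g \<in> carrier G \<Longrightarrow> \<exists>c::int. g = el (N g) \<otimes> z [^] c"
  using normal_form_exists[of g] by (metis N_el N_mult_z el_closed)

text \<open>The kernel of the projection to \<open>C\<^sub>2 * C\<^sub>m\<close> is generated by \<open>z\<close>. In the sequel equality modulo
  this kernel is written as an equation between values of \<open>N\<close>.\<close>

lemma N_eq_iff:
  assumes "g \<in> carrier G" "h \<in> carrier G"
  shows "N g = N h \<longleftrightarrow> (\<exists>c::int. g = h \<otimes> z [^] c)"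
proof
  assume eq: "N g = N h"
  obtain c d :: int where "g = el (N g) \<otimes> z [^] c" "h = el (N h) \<otimes> z [^] d"
    using normal_form assms by meson
  then have "g = h \<otimes> z [^] (c - d)"
    using eq by (metis (no_types, lifting) add_diff_cancel_left' diff_add_cancel el_closed int_pow_closed int_pow_mult m_assoc z_closed add.commute)
  then show "\<exists>c::int. g = h \<otimes> z [^] c" ..
qed (use assms N_mult_z in auto)

lemma N_mult_cong:
  assumes "N g = N g'" "N h = N h'" and [simp]: "g \<in> carrier G" "g' \<in> carrier G" "h \<in> carrier G" "h' \<in> carrier G"
  shows "N (g \<otimes> h) = N (g' \<otimes> h')"
proof -
  obtain c d :: int where "g = g' \<otimes> z [^] c" "h = h' \<otimes> z [^] d"
    using assms N_eq_iff by meson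
  moreover have "z [^] c \<otimes> (h' \<otimes> z [^] d) = h' \<otimes> z [^] (c + d)"
    by (simp add: zc_left_comm int_pow_mult)
  ultimately have "g \<otimes> h = g' \<otimes> h' \<otimes> z [^] (c + d)"
    by (simp add: m_assoc)
  then show ?thesis by (simp add: N_mult_z)
qed

lemma N_inv_cong:
  assumes "N g = N g'" and [simp]: "g \<in> carrier G" "g' \<in> carrier G"
  shows "N (inv g) = N (inv g')"
proof -
  obtain c :: int where "g = g' \<otimes> z [^] c" using assms N_eq_iff by meson
  then have "inv g = inv g' \<otimes> z [^] (-c)"
    by (simp add: inv_mult_group int_pow_neg[symmetric] zc_comm)
  then show ?thesis by (simp add: N_mult_z)
qed

end

section \<open>Cyclic words and their twisted rotations\<close>

text \<open>With \<open>tw\<close>, the effect on exponents of the automorphism that inverts both generators.\<close>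

definition flip :: "nat \<Rightarrow> bool \<Rightarrow> nat \<Rightarrow> nat" where
  "flip m tw j = (if tw then neg_mod m j else j)"

text \<open>A nonempty sequence \<open>S\<close> stands for the cyclic word \<open>y\<^bsup>s\<^sub>1\<^esup> x \<dots> y\<^bsup>s\<^sub>k\<^esup> x\<close>, whose normal form is
  \<open>S @ [0]\<close>. A syllable \<open>y\<^bsup>s\<^esup> x\<close> that is moved from the front to the back passes through the
  automorphism on the way.\<close>

definition rot :: "nat \<Rightarrow> bool \<Rightarrow> nat list \<Rightarrow> nat list" where
  "rot m tw S = tl S @ [flip m tw (hd S)]"

text \<open>The sequence \<open>[0]\<close>, standing for the single letter \<open>x\<close>, is the only one with a vanishing
  exponent that is cyclically reduced.\<close>

definition cyclic :: "nat \<Rightarrow> nat list \<Rightarrow> bool" where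
  "cyclic m S \<longleftrightarrow> S \<noteq> [] \<and> (\<forall>d\<in>set S. d < m) \<and> (S = [0] \<or> 0 \<notin> set S)"

lemma nf_positive: "l \<noteq> [] \<Longrightarrow> \<forall>d\<in>set l. 0 < d \<and> d < m \<Longrightarrow> nf m l"
  by (cases l rule: list_ends_cases) auto

lemma neg_mod_less [simp]: "0 < m \<Longrightarrow> neg_mod m j < m"
  by (simp add: neg_mod_def)

lemma neg_mod_0 [simp]: "neg_mod m 0 = 0"
  by (simp add: neg_mod_def)

lemma neg_mod_eq_0 [simp]: "j < m \<Longrightarrow> neg_mod m j = 0 \<longleftrightarrow> j = 0"
  by (cases "j = 0") (auto simp: neg_mod_def)

lemma neg_mod_pos [simp]: "j < m \<Longrightarrow> 0 < neg_mod m j \<longleftrightarrow> 0 < j"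
  using neg_mod_eq_0[of j m] by linarith

lemma neg_mod_neg_mod [simp]: "j < m \<Longrightarrow> neg_mod m (neg_mod m j) = j"
  by (cases "j = 0") (auto simp: neg_mod_def)

lemma add_neg_mod: "j < m \<Longrightarrow> j + neg_mod m j = (if j = 0 then 0 else m)"
  by (auto simp: neg_mod_def)

lemma flip_less [simp]: "j < m \<Longrightarrow> flip m tw j < m"
  by (simp add: flip_def)

lemma flip_0 [simp]: "flip m tw 0 = 0"
  by (simp add: flip_def)

lemma flip_eq_0 [simp]: "j < m \<Longrightarrow> flip m tw j = 0 \<longleftrightarrow> j = 0"
  by (simp add: flip_def)

lemma flip_pos [simp]: "j < m \<Longrightarrow> 0 < flip m tw j \<longleftrightarrow> 0 < j"
  by (simp add: flip_def)

lemma flip_flip [simp]: "j < m \<Longrightarrow> flip m tw (flip m tw j) = j"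
  by (simp add: flip_def)

lemma mod_add_eq_0_iff:
  fixes i j m :: nat
  assumes "i < m" "j < m"
  shows "(i + j) mod m = 0 \<longleftrightarrow> j = neg_mod m i"
  using assms by (cases "i + j < m") (auto simp: neg_mod_def mod_if)

lemma rot_funpow_length: "n \<le> length S \<Longrightarrow> (rot m tw ^^ n) S = drop n S @ map (flip m tw) (take n S)"
proof (induction n)
  case (Suc n)
  then have "drop n S = S ! n # drop (Suc n) S" by (simp add: Cons_nth_drop_Suc)
  then show ?case using Suc by (simp add: rot_def take_Suc_conv_app_nth)
qed simp

text \<open>After one full turn every entry is flipped, after two turns the sequence is back.\<close>

lemma rot_period: "\<forall>d\<in>set S. d < m \<Longrightarrow> (rot m tw ^^ (2 * length S)) S = S"
proof -
  assume d: "\<forall>d\<in>set S. d < m"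
  have "(rot m tw ^^ (2 * length S)) S = (rot m tw ^^ length S) ((rot m tw ^^ length S) S)"
    by (simp add: mult_2 funpow_add)
  also have "\<dots> = (rot m tw ^^ length S) (map (flip m tw) S)"
    using rot_funpow_length[of "length S" S m tw] by simp
  also have "\<dots> = S" using rot_funpow_length[of "length S" "map (flip m tw) S" m tw] d
    by (simp add: map_idI)
  finally show ?thesis .
qed

lemma cyclic_rot: "cyclic m S \<Longrightarrow> cyclic m (rot m tw S)"
  by (cases S) (auto simp: cyclic_def rot_def)

lemma cyclic_rot_funpow: "cyclic m S \<Longrightarrow> cyclic m ((rot m tw ^^ n) S)"
  by (induction n) (auto simp: cyclic_rot)

lemma nf_cyclic: "0 < m \<Longrightarrow> cyclic m S \<Longrightarrow> nf m (S @ [0])"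
  by (cases S) (auto simp: cyclic_def intro: gr0I)

text \<open>Cyclic reduction: the last exponent is moved to the front, through the automorphism, and if the
  two ends cancel then the word has the form \<open>x u x\<close> and is replaced by \<open>u\<close>.\<close>

function core :: "nat \<Rightarrow> bool \<Rightarrow> nat list \<Rightarrow> nat list" where
  "core m tw l =
     (if length l < 2 then l
      else if (hd l + flip m tw (last l)) mod m = 0 \<and> butlast (tl l) \<noteq> [] then core m tw (butlast (tl l))
      else ((hd l + flip m tw (last l)) mod m) # butlast (tl l) @ [0])"
  by auto
termination by (relation "measure (\<lambda>(_, _, l). length l)") auto

text \<open>The number of conjugations by \<open>x\<close> in the cyclic reduction; its parity enters the test for
  twisted conjugacy.\<close>

function rounds :: "nat \<Rightarrow> bool \<Rightarrow> nat list \<Rightarrow> nat" where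
  "rounds m tw l =
     (if length l < 2 then 0
      else if (hd l + flip m tw (last l)) mod m = 0 \<and> butlast (tl l) \<noteq> [] then Suc (rounds m tw (butlast (tl l)))
      else 0)"
  by auto
termination by (relation "measure (\<lambda>(_, _, l). length l)") auto

declare core.simps [simp del] rounds.simps [simp del]

lemma core_single: "core m tw [d] = [d]" "rounds m tw [d] = 0"
  by (simp_all add: core.simps[of m tw "[d]"] rounds.simps[of m tw "[d]"])

lemma core_ends:
  assumes "(a + flip m tw b) mod m = d"
  shows "core m tw (a # l @ [b]) = (if d = 0 \<and> l \<noteq> [] then core m tw l else d # l @ [0])"
    "rounds m tw (a # l @ [b]) = (if d = 0 \<and> l \<noteq> [] then Suc (rounds m tw l) else 0)"
  using assms
  by (simp_all add: core.simps[of m tw "a # l @ [b]"] rounds.simps[of m tw "a # l @ [b]"] butlast_append)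

lemma core_nonempty: "l \<noteq> [] \<Longrightarrow> core m tw l \<noteq> []"
proof (induction m tw l rule: core.induct)
  case (1 m tw l)
  then show ?case by (subst core.simps) auto
qed

lemma core_bounded: "\<forall>d\<in>set l. d < m \<Longrightarrow> 0 < m \<Longrightarrow> \<forall>d\<in>set (core m tw l). d < m"
proof (induction m tw l rule: core.induct)
  case (1 m tw l)
  have "\<forall>d\<in>set (butlast (tl l)). d < m"
    using 1(2) by (metis in_set_butlastD list.set_sel(2) tl_Nil)
  then show ?case using 1 by (subst core.simps) auto
qed

lemma rounds_le: "rounds m tw l \<le> length l"
proof (induction m tw l rule: rounds.induct)
  case (1 m tw l)
  show ?case
  proof (cases "\<not> length l < 2 \<and> (hd l + flip m tw (last l)) mod m = 0 \<and> butlast (tl l) \<noteq> []")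
    case True
    then have "rounds m tw (butlast (tl l)) \<le> length l - 2" "2 \<le> length l" using 1 by simp_all
    then have "Suc (rounds m tw (butlast (tl l))) \<le> length l" by linarith
    then show ?thesis using True by (subst rounds.simps) simp
  qed (subst rounds.simps, auto)
qed

lemma length_core: "length (core m tw l) \<le> length l"
proof (induction m tw l rule: core.induct)
  case (1 m tw l)
  show ?case
  proof (cases "\<not> length l < 2 \<and> (hd l + flip m tw (last l)) mod m = 0 \<and> butlast (tl l) \<noteq> []")
    case True
    then have "length (core m tw (butlast (tl l))) \<le> length l - 2" using 1 by simp
    then show ?thesis using True by (subst core.simps) simp
  qed (subst core.simps, auto)
qed

section \<open>Calculating modulo the centre\<close>

context torus_knot
begin

lemma N_mult:
  assumes "g \<in> carrier G" "h \<in> carrier G" "nf m (join_nf m (N g) (N h))"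
  shows "N (g \<otimes> h) = join_nf m (N g) (N h)"
proof -
  have "\<forall>d\<in>set (tl (N h)). d < m" using nf_N[of h] assms(2) by (cases "N h") (auto simp: nf_def)
  then have "N (g \<otimes> el (N h)) = join_nf m (N g) (N h)" using N_mult_el assms by simp
  moreover have "N (g \<otimes> h) = N (g \<otimes> el (N h))"
    using assms by (intro N_mult_cong) (simp_all add: N_el nf_N)
  ultimately show ?thesis by simp
qed

lemma N_el_N: "g \<in> carrier G \<Longrightarrow> N (el (N g)) = N g"
  by (simp add: N_el nf_N)

lemma N_x: "N x = [0, 0]"
  using N_mult_x[of \<one>] by (simp add: N_one push_x_def)

lemma N_y_pow: "N (y [^] j) = [j mod m]" for j :: nat
  using N_mult_y_pow[of \<one> j] by (simp add: N_one push_y_def)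

lemma N_z: "N (z [^] (c::int)) = [0]"
  using N_mult_z[of \<one> c] by (simp add: N_one)

lemma N_eq_0_iff: "g \<in> carrier G \<Longrightarrow> N g = [0] \<longleftrightarrow> (\<exists>c::int. g = z [^] c)"
  using N_eq_iff[of g \<one>] by (simp add: N_one)

lemma N_mult_central:
  assumes "N h = [0]" "g \<in> carrier G" "h \<in> carrier G"
  shows "N (g \<otimes> h) = N g" "N (h \<otimes> g) = N g"
proof -
  obtain c :: int where "h = z [^] c" using assms N_eq_0_iff by auto
  then show "N (g \<otimes> h) = N g" "N (h \<otimes> g) = N g" using assms by (simp_all add: N_mult_z zc_comm)
qed

lemma N_inv_unique:
  assumes "N (g \<otimes> h) = [0]" "g \<in> carrier G" "h \<in> carrier G"
  shows "N (inv g) = N h"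
proof -
  have "N (inv g \<otimes> (g \<otimes> h)) = N (inv g)" using assms by (intro N_mult_central) auto
  then show ?thesis using assms by simp
qed

lemma N_inv_x: "N (inv x) = [0, 0]"
  using N_inv_unique[of x x] N_z[of 1] by (simp add: x_x N_x)

lemma N_y_pow_neg:
  assumes "j < m"
  shows "N (inv (y [^] j)) = [neg_mod m j]"
proof -
  have "N (y [^] j \<otimes> y [^] neg_mod m j) = [0]"
    using assms by (simp add: y_pow_add add_neg_mod N_y_pow N_one)
  then have "N (inv (y [^] j)) = N (y [^] neg_mod m j)" by (rule N_inv_unique) simp_all
  then show ?thesis using assms by (simp add: N_y_pow neg_mod_def)
qed

lemma N_el_mod: "N (el (a @ j # b)) = N (el (a @ (j mod m) # b))"
proof -
  have 1: "el (j # b) = z [^] int (j div m) \<otimes> el ((j mod m) # b)" for b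
    by (cases "b = []") (simp_all add: el_Cons y_pow_mod[of j] zc_comm m_assoc)
  have "el (a @ j # b) = z [^] int (j div m) \<otimes> el (a @ (j mod m) # b)"
    by (cases "a = []") (simp_all add: 1 el_append zc_left_comm m_assoc)
  then show ?thesis by (simp add: N_mult_central N_z)
qed

lemma N_el_zero:
  assumes "a \<noteq> []" "b \<noteq> []"
  shows "N (el (a @ 0 # b)) = N (el (butlast a @ ((last a + hd b) mod m) # tl b))"
proof -
  have "el (a @ 0 # b) = el a \<otimes> (z \<otimes> el b)"
    using assms by (simp add: el_append el_Cons m_assoc x_x_left)
  also have "\<dots> = z \<otimes> (el a \<otimes> el b)"
    using zc_left_comm[of "el a" "el b" 1] by simp
  finally have "N (el (a @ 0 # b)) = N (el a \<otimes> el b)"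
    using N_mult_central(2)[of z "el a \<otimes> el b"] N_z[of 1] by simp
  then show ?thesis using assms N_el_mod by (simp add: el_mult)
qed

text \<open>The product with the reversed list of negated exponents collapses from the middle: each step
  meets \<open>x z\<^sup>c x = z\<^sup>c\<^sup>+\<^sup>1\<close>.\<close>

lemma N_inv_el:
  assumes "l \<noteq> []" "\<forall>d\<in>set l. d < m"
  shows "N (inv (el l)) = N (el (rev (map (neg_mod m) l)))"
proof -
  have "N (el l \<otimes> el (rev (map (neg_mod m) l))) = [0]" using assms
  proof (induction l rule: el.induct)
    case (2 j)
    then show ?case by (simp add: y_pow_add add_neg_mod N_y_pow N_one)
  next
    case (3 j i l)
    define l' where "l' = i # l"
    then have "l' \<noteq> []" by simp
    obtain c :: int where c: "el l' \<otimes> el (rev (map (neg_mod m) l')) = z [^] c"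
      using 3 N_eq_0_iff by (auto simp: l'_def)
    have "el (j # l') \<otimes> el (rev (map (neg_mod m) (j # l')))
      = y [^] j \<otimes> (x \<otimes> ((el l' \<otimes> el (rev (map (neg_mod m) l'))) \<otimes> (x \<otimes> y [^] neg_mod m j)))"
      using el_append[of "rev (map (neg_mod m) l')" "[neg_mod m j]"] \<open>l' \<noteq> []\<close>
      by (simp add: el_Cons m_assoc)
    also have "\<dots> = y [^] j \<otimes> (x \<otimes> (z [^] c \<otimes> (x \<otimes> y [^] neg_mod m j)))" by (simp only: c)
    also have "\<dots> = z [^] c \<otimes> (z \<otimes> (y [^] j \<otimes> y [^] neg_mod m j))"
      by (simp add: zc_left_comm[symmetric] x_x_left)
        (use zc_left_comm[of "y [^] j" _ 1] in simp)
    finally show ?case using 3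
      using N_mult_central(2)[of z "y [^] j \<otimes> y [^] neg_mod m j"] N_z[of 1]
      by (simp add: l'_def N_mult_central N_z y_pow_add add_neg_mod N_y_pow N_one)
  qed simp
  then show ?thesis by (rule N_inv_unique) simp_all
qed

lemma N_inv:
  assumes "g \<in> carrier G"
  shows "N (inv g) = rev (map (neg_mod m) (N g))"
proof -
  have nf: "nf m (N g)" using nf_N assms by simp
  have "N (inv g) = N (inv (el (N g)))" using assms by (intro N_inv_cong) (simp_all add: N_el_N)
  also have "\<dots> = N (el (rev (map (neg_mod m) (N g))))"
    using nf by (intro N_inv_el) (auto simp: nf_def)
  also have "\<dots> = rev (map (neg_mod m) (N g))"
    using nf by (intro N_el, cases "N g" rule: list_ends_cases) (auto intro: gr0I)
  finally show ?thesis .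
qed

lemma ab_one: "ab \<one> = 0"
  using ab_mult[of \<one> \<one>] by simp

lemma ab_inv: "g \<in> carrier G \<Longrightarrow> ab (inv g) = - ab g"
  using ab_mult[of g "inv g"] by (simp add: ab_one)

lemma ab_y_pow: "ab (y [^] (j::nat)) = 2 * int j"
  by (induction j) (simp_all add: ab_one ab_mult ab_y)

lemma ab_z: "ab z = 2 * int m"
  by (simp add: z_def ab_y_pow)

lemma ab_int_pow: "g \<in> carrier G \<Longrightarrow> ab (g [^] (c::int)) = c * ab g"
proof -
  assume g: "g \<in> carrier G"
  have nat: "ab (g [^] (n::nat)) = int n * ab g" for n
    by (induction n) (use g in \<open>simp_all add: ab_one ab_mult algebra_simps\<close>)
  show ?thesis
    by (cases c rule: int_cases2) (use g nat in \<open>simp_all add: int_pow_int int_pow_neg_int ab_inv\<close>)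
qed

end

section \<open>Conjugacy twisted by the inverting automorphism\<close>

text \<open>Both conjugacy (\<open>tw\<close> false) and conjugacy twisted by \<open>x \<mapsto> x\<^sup>-\<^sup>1\<close>, \<open>y \<mapsto> y\<^sup>-\<^sup>1\<close> (\<open>tw\<close> true) are
  treated at once. Modulo the centre \<open>\<phi>\<close> fixes \<open>x\<close> and acts on exponents of \<open>y\<close> by \<open>flip\<close>.\<close>

locale twisted = torus_knot +
  fixes \<phi> and tw :: bool
  assumes hom: "\<phi> \<in> hom G G"
    and \<phi>_x: "\<phi> x = (if tw then inv x else x)" and \<phi>_y: "\<phi> y = (if tw then inv y else y)"
begin

abbreviation "flp \<equiv> flip m tw"

lemma \<phi>_closed [simp]: "g \<in> carrier G \<Longrightarrow> \<phi> g \<in> carrier G"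
  using hom by (auto simp: hom_def)

lemma \<phi>_mult: "g \<in> carrier G \<Longrightarrow> h \<in> carrier G \<Longrightarrow> \<phi> (g \<otimes> h) = \<phi> g \<otimes> \<phi> h"
  using hom by (auto simp: hom_def)

sublocale \<phi>: group_hom G G \<phi>
  by (unfold_locales) (rule hom)

lemma \<phi>_z_pow: "\<phi> (z [^] (c::int)) = z [^] (if tw then - c else c)"
proof -
  have "\<phi> z = (if tw then inv z else z)"
    by (simp add: x_x[symmetric] \<phi>_x inv_mult_group)
  then show ?thesis by (simp add: \<phi>.hom_int_pow int_pow_inv int_pow_neg)
qed

lemma N_\<phi>_y_pow: "j < m \<Longrightarrow> N (\<phi> (y [^] j)) = [flp j]"
proof -
  assume "j < m"
  moreover have "\<phi> (y [^] j) = (if tw then inv (y [^] j) else y [^] j)"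
    by (simp add: \<phi>.hom_nat_pow \<phi>_y nat_pow_inv)
  ultimately show ?thesis by (simp add: N_y_pow_neg N_y_pow flip_def)
qed

lemma N_\<phi>_x: "N (\<phi> x) = [0, 0]"
  by (simp add: \<phi>_x N_x N_inv_x)

lemma N_\<phi>_el: "\<forall>d\<in>set l. d < m \<Longrightarrow> N (\<phi> (el l)) = N (el (map flp l))"
proof (induction l rule: el.induct)
  case (2 j)
  then show ?case by (simp add: N_\<phi>_y_pow N_y_pow)
next
  case (3 j i l)
  have "N (\<phi> (y [^] j)) = N (y [^] flp j)" "N (\<phi> x) = N x"
    using 3 by (simp_all add: N_\<phi>_y_pow N_y_pow N_\<phi>_x N_x)
  moreover have "N (\<phi> (el (i # l))) = N (el (map flp (i # l)))" using 3 by simp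
  ultimately have "N (\<phi> (y [^] j) \<otimes> \<phi> x \<otimes> \<phi> (el (i # l))) = N (y [^] flp j \<otimes> x \<otimes> el (map flp (i # l)))"
    by (intro N_mult_cong) simp_all
  then show ?case by simp
qed simp

lemma N_\<phi>_cong:
  assumes "N g = N h" "g \<in> carrier G" "h \<in> carrier G"
  shows "N (\<phi> g) = N (\<phi> h)"
proof -
  obtain c :: int where "g = h \<otimes> z [^] c" using assms N_eq_iff by meson
  then show ?thesis using assms by (simp add: \<phi>_z_pow N_mult_z)
qed

lemma N_\<phi>:
  assumes "g \<in> carrier G"
  shows "N (\<phi> g) = map flp (N g)"
proof -
  have nf: "nf m (N g)" using nf_N assms by simp
  have "N (\<phi> g) = N (\<phi> (el (N g)))" using assms by (intro N_\<phi>_cong) (simp_all add: N_el_N)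
  also have "\<dots> = N (el (map flp (N g)))" using nf by (intro N_\<phi>_el) (auto simp: nf_def)
  also have "\<dots> = map flp (N g)"
    using nf by (intro N_el, cases "N g" rule: list_ends_cases) (auto intro: gr0I)
  finally show ?thesis .
qed

definition tconj where
  "tconj w u = inv (\<phi> w) \<otimes> u \<otimes> w"

text \<open>Twisted conjugacy modulo the centre, together with the parity of the abelianization of the
  conjugating element, which is the parity of the number of its letters \<open>x\<close>. For the twisted
  relation this is exactly what is lost when one passes to the quotient by the centre.\<close>

definition parity_conj :: "'a \<Rightarrow> 'a \<Rightarrow> int \<Rightarrow> bool" where
  "parity_conj u v n \<longleftrightarrow> (\<exists>w\<in>carrier G. N v = N (tconj w u) \<and> even (ab w + n))"

lemma tconj_closed [simp]: "w \<in> carrier G \<Longrightarrow> u \<in> carrier G \<Longrightarrow> tconj w u \<in> carrier G"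
  by (simp add: tconj_def)

lemma tconj_one: "u \<in> carrier G \<Longrightarrow> tconj \<one> u = u"
  by (simp add: tconj_def)

lemma tconj_mult:
  "w \<in> carrier G \<Longrightarrow> w' \<in> carrier G \<Longrightarrow> u \<in> carrier G \<Longrightarrow> tconj w' (tconj w u) = tconj (w \<otimes> w') u"
  by (simp add: tconj_def inv_mult_group m_assoc)

lemma N_tconj_cong:
  "N u = N u' \<Longrightarrow> w \<in> carrier G \<Longrightarrow> u \<in> carrier G \<Longrightarrow> u' \<in> carrier G \<Longrightarrow> N (tconj w u) = N (tconj w u')"
  unfolding tconj_def by (intro N_mult_cong) simp_all

lemma N_tconj_cong':
  "N w = N w' \<Longrightarrow> w \<in> carrier G \<Longrightarrow> w' \<in> carrier G \<Longrightarrow> u \<in> carrier G \<Longrightarrow> N (tconj w u) = N (tconj w' u)"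
  unfolding tconj_def by (intro N_mult_cong N_inv_cong N_\<phi>_cong) simp_all

lemma parity_conj_refl: "u \<in> carrier G \<Longrightarrow> parity_conj u u 0"
  unfolding parity_conj_def by (rule bexI[of _ \<one>]) (simp_all add: tconj_one ab_one)

lemma parity_conj_trans:
  assumes "parity_conj u v n" "parity_conj v t n'" and [simp]: "u \<in> carrier G" "v \<in> carrier G" "t \<in> carrier G"
  shows "parity_conj u t (n + n')"
proof -
  obtain w where [simp]: "w \<in> carrier G" and w: "N v = N (tconj w u)" "even (ab w + n)"
    using assms unfolding parity_conj_def by blast
  obtain w' where [simp]: "w' \<in> carrier G" and w': "N t = N (tconj w' v)" "even (ab w' + n')"
    using assms unfolding parity_conj_def by blast
  have "N t = N (tconj w' (tconj w u))" using w' N_tconj_cong[OF w(1), of w'] by simp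
  moreover have "even (ab (w \<otimes> w') + (n + n'))" using w w' by (simp add: ab_mult)
  ultimately show ?thesis unfolding parity_conj_def by (intro bexI[of _ "w \<otimes> w'"]) (simp_all add: tconj_mult)
qed

lemma parity_conj_sym:
  assumes "parity_conj u v n" and [simp]: "u \<in> carrier G" "v \<in> carrier G"
  shows "parity_conj v u n"
proof -
  obtain w where [simp]: "w \<in> carrier G" and w: "N v = N (tconj w u)" "even (ab w + n)"
    using assms unfolding parity_conj_def by blast
  have "N (tconj (inv w) v) = N (tconj (inv w) (tconj w u))" using N_tconj_cong[OF w(1), of "inv w"] by simp
  then have "N u = N (tconj (inv w) v)" by (simp add: tconj_mult tconj_one)
  then show ?thesis unfolding parity_conj_def using w by (intro bexI[of _ "inv w"]) (auto simp: ab_inv)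
qed

lemma parity_conj_cong:
  assumes "parity_conj u v n" "N u = N u'" "N v = N v'" "even (n + n')" "u \<in> carrier G" "u' \<in> carrier G"
  shows "parity_conj u' v' n'"
proof -
  obtain w where w: "w \<in> carrier G" "N v = N (tconj w u)" "even (ab w + n)"
    using assms unfolding parity_conj_def by blast
  then have "N v' = N (tconj w u')" using assms N_tconj_cong[of u u' w] by simp
  moreover have "even (ab w + n')" using w(3) assms(4) by presburger
  ultimately show ?thesis using w(1) unfolding parity_conj_def by blast
qed

text \<open>The first of three elementary moves: conjugation by a power of \<open>y\<close> moves the last exponent to
  the front.\<close>

lemma N_merge_ends:
  assumes "N u = a # l @ [b]" and [simp]: "u \<in> carrier G"
  shows "N (tconj (inv (y [^] b)) u) = N (el (((a + flp b) mod m) # l @ [0]))"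
proof -
  have b: "b < m" using nf_N[of u] assms by simp
  define v where "v = el (a # l @ [0])"
  have [simp]: "v \<in> carrier G" by (simp add: v_def)
  have "v \<otimes> y [^] b = el (a # l @ [b])"
    using el_mult[of "a # l @ [0]" "[b]"] by (simp add: v_def butlast_append)
  then have u: "N u = N (v \<otimes> y [^] b)" using assms N_el_N[of u] by simp
  have "N (tconj (inv (y [^] b)) u) = N (tconj (inv (y [^] b)) (v \<otimes> y [^] b))"
    by (rule N_tconj_cong[OF u]) simp_all
  also have "tconj (inv (y [^] b)) (v \<otimes> y [^] b) = \<phi> (y [^] b) \<otimes> v"
    unfolding tconj_def by (simp add: m_assoc del: \<phi>.hom_nat_pow)
  also have "N (\<phi> (y [^] b) \<otimes> v) = N (el [flp b] \<otimes> v)"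
    using b by (intro N_mult_cong) (simp_all add: N_\<phi>_y_pow N_y_pow del: \<phi>.hom_nat_pow)
  also have "el [flp b] \<otimes> v = el ((a + flp b) # l @ [0])"
    unfolding v_def el_mult_Cons by (simp add: add.commute)
  finally show ?thesis using N_el_mod[of "[]"] by simp
qed

text \<open>The second move: \<open>x u x\<close> is conjugate to \<open>u\<close> by \<open>x\<close>, since \<open>\<phi> x\<close> agrees with \<open>x\<close> modulo the centre.\<close>

lemma N_strip_x:
  assumes "N u = 0 # l @ [0]" "l \<noteq> []" and [simp]: "u \<in> carrier G"
  shows "N (tconj x u) = N (el l)"
proof -
  have u: "N u = N (x \<otimes> el l \<otimes> x)"
    using assms N_el_N[of u] by (simp add: el_Cons el_append m_assoc)
  have "N (tconj x u) = N (inv (\<phi> x) \<otimes> (x \<otimes> el l \<otimes> x) \<otimes> x)"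
    using u unfolding tconj_def by (intro N_mult_cong) simp_all
  also have "\<dots> = N (x \<otimes> (x \<otimes> el l \<otimes> x) \<otimes> x)"
    by (intro N_mult_cong) (simp_all add: \<phi>_x N_x N_inv_x)
  also have "x \<otimes> (x \<otimes> el l \<otimes> x) \<otimes> x = z \<otimes> (el l \<otimes> z)"
    by (simp add: m_assoc x_x_left x_x)
  also have "N \<dots> = N (el l)" using N_z[of 1] by (simp add: N_mult_central)
  finally show ?thesis .
qed

text \<open>The third move is one step of rotation. The conjugating element has a single \<open>x\<close>, so every
  step of rotation changes the parity.\<close>

lemma N_rotate:
  assumes "N u = j # S @ [0]" and [simp]: "u \<in> carrier G"
  shows "N (tconj (y [^] flp j \<otimes> x) u) = N (el (S @ [flp j, 0]))"
proof -
  have j: "j < m" using nf_N[of u] assms by simp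
  have u: "N u = N (y [^] j \<otimes> x \<otimes> el (S @ [0]))"
    using assms N_el_N[of u] by (simp add: el_Cons)
  have w: "N (\<phi> (y [^] flp j \<otimes> x)) = N (y [^] j \<otimes> x)"
    using j by (simp add: N_\<phi> N_mult_x N_y_pow del: \<phi>.hom_mult) (simp add: push_x_def)
  have "N (tconj (y [^] flp j \<otimes> x) u) =
    N (inv (y [^] j \<otimes> x) \<otimes> (y [^] j \<otimes> x \<otimes> el (S @ [0])) \<otimes> (y [^] flp j \<otimes> x))"
    unfolding tconj_def using u w by (intro N_mult_cong N_inv_cong) simp_all
  also have "inv (y [^] j \<otimes> x) \<otimes> (y [^] j \<otimes> x \<otimes> el (S @ [0])) = el (S @ [0])"
    by simp
  also have "el (S @ [0]) \<otimes> (y [^] flp j \<otimes> x) = el (S @ [flp j, 0])"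
    using el_mult[of "S @ [0]" "[flp j, 0]"] by (simp add: butlast_append)
  finally show ?thesis .
qed

lemma parity_conj_core:
  assumes "u \<in> carrier G"
  shows "parity_conj u (el (core m tw (N u))) (int (rounds m tw (N u)))
    \<and> ((\<exists>d<m. core m tw (N u) = [d]) \<or> (\<exists>S. cyclic m S \<and> core m tw (N u) = S @ [0]))"
  using assms
proof (induction "length (N u)" arbitrary: u rule: less_induct)
  case less
  note [simp] = less.prems
  have nf: "nf m (N u)" using nf_N by simp
  show ?case
  proof (cases "N u" rule: list_ends_cases)
    case 1 then show ?thesis using nf by simp
  next
    case (2 d)
    have "core m tw (N u) = N u" "rounds m tw (N u) = 0"
      using 2 by (simp_all add: core_single)
    then show ?thesis using 2 nf parity_conj_cong[OF parity_conj_refl[of u], of u "el (N u)" 0] N_el_N[of u]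
      by (auto simp del: el.simps)
  next
    case (3 a l b)
    define d where "d = (a + flp b) mod m"
    define u' where "u' = tconj (inv (y [^] b)) u"
    have d: "d < m" by (simp add: d_def)
    have [simp]: "u' \<in> carrier G" by (simp add: u'_def)
    have "nf m (d # l @ [0])" using nf 3 d by simp
    then have Nu': "N u' = d # l @ [0]"
      unfolding u'_def d_def using N_merge_ends[OF 3] N_el by (simp only: less.prems)
    have tw1: "parity_conj u u' 0"
      unfolding parity_conj_def u'_def by (rule bexI[of _ "inv (y [^] b)"]) (simp_all add: ab_inv ab_y_pow)
    show ?thesis
    proof (cases "d = 0 \<and> l \<noteq> []")
      case True
      define u'' where "u'' = tconj x u'"
      have [simp]: "u'' \<in> carrier G" by (simp add: u''_def)
      have "nf m l" using True nf 3 by (intro nf_positive) auto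
      then have Nu'': "N u'' = l" unfolding u''_def using N_strip_x[of u' l] Nu' True N_el by simp
      have tw2: "parity_conj u' u'' 1"
        unfolding parity_conj_def u''_def by (rule bexI[of _ x]) (use m_odd in \<open>simp_all add: ab_x\<close>)
      have core: "core m tw (N u) = core m tw l" "rounds m tw (N u) = Suc (rounds m tw l)"
        using True core_ends[OF d_def[symmetric]] unfolding 3 by simp_all
      have IH: "parity_conj u'' (el (core m tw l)) (int (rounds m tw l))
        \<and> ((\<exists>d<m. core m tw l = [d]) \<or> (\<exists>S. cyclic m S \<and> core m tw l = S @ [0]))"
        using less.hyps[of u''] Nu'' 3 by simp
      have "parity_conj u (el (core m tw l)) (0 + 1 + int (rounds m tw l))"
        by (rule parity_conj_trans[OF parity_conj_trans[OF tw1 tw2]]) (use IH in simp_all)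
      then show ?thesis unfolding core using IH by (simp add: add.commute)
    next
      case False
      have core: "core m tw (N u) = d # l @ [0]" "rounds m tw (N u) = 0"
        unfolding 3 core_ends[OF d_def[symmetric]] by (rule if_not_P[OF False])+
      have "cyclic m (d # l)" using False nf 3 d by (auto simp: cyclic_def)
      moreover have "parity_conj u (el (d # l @ [0])) 0"
        using parity_conj_cong[OF tw1, of u "el (d # l @ [0])" 0] Nu' N_el_N[of u'] by simp
      ultimately show ?thesis unfolding core by (metis append_Cons of_nat_0)
    qed
  qed
qed


text \<open>A conjugation between cyclically reduced words is a rotation, and the number of steps has the
  parity of the conjugating element \<open>w\<close>. The proof strips \<open>w\<close> from the left. If its first syllable
  cancels against the beginning of \<open>u\<close>, or against the end of \<open>u\<close> after a first letter \<open>x\<close>, then it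
  performs one step of rotation, forwards or backwards. In all other cases \<open>w\<^sup>-\<^sup>1 u w\<close> (with the
  twist) is already reduced as it stands; its two ends then come from the same syllable of \<open>w\<close>, and
  this is impossible for a word that is cyclically reduced. Stripping one syllable at a time keeps
  track of the parity, which comparing the two cyclic words would not.\<close>

lemma rotation_complete:
  assumes "cyclic m S" "N u = S @ [0]" "u \<in> carrier G" "w \<in> carrier G"
    and "(\<exists>T. cyclic m T \<and> N (tconj w u) = T @ [0]) \<or> (\<exists>d. N (tconj w u) = [d])"
  shows "\<exists>r::nat. even (ab w + int r) \<and> N (tconj w u) = (rot m tw ^^ r) S @ [0]"
  using assms
proof (induction "length (N w)" arbitrary: w u S rule: less_induct)
  case less
  note cyc = less.prems(1) and Nu = less.prems(2) and target = less.prems(5)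
  note [simp] = less.prems(3,4)
  define f where "f j = neg_mod m (flp j)" for j
  have f_less [simp]: "f j < m" and f0 [simp]: "f 0 = 0" for j by (simp_all add: f_def)
  have f_pos [simp]: "0 < f j \<longleftrightarrow> 0 < j" if "j < m" for j using that by (simp add: f_def)
  obtain s S' where S: "S = s # S'" using cyc by (cases S) (auto simp: cyclic_def)
  have S_less: "s < m" "\<forall>d\<in>set S'. d < m" and S'_pos: "\<forall>d\<in>set S'. 0 < d"
    and s0: "s = 0 \<Longrightarrow> S' = []"
    using cyc by (auto simp: cyclic_def S intro: gr0I)
  have nfw: "nf m (N w)" using nf_N by simp
  obtain i W where W: "N w = i # W" using nfw by (cases "N w") auto
  have i: "i < m" using nfw by (simp add: W nf_def)
  have Nw': "N (inv (\<phi> w)) = rev (map f W) @ [f i]"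
    by (simp add: N_inv N_\<phi> W f_def)
  have Nv: "N (tconj w u) = N (el (rev (map f W) @ [f i]) \<otimes> el (S @ [0]) \<otimes> el (i # W))"
    unfolding tconj_def using Nw' Nu W N_el_N[of "inv (\<phi> w)"] N_el_N[of u] N_el_N[of w]
    by (intro N_mult_cong) simp_all
  also have "el (rev (map f W) @ [f i]) \<otimes> el (S @ [0]) \<otimes> el (i # W)
    = el (rev (map f W) @ (f i + s) # S' @ i # W)"
    using el_mult[of "rev (map f W) @ [f i]" "S @ [0]"]
      el_mult[of "rev (map f W) @ (f i + s) # S' @ [0]" "i # W"] by (simp add: S butlast_append)
  finally have Nv: "N (tconj w u) = N (el (rev (map f W) @ ((f i + s) mod m) # S' @ i # W))"
    using N_el_mod by metis
  have no_long: False if "nf m (a # l @ [b])" "N (tconj w u) = a # l @ [b]" "b = 0 \<Longrightarrow> a = 0" "l \<noteq> []" for a l b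
  proof -
    from target that obtain T where T: "cyclic m T" "a # l @ [b] = T @ [0]" by auto
    then have "b = 0" "T = a # l" by (metis append_Cons last_snoc, metis append_Cons butlast_snoc)
    then show False using T that by (auto simp: cyclic_def)
  qed
  have W_nf: "W \<noteq> [] \<Longrightarrow> nf m W"
    using nfw nf_ends[of m i "a # l" b for a l b] by (cases W rule: list_ends_cases) (auto simp: W)
  show ?case
  proof (cases "W = []")
    case True
    have "nf m (((f i + s) mod m) # S' @ [i])" using S_less S'_pos i by simp
    then have Nv': "N (tconj w u) = ((f i + s) mod m) # S' @ [i]"
      using Nv True N_el by simp
    with target have "i = 0" by (metis append_Cons last_snoc append_is_Nil_conv list.inject not_Cons_self2)
    moreover have "even (ab w)"
    proof -
      obtain c :: int where "w = z [^] c" using W True \<open>i = 0\<close> N_eq_0_iff[of w] by auto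
      then show ?thesis by (simp add: ab_int_pow ab_z)
    qed
    ultimately show ?thesis using Nv' S_less S by (intro exI[of _ 0]) simp
  next
    case False
    obtain W' b where Wb: "W = W' @ [b]" using False by (cases W rule: rev_cases) auto
    have Wd: "b < m" "\<forall>d\<in>set W'. 0 < d \<and> d < m" using nfw by (simp_all add: W Wb)
    \<comment> \<open>The first syllable of the conjugating element decides which end of the word it meets.\<close>
    consider (rotate) "i = flp s" | (generic) "i \<noteq> flp s" "i \<noteq> 0"
      | (backward) "i = 0" "s \<noteq> 0" "hd W = neg_mod m (last S)"
      | (back_generic) "i = 0" "s \<noteq> 0" "hd W \<noteq> neg_mod m (last S)"
      using flip_0[of m tw] by metis
    then show ?thesis
    proof cases
      case rotate
      define w1 where "w1 = y [^] i \<otimes> x"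
      define w2 where "w2 = inv w1 \<otimes> w"
      have [simp]: "w1 \<in> carrier G" "w2 \<in> carrier G" by (simp_all add: w1_def w2_def)
      have w: "w = w1 \<otimes> w2" by (simp add: w2_def)
      have "N w2 = N (inv w1 \<otimes> (w1 \<otimes> el W))"
        unfolding w2_def using W False N_el_N[of w] by (intro N_mult_cong) (simp_all add: w1_def el_Cons)
      then have Nw2: "N w2 = W" using W_nf False N_el by simp
      define u1 where "u1 = tconj w1 u"
      have [simp]: "u1 \<in> carrier G" by (simp add: u1_def)
      have Nu1: "N u1 = rot m tw S @ [0]"
        using N_rotate[of u s S'] Nu S rotate N_el[OF nf_cyclic[OF _ cyclic_rot[OF cyc]], of tw]
        by (simp add: u1_def w1_def rot_def)
      have v: "tconj w u = tconj w2 u1" by (simp add: w u1_def tconj_mult)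
      obtain r :: nat where "even (ab w2 + int r)" "N (tconj w2 u1) = (rot m tw ^^ r) (rot m tw S) @ [0]"
        using less.hyps[of w2 "rot m tw S" u1] Nw2 W Nu1 cyclic_rot[OF cyc] target v by auto
      moreover have "ab w = ab w2 + 2 * int i + int m"
        by (simp add: w w1_def ab_mult ab_y_pow ab_x)
      ultimately show ?thesis using m_odd v
        by (intro exI[of _ "Suc r"]) (auto simp: funpow_swap1)
    next
      case generic
      define e where "e = (f i + s) mod m"
      have e: "0 < e" "e < m"
      proof -
        have "e = 0 \<longleftrightarrow> s = neg_mod m (f i)" unfolding e_def using S_less by (intro mod_add_eq_0_iff) simp_all
        then show "0 < e" using generic i by (auto simp: f_def intro: gr0I)
      qed (simp add: e_def)
      have eq: "rev (map f W) @ e # S' @ i # W = f b # (rev (map f W') @ e # S' @ i # W') @ [b]"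
        by (simp add: Wb)
      have nf: "nf m (f b # (rev (map f W') @ e # S' @ i # W') @ [b])"
        unfolding nf_ends using e generic(2) i S_less S'_pos Wd by auto
      then have "N (tconj w u) = f b # (rev (map f W') @ e # S' @ i # W') @ [b]"
        using Nv eq N_el unfolding e_def by metis
      then show ?thesis using no_long[OF nf] by simp
    next
      case backward
      obtain S0 t where S0: "S = S0 @ [t]" using S by (metis list.distinct(1) rev_exhaust)
      have t: "t < m" "0 < t" using cyc S0 backward S by (auto simp: cyclic_def intro: gr0I)
      define j where "j = neg_mod m t"
      obtain R where R: "W = j # R" using backward False S0 by (cases W) (auto simp: j_def)
      have j: "j < m" by (simp add: j_def)
      define w1 where "w1 = x \<otimes> y [^] j"
      define w2 where "w2 = inv w1 \<otimes> w"
      have [simp]: "w1 \<in> carrier G" "w2 \<in> carrier G" by (simp_all add: w1_def w2_def)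
      have w: "w = w1 \<otimes> w2" by (simp add: w2_def)
      have "N w2 = N (inv w1 \<otimes> (w1 \<otimes> el (0 # R)))"
        unfolding w2_def using W R backward N_el_N[of w]
        by (intro N_mult_cong) (cases "R = []"; simp add: w1_def el_Cons m_assoc)+
      moreover have "nf m (0 # R)" using nfw nf_ends[of m i "j # a" b for a b]
        by (cases R rule: rev_cases) (auto simp: W R)
      ultimately have Nw2: "N w2 = 0 # R" using N_el by simp
      define u1 where "u1 = tconj w1 u"
      define S1 where "S1 = flp t # S0"
      have [simp]: "u1 \<in> carrier G" by (simp add: u1_def)
      have S1: "rot m tw S1 = S" "cyclic m S1"
        using t cyc S0 S backward by (auto simp: S1_def rot_def cyclic_def)
      have Nu1: "N u1 = S1 @ [0]"
      proof -
        have "N (el (S1 @ [0])) = S1 @ [0]" using N_el nf_cyclic S1(2) by simp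
        moreover have "N u = N (tconj (y [^] t \<otimes> x) (el (S1 @ [0])))"
          using N_rotate[of "el (S1 @ [0])" "flp t" S0] t S1 calculation Nu
            N_el[OF nf_cyclic[OF _ cyc]] by (simp add: S0 S1_def)
        then have "N u1 = N (tconj (y [^] t \<otimes> x \<otimes> w1) (el (S1 @ [0])))"
          unfolding u1_def using N_tconj_cong[of u "tconj (y [^] t \<otimes> x) (el (S1 @ [0]))" w1]
          by (simp add: tconj_mult)
        moreover have "N (y [^] t \<otimes> x \<otimes> w1) = N \<one>"
        proof -
          have "y [^] t \<otimes> x \<otimes> w1 = y [^] t \<otimes> (z \<otimes> y [^] j)"
            by (simp add: w1_def m_assoc x_x_left)
          also have "\<dots> = z \<otimes> y [^] (t + j)"
            using zc_left_comm[of "y [^] t" "y [^] j" 1] by (simp add: y_pow_add)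
          finally show ?thesis using N_z[of 1] t
            by (simp add: N_mult_central N_y_pow j_def add_neg_mod N_one)
        qed
        ultimately show ?thesis
          using N_tconj_cong'[of "y [^] t \<otimes> x \<otimes> w1" \<one> "el (S1 @ [0])"] by (simp add: tconj_one)
      qed
      have v: "tconj w u = tconj w2 u1" by (simp add: w u1_def tconj_mult)
      obtain r :: nat where r: "even (ab w2 + int r)" "N (tconj w2 u1) = (rot m tw ^^ r) S1 @ [0]"
        using less.hyps[of w2 S1 u1] Nw2 W R Nu1 S1 target v by auto
      \<comment> \<open>A backward step is written as an odd number of forward steps, so the parity stays right.\<close>
      have "S1 = (rot m tw ^^ (2 * length S - 1)) S"
      proof -
        have "2 * length S1 = Suc (2 * length S - 1)" using S0 by (simp add: S1_def)
        then have "S1 = (rot m tw ^^ Suc (2 * length S - 1)) S1"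
          using rot_period[of S1 m tw] S1(2) by (simp add: cyclic_def)
        then show ?thesis by (simp add: funpow_swap1 S1)
      qed
      then have "N (tconj w2 u1) = (rot m tw ^^ (r + (2 * length S - 1))) S @ [0]"
        using r(2) by (simp add: funpow_add)
      moreover have "ab w = ab w2 + 2 * int j + int m"
        by (simp add: w w1_def ab_mult ab_y_pow ab_x)
      moreover have "odd (int (2 * length S - 1))" using S0 by simp
      ultimately show ?thesis using m_odd v r(1)
        by (intro exI[of _ "r + (2 * length S - 1)"]) auto
    next
      case back_generic
      have pos: "\<forall>d\<in>set S. 0 < d \<and> d < m" using cyc S back_generic by (auto simp: cyclic_def intro: gr0I)
      define e where "e = (last S + hd W) mod m"
      have hdW: "hd W < m" using W_nf False by (auto simp: nf_def)
      have lS: "last S < m" using pos S by simp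
      have e: "0 < e" "e < m"
      proof -
        have "e = 0 \<longleftrightarrow> hd W = neg_mod m (last S)" unfolding e_def
          using lS hdW by (intro mod_add_eq_0_iff) simp_all
        then show "0 < e" using back_generic by (auto intro: gr0I)
      qed (simp add: e_def)
      have "N (tconj w u) = N (el ((rev (map f W) @ S) @ 0 # W))"
        using Nv S back_generic S_less by simp
      also have "\<dots> = N (el (rev (map f W) @ butlast S @ e # tl W))"
        using N_el_zero[of "rev (map f W) @ S" W] S False by (simp add: e_def butlast_append)
      finally have Nv': "N (tconj w u) = N (el (rev (map f W) @ butlast S @ e # tl W))" .
      have bpos: "\<forall>d\<in>set (butlast S). 0 < d \<and> d < m" using pos by (auto dest: in_set_butlastD)
      show ?thesis
      proof (cases W')
        case Nil
        have nf: "nf m (f b # butlast S @ [e])" using e bpos by simp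
        then have "N (tconj w u) = f b # butlast S @ [e]" using Nv' Nil Wb N_el by simp
        then have False using target e by (metis append_Cons last_snoc append_is_Nil_conv list.inject not_Cons_self2 less_irrefl)
        then show ?thesis ..
      next
        case (Cons c W'')
        have eq: "rev (map f W) @ butlast S @ e # tl W = f b # (rev (map f W') @ butlast S @ e # W'') @ [b]"
          by (simp add: Wb Cons)
        have nf: "nf m (f b # (rev (map f W') @ butlast S @ e # W'') @ [b])"
          unfolding nf_ends using e bpos Wd Cons by auto
        then have "N (tconj w u) = f b # (rev (map f W') @ butlast S @ e # W'') @ [b]"
          using Nv' eq N_el by metis
        then show ?thesis using no_long[OF nf] by simp
      qed
    qed
  qed
qed

end

section \<open>The test for twisted conjugacy\<close>

text \<open>The arguments are the normal forms of the two elements and the difference \<open>D\<close> of their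
  abelianizations. Without twist equality of the abelianizations fixes the central exponent; a core
  of length one is a power of \<open>y\<close> and is then determined as well. With twist only the parity of the
  central exponent is an invariant, because \<open>\<phi>(z)\<^sup>-\<^sup>1 u z = u z\<^sup>2\<close>; conjugation by \<open>w\<close> changes the
  abelianization by \<open>2 ab w\<close>, and so the parity of the number of letters \<open>x\<close> in \<open>w\<close> has to match
  \<open>D\<close> modulo \<open>4\<close>. Two full turns exhaust the rotations.\<close>

definition accepts :: "nat \<Rightarrow> bool \<Rightarrow> nat list \<Rightarrow> nat list \<Rightarrow> int \<Rightarrow> bool" where
  "accepts m tw lu lv D \<longleftrightarrow>
     (let cu = core m tw lu; cv = core m tw lv in
      length cu = length cv \<and> (\<not> tw \<longrightarrow> D = 0) \<and>
      (length cu = 1 \<or>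
       (\<exists>r < 2 * (length cu - 1). (rot m tw ^^ r) (butlast cu) = butlast cv \<and>
          (tw \<longrightarrow> 4 dvd D + 2 * int (rounds m tw lu + rounds m tw lv + r)))))"

text \<open>If \<open>g\<close> conjugates the standard generators to elements with normal forms \<open>la\<close> and \<open>lb\<close>, then this is
  the normal form of \<open>g\<^sup>-\<^sup>1\<close>. Indeed \<open>la\<close> is \<open>p x p\<^sup>-\<^sup>1\<close> where \<open>g\<close> is \<open>p\<close> or \<open>p x\<close>, and \<open>p y p\<^sup>-\<^sup>1\<close> is shorter
  than \<open>la\<close> whereas \<open>p x y x p\<^sup>-\<^sup>1\<close> is longer.\<close>

definition inverse_half :: "nat list \<Rightarrow> nat list \<Rightarrow> nat list" where
  "inverse_half la lb =
     (let h = drop (length la div 2) la in if length lb < length la then h else 0 # h)"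

context twisted
begin

lemma ab_\<phi>: "g \<in> carrier G \<Longrightarrow> ab (\<phi> g) = (if tw then - ab g else ab g)"
  by (induction g rule: generated_induct)
    (auto simp: ab_one ab_inv ab_mult \<phi>_x \<phi>_y)

lemma ab_tconj: "w \<in> carrier G \<Longrightarrow> u \<in> carrier G \<Longrightarrow>
    ab (tconj w u) = ab u + (if tw then 2 * ab w else 0)"
  by (simp add: tconj_def ab_mult ab_inv ab_\<phi>)

definition tw_conj where "tw_conj u v \<longleftrightarrow> (\<exists>w\<in>carrier G. v = tconj w u)"

lemma tw_conj_trans: "tw_conj u v \<Longrightarrow> tw_conj v t \<Longrightarrow> u \<in> carrier G \<Longrightarrow> tw_conj u t"
  unfolding tw_conj_def using tconj_mult m_closed by metis

lemma tw_conj_sym: "tw_conj u v \<Longrightarrow> u \<in> carrier G \<Longrightarrow> tw_conj v u"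
  unfolding tw_conj_def by (metis inv_closed r_inv tconj_mult tconj_one)

text \<open>An equation modulo the centre is lifted by correcting the conjugating element with a power
  of \<open>z\<close>. With twist this changes the result by \<open>z\<^sup>2\<^sup>e\<close>, whence the condition modulo \<open>4\<close>.\<close>

lemma tw_conj_if_parity_conj:
  assumes "parity_conj u v n" and [simp]: "u \<in> carrier G" "v \<in> carrier G"
    and plain: "\<not> tw \<Longrightarrow> ab u = ab v" and twist: "tw \<Longrightarrow> 4 dvd ab u - ab v + 2 * n"
  shows "tw_conj u v"
proof -
  obtain w where [simp]: "w \<in> carrier G" and w: "N v = N (tconj w u)" "even (ab w + n)"
    using assms unfolding parity_conj_def by blast
  obtain c :: int where c: "v = tconj w u \<otimes> z [^] c" using w N_eq_iff by auto
  have abv: "ab v = ab u + (if tw then 2 * ab w else 0) + 2 * int m * c"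
    by (simp add: c ab_mult ab_tconj ab_int_pow ab_z)
  show ?thesis
  proof (cases tw)
    case False
    then have "c = 0" using abv plain m_ge by simp
    then show ?thesis unfolding tw_conj_def using c by auto
  next
    case True
    have "4 dvd 2 * (n - ab w - int m * c)" using twist[OF True] abv True by (simp add: algebra_simps)
    then have "even (n - ab w - int m * c)" by presburger
    then have "even (int m * c)" using w(2) by (metis even_add even_diff)
    then obtain e where e: "c = 2 * e" using m_odd by auto
    have "tconj (w \<otimes> z [^] e) u = z [^] e \<otimes> (inv (\<phi> w) \<otimes> u \<otimes> w \<otimes> z [^] e)"
      unfolding tconj_def using True by (simp add: \<phi>_z_pow inv_mult_group int_pow_neg m_assoc
          del: \<phi>.hom_int_pow)
    also have "\<dots> = tconj w u \<otimes> (z [^] e \<otimes> z [^] e)"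
      unfolding tconj_def by (simp add: zc_left_comm m_assoc)
    also have "\<dots> = v" by (simp add: c e int_pow_mult[symmetric])
    finally show ?thesis unfolding tw_conj_def by (intro bexI[of _ "w \<otimes> z [^] e"]) simp_all
  qed
qed

lemma power_of_y:
  assumes "N u = [d]" "u \<in> carrier G"
  shows "\<exists>e::int. u = y [^] e"
proof -
  have "d < m" using nf_N[of u] assms by simp
  then have "N u = N (y [^] d)" using assms by (simp add: N_y_pow)
  then obtain c :: int where "u = y [^] d \<otimes> z [^] c" using assms N_eq_iff by auto
  then have "u = y [^] (int d + int m * c)"
    by (simp add: z_def int_pow_mult int_pow_pow int_pow_int[symmetric])
  then show ?thesis ..
qed

text \<open>Twisted conjugation by a power of \<open>y\<close> changes the exponent by an even number. Since \<open>m\<close> is odd, the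
  exponent becomes \<open>0\<close> or \<open>m\<close>, and \<open>y\<^sup>m = z = \<phi>(x)\<^sup>-\<^sup>1 x\<close> is twisted conjugate to the identity.\<close>

lemma tw_conj_one:
  assumes tw "N u = [d]" and [simp]: "u \<in> carrier G"
  shows "tw_conj u \<one>"
proof -
  obtain e :: int where e: "u = y [^] e" using power_of_y assms by blast
  have shift: "tw_conj (y [^] e) (y [^] (e - 2 * f))" for e f :: int
  proof -
    have "\<phi> (y [^] (- f)) = y [^] f"
      using assms(1) by (simp add: \<phi>.hom_int_pow \<phi>_y int_pow_inv int_pow_neg)
    then have "tconj (y [^] (- f)) (y [^] e) = y [^] (- f) \<otimes> y [^] e \<otimes> y [^] (- f)"
      unfolding tconj_def by (simp add: int_pow_neg)
    also have "\<dots> = y [^] (e - 2 * f)" by (simp add: int_pow_mult[symmetric])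
    finally show ?thesis unfolding tw_conj_def by (metis int_pow_closed y_closed)
  qed
  show ?thesis
  proof (cases "even e")
    case True
    then show ?thesis using shift[of e "e div 2"] e by simp
  next
    case False
    then have "even (e - int m)" using m_odd by simp
    then obtain f where "e - int m = 2 * f" by (elim evenE)
    then have "e - 2 * f = int m" by simp
    then have "tw_conj u z" using shift[of e f] e by (simp add: z_def int_pow_int)
    moreover have "tw_conj z \<one>"
    proof -
      have "tconj (inv x) z = inv x \<otimes> (x \<otimes> x) \<otimes> inv x"
        using assms(1) by (simp add: tconj_def \<phi>_x x_x)
      then show ?thesis unfolding tw_conj_def by (intro bexI[of _ "inv x"]) (simp_all add: m_assoc)
    qed
    ultimately show ?thesis using tw_conj_trans by simp
  qed
qed

lemma parity_conj_rot: "cyclic m S \<Longrightarrow> parity_conj (el (S @ [0])) (el ((rot m tw ^^ r) S @ [0])) (int r)"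
proof (induction r)
  case 0
  then show ?case by (simp add: parity_conj_refl)
next
  case (Suc r)
  define S' where "S' = (rot m tw ^^ r) S"
  have cyc: "cyclic m S'" using Suc cyclic_rot_funpow S'_def by simp
  then obtain j T where S': "S' = j # T" by (cases S') (auto simp: cyclic_def)
  have N: "N (el (j # T @ [0])) = j # T @ [0]" using N_el[OF nf_cyclic[OF _ cyc]] S' by simp
  have "parity_conj (el (S' @ [0])) (el (rot m tw S' @ [0])) 1"
    unfolding parity_conj_def using N_rotate[OF N] S' m_odd
    by (intro bexI[of _ "y [^] flp j \<otimes> x"]) (simp_all add: rot_def ab_mult ab_x ab_y_pow)
  then have "parity_conj (el (S @ [0])) (el (rot m tw S' @ [0])) (int r + 1)"
    using Suc parity_conj_trans[of _ "el (S' @ [0])"] S'_def by simp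
  then show ?case by (simp add: S'_def add.commute)
qed

lemma nf_core:
  assumes "u \<in> carrier G"
  shows "N (el (core m tw (N u))) = core m tw (N u)"
  using parity_conj_core[OF assms] N_el nf_cyclic by (metis nf_single m_pos)

lemma twisted_conjugacy_test:
  assumes [simp]: "u \<in> carrier G" "v \<in> carrier G"
  shows "tw_conj u v \<longleftrightarrow> accepts m tw (N u) (N v) (ab u - ab v)"
proof -
  define cu where "cu = core m tw (N u)"
  define cv where "cv = core m tw (N v)"
  define ru where "ru = int (rounds m tw (N u))"
  define rv where "rv = int (rounds m tw (N v))"
  have U: "parity_conj u (el cu) ru" "(\<exists>d<m. cu = [d]) \<or> (\<exists>S. cyclic m S \<and> cu = S @ [0])"
    using parity_conj_core[of u] by (auto simp: cu_def ru_def)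
  have V: "parity_conj v (el cv) rv" "(\<exists>d<m. cv = [d]) \<or> (\<exists>S. cyclic m S \<and> cv = S @ [0])"
    using parity_conj_core[of v] by (auto simp: cv_def rv_def)
  have Ncu: "N (el cu) = cu" and Ncv: "N (el cv) = cv" by (simp_all add: cu_def cv_def nf_core)
  have accepts: "accepts m tw (N u) (N v) (ab u - ab v) \<longleftrightarrow> length cu = length cv \<and> (\<not> tw \<longrightarrow> ab u = ab v) \<and>
      (length cu = 1 \<or>
       (\<exists>r < 2 * (length cu - 1). (rot m tw ^^ r) (butlast cu) = butlast cv \<and>
          (tw \<longrightarrow> 4 dvd ab u - ab v + 2 * (ru + rv + int r))))"
    by (simp add: accepts_def Let_def cu_def cv_def ru_def rv_def)
  show ?thesis
  proof
    assume "tw_conj u v"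
    then obtain w where [simp]: "w \<in> carrier G" and v: "v = tconj w u" unfolding tw_conj_def by blast
    have abv: "ab v = ab u + (if tw then 2 * ab w else 0)" by (simp add: v ab_tconj)
    have "parity_conj u v (ab w)" unfolding parity_conj_def using v by auto
    then have cc: "parity_conj (el cu) (el cv) (ru + ab w + rv)"
      using parity_conj_trans[OF parity_conj_trans[OF parity_conj_sym[OF U(1)]] V(1)] by simp
    show "accepts m tw (N u) (N v) (ab u - ab v)"
    proof (cases "\<exists>S. cyclic m S \<and> cu = S @ [0]")
      case True
      then obtain S where S: "cyclic m S" "cu = S @ [0]" by blast
      obtain w0 where w0: "w0 \<in> carrier G" "cv = N (tconj w0 (el cu))" "even (ab w0 + (ru + ab w + rv))"
        using cc unfolding parity_conj_def Ncv by blast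
      obtain r :: nat where r: "even (ab w0 + int r)" "cv = (rot m tw ^^ r) S @ [0]"
        using rotation_complete[of S "el cu" w0] S w0 V(2) Ncu by auto
      have len: "length ((rot m tw ^^ n) S) = length S" for n
        by (induction n) (use S in \<open>auto simp: rot_def cyclic_def Suc_diff_le\<close>)
      have "S \<noteq> []" using S by (simp add: cyclic_def)
      define r' where "r' = r mod (2 * length S)"
      have period: "(rot m tw ^^ (n * (2 * length S))) S = S" for n
        using rot_period[of S m tw] S(1) by (induction n) (simp_all add: funpow_add cyclic_def)
      have "(rot m tw ^^ r') S = (rot m tw ^^ r) S"
      proof -
        have "(rot m tw ^^ r) S = (rot m tw ^^ (r' + (r div (2 * length S)) * (2 * length S))) S"
          by (simp only: r'_def mod_div_mult_eq)
        also have "\<dots> = (rot m tw ^^ r') S" by (simp only: funpow_add comp_apply period)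
        finally show ?thesis ..
      qed
      moreover have "r' < 2 * length S" using \<open>S \<noteq> []\<close> by (simp add: r'_def)
      moreover have "even (int r') \<longleftrightarrow> even (int r)"
        by (simp add: r'_def dvd_mod_iff)
      then have "even (ru + rv + int r' - ab w)" using r(1) w0(3) by presburger
      then have "4 dvd - 2 * ab w + 2 * (ru + rv + int r')" by presburger
      ultimately show ?thesis
        unfolding accepts using abv r(2) len S(2) by (intro conjI disjI2 exI[of _ r']) auto
    next
      case False
      then obtain d where d: "cu = [d]" using U(2) by blast
      have "length cv = 1"
      proof (rule ccontr)
        assume "length cv \<noteq> 1"
        then obtain T where T: "cyclic m T" "cv = T @ [0]" using V(2) by auto
        obtain w0 where w0: "w0 \<in> carrier G" "cu = N (tconj w0 (el cv))"
          using parity_conj_sym[OF cc] unfolding parity_conj_def Ncu by auto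
        then obtain r :: nat where "cu = (rot m tw ^^ r) T @ [0]"
          using rotation_complete[of T "el cv" w0] T d Ncv by (metis el_closed)
        then have "(rot m tw ^^ r) T = []" using d by simp
        then show False using cyclic_rot_funpow[OF T(1)] by (simp add: cyclic_def)
      qed
      then show ?thesis unfolding accepts using d abv by simp
    qed
  next
    assume acc: "accepts m tw (N u) (N v) (ab u - ab v)"
    show "tw_conj u v"
    proof (cases "length cu = 1")
      case True
      then obtain d d' where d: "cu = [d]" "cv = [d']"
        using acc unfolding accepts by (metis One_nat_def length_0_conv length_Suc_conv)
      obtain w where [simp]: "w \<in> carrier G" and w: "N (tconj w u) = [d]"
        using U(1) d Ncu unfolding parity_conj_def by auto
      obtain w' where [simp]: "w' \<in> carrier G" and w': "N (tconj w' v) = [d']"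
        using V(1) d Ncv unfolding parity_conj_def by auto
      have tw_conj: "tw_conj u (tconj w u)" "tw_conj v (tconj w' v)" unfolding tw_conj_def by auto
      show ?thesis
      proof (cases tw)
        case True
        then have "tw_conj u \<one>" "tw_conj v \<one>"
          using tw_conj_one[OF _ w] tw_conj_one[OF _ w'] tw_conj tw_conj_trans[of u] tw_conj_trans[of v] by auto
        then show ?thesis using tw_conj_sym tw_conj_trans by (meson assms)
      next
        case False
        obtain e e' :: int where e: "tconj w u = y [^] e" "tconj w' v = y [^] e'"
          using power_of_y[OF w] power_of_y[OF w'] by auto
        have "ab (tconj w u) = ab (tconj w' v)"
          using acc False unfolding accepts by (simp add: ab_tconj)
        then have "e = e'" unfolding e by (simp add: ab_int_pow ab_y)
        then have "tw_conj v (tconj w u)" using tw_conj(2) e by simp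
        then show ?thesis using tw_conj(1) tw_conj_sym tw_conj_trans by (meson assms)
      qed
    next
      case False
      then obtain r where r: "(rot m tw ^^ r) (butlast cu) = butlast cv"
          "tw \<Longrightarrow> 4 dvd ab u - ab v + 2 * (ru + rv + int r)"
        and len: "length cu = length cv" and plain: "\<not> tw \<Longrightarrow> ab u = ab v"
        using acc unfolding accepts by blast
      obtain S where S: "cyclic m S" "cu = S @ [0]" using U(2) False by auto
      obtain T where T: "cyclic m T" "cv = T @ [0]" using V(2) False len by auto
      have "parity_conj (el cu) (el cv) (int r)" using parity_conj_rot[OF S(1), of r] r(1) S(2) T(2) by simp
      then have "parity_conj u v (ru + int r + rv)"
        using parity_conj_trans[OF parity_conj_trans[OF U(1)] parity_conj_sym[OF V(1)]] by simp
      then show ?thesis by (rule tw_conj_if_parity_conj) (use r(2) plain in \<open>simp_all add: algebra_simps\<close>)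
    qed
  qed
qed

end


section \<open>Automorphisms\<close>

lemma nf_append_positive:
  assumes "\<forall>d\<in>set P. 0 < d \<and> d < m" "nf m L" "P = [] \<or> hd L \<noteq> 0 \<or> length L = 1"
  shows "nf m (P @ L)"
proof (cases P)
  case (Cons a P')
  show ?thesis
  proof (cases L rule: list_ends_cases)
    case 1 then show ?thesis using assms by simp
  next
    case (2 d)
    then show ?thesis using assms Cons nf_ends[of m a P' d] by simp
  next
    case (3 p L' q)
    then show ?thesis using assms Cons nf_ends[of m a "P' @ p # L'" q] by auto
  qed
qed (use assms in simp)

context torus_knot
begin

lemma conj_power:
  assumes "w \<in> carrier G" "g \<in> carrier G"
  shows "(inv w \<otimes> g \<otimes> w) [^] (n::nat) = inv w \<otimes> g [^] n \<otimes> w"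
  by (induction n) (use assms in \<open>simp_all add: m_assoc\<close>)

lemma N_conj_central:
  assumes "N h = [0]" "w \<in> carrier G" "h \<in> carrier G"
  shows "inv w \<otimes> h \<otimes> w = h"
proof -
  obtain c :: int where "h = z [^] c" using assms N_eq_0_iff by auto
  then show ?thesis using assms by (simp add: zc_comm m_assoc)
qed

text \<open>Torsion of the free product is conjugate into a factor: a cyclically reduced word of several
  syllables has powers that are longer and longer.\<close>

lemma torsion_mod_center:
  assumes [simp]: "g \<in> carrier G" and "N (g [^] n) = [0]" "0 < (n::nat)"
  shows "\<exists>w\<in>carrier G. N (inv w \<otimes> g \<otimes> w) = [0, 0] \<or> (\<exists>d<m. N (inv w \<otimes> g \<otimes> w) = [d])"
proof -
  have T: "twisted G m x y N ab (\<lambda>g. g) False"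
    by (intro twisted.intro torus_knot_axioms twisted_axioms.intro) (auto simp: hom_def)
  note parity_conj_core = twisted.parity_conj_core[OF T \<open>g \<in> carrier G\<close>]
  obtain w where [simp]: "w \<in> carrier G" and w: "N (inv w \<otimes> g \<otimes> w) = core m False (N g)"
    using parity_conj_core twisted.nf_core[OF T \<open>g \<in> carrier G\<close>]
    unfolding twisted.parity_conj_def[OF T] twisted.tconj_def[OF T] by auto
  define h where "h = inv w \<otimes> g \<otimes> w"
  have [simp]: "h \<in> carrier G" by (simp add: h_def)
  have hn: "N (h [^] n) = [0]"
    unfolding h_def conj_power[OF \<open>w \<in> carrier G\<close> \<open>g \<in> carrier G\<close>]
    using assms N_conj_central[of "g [^] n" w] by simp
  have "\<not> (\<exists>S. S \<noteq> [] \<and> (\<forall>d\<in>set S. 0 < d \<and> d < m) \<and> N h = S @ [0])"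
  proof
    assume "\<exists>S. S \<noteq> [] \<and> (\<forall>d\<in>set S. 0 < d \<and> d < m) \<and> N h = S @ [0]"
    then obtain S where S: "S \<noteq> []" "\<forall>d\<in>set S. 0 < d \<and> d < m" "N h = S @ [0]" by blast
    have "N (h [^] k) = concat (replicate k S) @ [0]" for k :: nat
    proof (induction k)
      case 0 then show ?case by (simp add: N_one)
    next
      case (Suc k)
      have pos: "\<forall>d\<in>set (concat (replicate k S) @ S). 0 < d \<and> d < m" using S by auto
      have "join_nf m (concat (replicate k S) @ [0]) (S @ [0]) = concat (replicate k S) @ S @ [0]"
        using S by (cases S) (auto simp: join_nf_def)
      moreover have "nf m (concat (replicate k S) @ S @ [0])"
        using nf_append_positive[OF pos, of "[0]"] by simp
      ultimately have "N (h [^] k \<otimes> h) = concat (replicate k S) @ S @ [0]"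
        using N_mult[of "h [^] k" h] Suc S(3) by simp
      moreover have "concat (replicate k S) @ S = S @ concat (replicate k S)"
        by (induction k) auto
      ultimately show ?case by simp
    qed
    then have "concat (replicate n S) = []" using hn by simp
    then show False using S(1) assms(3) by simp
  qed
  moreover have "(\<exists>d<m. N h = [d]) \<or> (\<exists>S. cyclic m S \<and> N h = S @ [0])"
    using parity_conj_core w by (simp add: h_def)
  ultimately have "N h = [0, 0] \<or> (\<exists>d<m. N h = [d])"
    by (auto simp: cyclic_def intro!: gr0I)
  then show ?thesis by (auto simp: h_def)
qed

lemma N_y_mult: "c \<in> carrier G \<Longrightarrow> N (y \<otimes> c) = ((1 + hd (N c)) mod m) # tl (N c)"
proof -
  assume c: "c \<in> carrier G"
  then have "nf m (N c)" using nf_N by simp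
  then have "nf m (((1 + hd (N c)) mod m) # tl (N c))" by (cases "N c" rule: list_ends_cases) auto
  then show ?thesis using N_mult[of y c] c N_y_pow[of 1] m_ge by (simp add: join_nf_def)
qed

text \<open>Multiplication by \<open>y\<close> on the left changes the first exponent, on the right the last one. For a
  central element they must therefore be the same, and \<open>x\<close> excludes the nontrivial powers of \<open>y\<close>.\<close>

lemma central_elements:
  assumes [simp]: "c \<in> carrier G" and "c \<otimes> x = x \<otimes> c" "c \<otimes> y = y \<otimes> c"
  shows "N c = [0]"
proof (cases "N c" rule: list_ends_cases)
  case 1 then show ?thesis by simp
next
  case (2 d)
  then have d: "d < m" using nf_N[of c] by simp
  have "N (x \<otimes> c) = [0, d]" using N_mult[of x c] d by (simp add: N_x 2 join_nf_def)
  moreover have "N (c \<otimes> x) = [d, 0]" by (simp add: N_mult_x 2 push_x_def)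
  ultimately show ?thesis using assms 2 by simp
next
  case (3 a l b)
  have a: "a < m" using 3 nf_N[of c] by simp
  have "N (c \<otimes> y) = a # l @ [(b + 1) mod m]"
    using 3 by (simp add: N_mult_y push_y_def butlast_append)
  moreover have "N (y \<otimes> c) = ((1 + a) mod m) # l @ [b]" using 3 by (simp add: N_y_mult)
  ultimately have "(1 + a) mod m = a" using assms by simp
  then have "(1 + a) mod m = a mod m" using a by simp
  then show ?thesis using m_ge a by (cases "1 + a < m") (auto simp: mod_if)
qed

definition signed where "signed tw g = (if tw then inv g else g)"

lemma signed_closed [simp]: "g \<in> carrier G \<Longrightarrow> signed tw g \<in> carrier G"
  by (simp add: signed_def)

lemma N_signed_x: "N (signed tw x) = [0, 0]"
  by (simp add: signed_def N_x N_inv_x)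

lemma N_signed_y: "N (signed tw y) = [flip m tw 1]"
  using N_y_pow_neg[of 1] N_y_pow[of 1] m_ge by (simp add: signed_def flip_def)

lemma automorphism_center:
  assumes "\<psi> \<in> auto G"
  shows "\<exists>tw. \<psi> z = signed tw z"
proof -
  have hom: "\<psi> \<in> hom G G" and bij: "bij_betw \<psi> (carrier G) (carrier G)"
    using assms by (auto simp: auto_def Bij_def)
  interpret \<psi>: group_hom G G \<psi> by unfold_locales (rule hom)
  have surj: "\<exists>t\<in>carrier G. \<psi> t = g" if "g \<in> carrier G" for g
    using bij that by (metis bij_betw_imp_surj_on image_iff)
  have "\<psi> z \<otimes> g = g \<otimes> \<psi> z" if g: "g \<in> carrier G" for g
  proof -
    obtain t where "t \<in> carrier G" "\<psi> t = g" using surj[OF g] by blast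
    then show ?thesis using z_comm[of t] \<psi>.hom_mult by (metis z_closed)
  qed
  then have "N (\<psi> z) = [0]" by (intro central_elements) auto
  then obtain a :: int where a: "\<psi> z = z [^] a" using N_eq_0_iff by auto
  obtain t where t: "t \<in> carrier G" "\<psi> t = z" using surj[of z] by auto
  have inj: "inj_on \<psi> (carrier G)" using bij by (simp add: bij_betw_def)
  have "t \<otimes> g = g \<otimes> t" if g: "g \<in> carrier G" for g
  proof (rule inj_onD[OF inj])
    show "\<psi> (t \<otimes> g) = \<psi> (g \<otimes> t)" using t g by (simp add: z_comm)
  qed (use t g in auto)
  then have "N t = [0]" using t by (intro central_elements) auto
  then obtain b :: int where b: "t = z [^] b" using N_eq_0_iff t by auto
  have "z = z [^] (a * b)"
    using t b a by (metis \<psi>.hom_int_pow int_pow_pow z_closed)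
  then have "ab z = a * b * ab z" using ab_int_pow[of z "a * b"] by simp
  then have "a * b = 1" using m_ge by (simp add: ab_z)
  then have "a = 1 \<or> a = -1" by (auto simp: zmult_eq_1_iff)
  then show ?thesis using a by (metis int_pow_1 int_pow_neg int_pow_one signed_def z_closed)
qed

text \<open>The images of \<open>x\<close> and \<open>y\<close> are torsion modulo the centre. Since \<open>\<psi> z = z\<^bsup>\<plusminus>1\<^esup>\<close>, comparing
  abelianizations of \<open>(\<psi> x)\<^sup>2 = (\<psi> y)\<^sup>m = \<psi> z\<close> leaves only one conjugacy class for each image;
  that \<open>m\<close> is odd separates the two factors.\<close>

lemma automorphism_generators:
  assumes "\<psi> \<in> auto G"
  shows "\<exists>tw. \<exists>p\<in>carrier G. \<exists>q\<in>carrier G.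
    \<psi> x = p \<otimes> signed tw x \<otimes> inv p \<and> \<psi> y = q \<otimes> signed tw y \<otimes> inv q"
proof -
  have hom: "\<psi> \<in> hom G G" using assms by (auto simp: auto_def)
  interpret \<psi>: group_hom G G \<psi> by unfold_locales (rule hom)
  obtain tw where tw: "\<psi> z = signed tw z" using automorphism_center[OF assms] by blast
  define a :: int where "a = (if tw then -1 else 1)"
  have abz: "ab (\<psi> z) = 2 * int m * a" by (simp add: tw signed_def a_def ab_inv ab_z)
  have Nz: "N (\<psi> z) = [0]" using N_z[of a] by (simp add: tw signed_def a_def int_pow_neg split: if_splits)
  have x2: "\<psi> x [^] (2::nat) = \<psi> z" by (simp add: numeral_2_eq_2 x_x[symmetric])
  have ym: "\<psi> y [^] m = \<psi> z" by (simp add: z_def \<psi>.hom_nat_pow)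
  have ab_pow: "ab (g [^] (n::nat)) = int n * ab g" if "g \<in> carrier G" for g n
    using ab_int_pow[OF that, of "int n"] by (simp add: int_pow_int)
  obtain p where [simp]: "p \<in> carrier G"
    and p: "N (inv p \<otimes> \<psi> x \<otimes> p) = [0, 0] \<or> (\<exists>d<m. N (inv p \<otimes> \<psi> x \<otimes> p) = [d])"
    using torsion_mod_center[of "\<psi> x" 2] x2 Nz by auto
  obtain q where [simp]: "q \<in> carrier G"
    and q: "N (inv q \<otimes> \<psi> y \<otimes> q) = [0, 0] \<or> (\<exists>d<m. N (inv q \<otimes> \<psi> y \<otimes> q) = [d])"
    using torsion_mod_center[of "\<psi> y" m] ym Nz by auto
  define g where "g = inv p \<otimes> \<psi> x \<otimes> p"
  define h where "h = inv q \<otimes> \<psi> y \<otimes> q"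
  have [simp]: "g \<in> carrier G" "h \<in> carrier G" by (simp_all add: g_def h_def)
  have abg: "ab g = int m * a"
    using ab_pow[of "\<psi> x" 2] abz x2 by (simp add: g_def ab_mult ab_inv)
  have abh: "ab h = 2 * a"
    using ab_pow[of "\<psi> y" m] abz ym m_ge by (simp add: h_def ab_mult ab_inv)
  have "g = signed tw x"
  proof (cases "N g = [0, 0]")
    case True
    then obtain c :: int where c: "g = x \<otimes> z [^] c" using N_eq_iff[of g x] N_x by auto
    then have "int m * (1 + 2 * c) = int m * a" using abg by (simp add: ab_mult ab_x ab_int_pow ab_z algebra_simps)
    then have "1 + 2 * c = a" using m_ge by simp
    then have "c = (if tw then -1 else 0)" by (auto simp: a_def split: if_splits)
    moreover have "x \<otimes> z [^] (-1::int) = inv x"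
      by (simp add: int_pow_neg x_x[symmetric] inv_mult_group)
    ultimately show ?thesis using c by (simp add: signed_def)
  next
    case False
    then obtain d where "d < m" "N g = N (y [^] d)" using p by (auto simp: g_def N_y_pow)
    then obtain c :: int where "g = y [^] d \<otimes> z [^] c" using N_eq_iff[of g "y [^] d"] by auto
    then have "int m * a = 2 * (int d + int m * c)"
      using abg by (simp add: ab_mult ab_y_pow ab_int_pow ab_z algebra_simps)
    then have "even (int m * a)" by simp
    then show ?thesis using m_odd by (simp add: a_def split: if_splits)
  qed
  moreover have "h = signed tw y"
  proof (cases "N h = [0, 0]")
    case True
    then obtain c :: int where c: "h = x \<otimes> z [^] c" using N_eq_iff[of h x] N_x by auto
    then have "int m * (1 + 2 * c) = 2 * a" using abh by (simp add: ab_mult ab_x ab_int_pow ab_z algebra_simps)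
    then have "even (int m * (1 + 2 * c))" by simp
    then show ?thesis using m_odd by simp
  next
    case False
    then obtain d where "d < m" "N h = N (y [^] d)" using q by (auto simp: h_def N_y_pow)
    then obtain c :: int where c: "h = y [^] d \<otimes> z [^] c" using N_eq_iff[of h "y [^] d"] by auto
    then have h: "h = y [^] (int d + int m * c)"
      by (simp add: z_def int_pow_mult int_pow_pow int_pow_int[symmetric])
    then have "int d + int m * c = a" using abh by (simp add: ab_int_pow ab_y)
    then show ?thesis using h by (auto simp: signed_def a_def int_pow_neg)
  qed
  moreover have "\<psi> x = p \<otimes> g \<otimes> inv p" "\<psi> y = q \<otimes> h \<otimes> inv q"
    by (simp_all add: g_def h_def m_assoc)
  ultimately show ?thesis by (metis \<open>p \<in> carrier G\<close> \<open>q \<in> carrier G\<close>)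
qed

end

lemma join_nf_x: "P \<noteq> [] \<Longrightarrow> last P < m \<Longrightarrow> join_nf m P [0, 0] = P @ [0]"
  by (simp add: join_nf_def)

context torus_knot
begin

text \<open>If \<open>q\<close> ends in \<open>x\<close> and begins with a nontrivial power of \<open>y\<close>, then there is no cancellation in an
  alternating product of \<open>x\<close> and conjugates \<open>q y\<^sup>i q\<^sup>-\<^sup>1\<close>. Hence no such product is as short as \<open>y\<close>.\<close>

lemma not_surjective:
  assumes hom: "\<theta> \<in> hom G G"
    and \<theta>x: "\<theta> x = signed tw x" and \<theta>y: "\<theta> y = q \<otimes> signed tw y \<otimes> inv q"
    and [simp]: "q \<in> carrier G" and Nq: "N q = P @ [0]" "P \<noteq> []" "\<forall>d\<in>set P. 0 < d"
  shows "y \<notin> \<theta> ` carrier G"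
proof
  interpret \<theta>: group_hom G G \<theta> by unfold_locales (rule hom)
  have P: "\<forall>d\<in>set P. 0 < d \<and> d < m" using nf_N[of q] Nq by (auto simp: nf_def)
  define P' where "P' = rev (map (neg_mod m) P)"
  have P': "\<forall>d\<in>set P'. 0 < d \<and> d < m" using P by (auto simp: P'_def)
  have Ninv: "N (inv q) = 0 # P'" by (simp add: N_inv Nq P'_def)
  have y_image: "N (\<theta> (y [^] i)) = P @ flip m tw i # P'" if i: "0 < i" "i < m" for i
  proof -
    have "\<theta> (y [^] i) = q \<otimes> (signed tw y) [^] i \<otimes> inv q"
      using conj_power[of "inv q" "signed tw y" i] by (simp add: \<theta>.hom_nat_pow \<theta>y)
    moreover have "N ((signed tw y) [^] i) = [flip m tw i]"
      using i by (cases tw) (simp_all add: signed_def flip_def nat_pow_inv N_y_pow_neg N_y_pow)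
    moreover have "nf m (P @ [flip m tw i])" "nf m (P @ flip m tw i # P')"
      using P P' i nf_append_positive[of P m "[flip m tw i]"]
        nf_positive[of "P @ flip m tw i # P'" m] by auto
    ultimately show ?thesis
      using i N_mult[of q "(signed tw y) [^] i"] N_mult[of "q \<otimes> (signed tw y) [^] i" "inv q"]
      by (simp add: Nq Ninv join_nf_def)
  qed
  have image: "l = [0] \<or> hd (N (\<theta> (el l))) \<noteq> 0 \<and> 2 \<le> length (N (\<theta> (el l)))"
    if "l \<noteq> []" "\<forall>d\<in>set l. d < m" "\<forall>d\<in>set (butlast l). 0 < d" for l
    using that
  proof (induction l rule: el.induct)
    case (2 i)
    then show ?case using y_image[of i] P Nq(2) by (cases "i = 0"; cases P; cases P'; auto simp: P'_def)
  next
    case (3 i j l)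
    define l' where "l' = j # l"
    have i: "0 < i" "i < m" using 3 by auto
    define Q where "Q = P @ flip m tw i # P'"
    have Q: "\<forall>d\<in>set Q. 0 < d \<and> d < m" using P P' i by (auto simp: Q_def)
    have IH: "l' = [0] \<or> hd (N (\<theta> (el l'))) \<noteq> 0 \<and> 2 \<le> length (N (\<theta> (el l')))"
      unfolding l'_def using 3 by (intro 3) auto
    have nfl: "nf m (N (\<theta> (el l')))" by (simp add: nf_N)
    have "nf m (Q @ [0])" using nf_append_positive[OF Q, of "[0]"] by simp
    then have N1: "N (\<theta> (y [^] i) \<otimes> \<theta> x) = Q @ [0]"
      using N_mult[of "\<theta> (y [^] i)" "\<theta> x"] y_image[OF i] Q join_nf_x[of Q m]
      by (simp add: \<theta>x N_signed_x Q_def[symmetric] del: \<theta>.hom_nat_pow) (simp add: Q_def)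
    have nf: "nf m (Q @ N (\<theta> (el l')))"
      using IH nfl by (intro nf_append_positive[OF Q]) (auto simp: N_one)
    moreover have "join_nf m (Q @ [0]) (N (\<theta> (el l'))) = Q @ N (\<theta> (el l'))"
      using nfl by (cases "N (\<theta> (el l'))") (auto simp: join_nf_def nf_def)
    ultimately have "N (\<theta> (y [^] i) \<otimes> \<theta> x \<otimes> \<theta> (el l')) = Q @ N (\<theta> (el l'))"
      using N_mult[of "\<theta> (y [^] i) \<otimes> \<theta> x" "\<theta> (el l')"] N1 by (simp del: \<theta>.hom_nat_pow)
    then have "N (\<theta> (el (i # l'))) = Q @ N (\<theta> (el l'))" by (simp add: el_Cons l'_def)
    moreover have "length (N (\<theta> (el l'))) \<ge> 1" using nfl by (cases "N (\<theta> (el l'))") auto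
    moreover have "Q \<noteq> []" "hd Q \<noteq> 0" using P Nq(2) by (auto simp: Q_def hd_append)
    moreover have "length Q \<ge> 1" using \<open>Q \<noteq> []\<close> by (cases Q) auto
    ultimately show ?case by (simp add: l'_def)
  qed simp
  assume "y \<in> \<theta> ` carrier G"
  then obtain h where h: "h \<in> carrier G" "y = \<theta> h" by blast
  obtain c :: int where c: "h = el (N h) \<otimes> z [^] c" using normal_form[OF h(1)] by blast
  have "N (\<theta> z) = [0]"
    using N_z[of 1] N_z[of "-1"] by (cases tw) (simp_all add: x_x[symmetric] \<theta>x signed_def inv_mult_group int_pow_neg)
  then obtain e :: int where "\<theta> z = z [^] e" using N_eq_0_iff by auto
  then have "\<theta> (z [^] c) = z [^] (e * c)" by (simp add: \<theta>.hom_int_pow int_pow_pow)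
  then have "N y = N (\<theta> (el (N h)))"
    using c h(2) by (metis N_mult_z \<theta>.hom_closed \<theta>.hom_mult el_closed int_pow_closed z_closed)
  then have N1: "N (\<theta> (el (N h))) = [1]" using N_y_pow[of 1] m_ge by simp
  have nfh: "nf m (N h)" using nf_N h by simp
  then obtain i l where l: "N h = i # l" by (cases "N h") auto
  show False
  proof (cases "l = [] \<or> 0 < i")
    case True
    have "\<forall>d\<in>set (butlast (N h)). 0 < d"
      using nfh True l by (cases "N h" rule: list_ends_cases) auto
    moreover have "\<forall>d\<in>set (N h). d < m" using nfh by (auto simp: nf_def)
    ultimately have "N h = [0]" using image[of "N h"] N1 l by auto
    then show False using N1 by (simp add: N_one)
  next
    case False
    have L: "\<forall>d\<in>set (butlast l). 0 < d" "\<forall>d\<in>set l. d < m"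
      using nfh False unfolding l by (auto simp: nf_def intro: gr0I)
    have "el (N h) = x \<otimes> el l" using False l by (simp add: el_Cons)
    then have N2: "N (\<theta> x \<otimes> \<theta> (el l)) = [1]" using N1 by simp
    show False
    proof (cases "l = [0]")
      case True
      then show False using N2 by (simp add: \<theta>x N_signed_x)
    next
      case l0: False
      then have hd: "hd (N (\<theta> (el l))) \<noteq> 0" using image[of l] L False by blast
      have "nf m (N (\<theta> (el l)))" by (simp add: nf_N)
      then have "nf m (0 # N (\<theta> (el l)))" using hd nf_ends[of m 0 "a # b" c for a b c]
        by (cases "N (\<theta> (el l))" rule: list_ends_cases) auto
      moreover have "join_nf m [0, 0] (N (\<theta> (el l))) = 0 # N (\<theta> (el l))"
        using \<open>nf m (N (\<theta> (el l)))\<close> by (cases "N (\<theta> (el l))") (auto simp: join_nf_def nf_def)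
      ultimately have "N (\<theta> x \<otimes> \<theta> (el l)) = 0 # N (\<theta> (el l))"
        using N_mult[of "\<theta> x" "\<theta> (el l)"] by (simp add: \<theta>x N_signed_x)
      then show False using N2 by simp
    qed
  qed
qed

text \<open>The two conjugating elements \<open>p\<close> and \<open>q\<close> of the generators can be made equal: what remains of
  \<open>p\<^sup>-\<^sup>1 q\<close> after absorbing a factor \<open>x\<close> into \<open>p\<close> is a power of \<open>y\<close>, which \<open>q\<close> can lose, or else
  surjectivity fails.\<close>

lemma automorphism_inner:
  assumes "\<psi> \<in> auto G"
  shows "\<exists>tw. \<exists>g\<in>carrier G. \<psi> x = g \<otimes> signed tw x \<otimes> inv g \<and> \<psi> y = g \<otimes> signed tw y \<otimes> inv g"
proof -
  have hom: "\<psi> \<in> hom G G" and bij: "bij_betw \<psi> (carrier G) (carrier G)"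
    using assms by (auto simp: auto_def Bij_def)
  interpret \<psi>: group_hom G G \<psi> by unfold_locales (rule hom)
  obtain tw p q where [simp]: "p \<in> carrier G" "q \<in> carrier G"
    and p: "\<psi> x = p \<otimes> signed tw x \<otimes> inv p" and q: "\<psi> y = q \<otimes> signed tw y \<otimes> inv q"
    using automorphism_generators[OF assms] by blast
  have commutes: "signed tw h \<otimes> k = k \<otimes> signed tw h" if "h \<otimes> k = k \<otimes> h" "h \<in> carrier G" "k \<in> carrier G" for h k
    using that commute_inv[of k h] by (auto simp: signed_def)
  \<comment> \<open>A leading letter \<open>x\<close> of \<open>p\<^sup>-\<^sup>1 q\<close> is moved into \<open>p\<close>; it commutes with \<open>x\<^bsup>\<plusminus>1\<^esup>\<close>.\<close>
  have "\<exists>g\<in>carrier G. \<exists>r\<in>carrier G. \<psi> x = g \<otimes> signed tw x \<otimes> inv g \<and> q = g \<otimes> r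
    \<and> ((\<exists>d. N r = [d]) \<or> (\<exists>a l b. N r = a # l @ [b] \<and> 0 < a))"
  proof (cases "N (inv p \<otimes> q)" rule: list_ends_cases)
    case 1 then show ?thesis by simp
  next
    case (2 d)
    then show ?thesis using p by (intro bexI[of _ p] bexI[of _ "inv p \<otimes> q"]) auto
  next
    case (3 a l b)
    show ?thesis
    proof (cases "a = 0")
      case False
      then show ?thesis using p 3 by (intro bexI[of _ p] bexI[of _ "inv p \<otimes> q"]) auto
    next
      case True
      have nf: "nf m (0 # l @ [b])" using 3 True nf_N[of "inv p \<otimes> q"] by simp
      define r where "r = inv (p \<otimes> x) \<otimes> q"
      have "N (inv p \<otimes> q) = N (x \<otimes> el (l @ [b]))"
        using 3 True N_el_N[of "inv p \<otimes> q"] by (simp add: el_Cons)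
      then have "N (inv x \<otimes> (inv p \<otimes> q)) = N (inv x \<otimes> (x \<otimes> el (l @ [b])))"
        by (rule N_mult_cong[OF HOL.refl]) simp_all
      moreover have "nf m (l @ [b])"
        using nf nf_append_positive[of l m "[b]"] by auto
      ultimately have "N r = l @ [b]" using N_el by (simp add: r_def inv_mult_group m_assoc)
      moreover have "(\<exists>d. l @ [b] = [d]) \<or> (\<exists>a l' b'. l @ [b] = a # l' @ [b'] \<and> 0 < a)"
        using nf nf_ends[of m 0 l b] by (cases l) auto
      moreover have "\<psi> x = (p \<otimes> x) \<otimes> signed tw x \<otimes> inv (p \<otimes> x)"
        using p by (simp add: signed_def inv_mult_group m_assoc)
      ultimately show ?thesis
        by (intro bexI[of _ "p \<otimes> x"] bexI[of _ r]) (simp_all add: r_def)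
    qed
  qed
  then obtain g r where [simp]: "g \<in> carrier G" "r \<in> carrier G"
    and g: "\<psi> x = g \<otimes> signed tw x \<otimes> inv g" and qr: "q = g \<otimes> r"
    and r: "(\<exists>d. N r = [d]) \<or> (\<exists>a l b. N r = a # l @ [b] \<and> 0 < a)" by blast
  have \<psi>y: "\<psi> y = g \<otimes> (r \<otimes> signed tw y \<otimes> inv r) \<otimes> inv g"
    using q by (simp add: qr inv_mult_group m_assoc)
  show ?thesis
  proof (cases "\<exists>d. N r = [d]")
    case True
    then obtain d where "N r = [d]" by blast
    then have "N r = N (y [^] d)" using nf_N[of r] by (simp add: N_y_pow)
    then obtain c :: int where c: "r = y [^] d \<otimes> z [^] c" using N_eq_iff[of r "y [^] d"] by auto
    have "y \<otimes> y [^] d = y [^] d \<otimes> y"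
      by (metis nat_pow_comm nat_pow_eone y_closed)
    then have "y \<otimes> r = r \<otimes> y"
      unfolding c using zc_comm[of y c] by (metis int_pow_closed m_assoc nat_pow_closed y_closed z_closed)
    then have "signed tw y \<otimes> r = r \<otimes> signed tw y" by (intro commutes) simp_all
    then have "r \<otimes> signed tw y \<otimes> inv r = signed tw y" by (metis inv_solve_right' m_closed signed_closed y_closed \<open>r \<in> carrier G\<close>)
    then show ?thesis using g \<psi>y by (intro exI[of _ tw] bexI[of _ g]) simp_all
  next
    case False
    then obtain a l b where r: "N r = a # l @ [b]" "0 < a" using r by blast
    have nf: "nf m (a # l @ [b])" using nf_N[of r] r by simp
    define q' where "q' = r \<otimes> inv (y [^] b)"
    have [simp]: "q' \<in> carrier G" by (simp add: q'_def)
    have "N q' = a # l @ [0]"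
      using N_mult[of r "inv (y [^] b)"] nf r add_neg_mod[of b m]
      by (simp add: q'_def N_y_pow_neg join_nf_def butlast_append)
    moreover have "r \<otimes> signed tw y \<otimes> inv r = q' \<otimes> signed tw y \<otimes> inv q'"
    proof -
      have "y \<otimes> y [^] b = y [^] b \<otimes> y" by (metis nat_pow_comm nat_pow_eone y_closed)
      then have "signed tw y \<otimes> y [^] b = y [^] b \<otimes> signed tw y" by (intro commutes) simp_all
      then have "inv (y [^] b) \<otimes> (signed tw y \<otimes> y [^] b) = signed tw y" by simp
      then have "inv (y [^] b) \<otimes> (signed tw y \<otimes> (y [^] b \<otimes> inv r)) = signed tw y \<otimes> inv r"
        by (metis inv_closed m_assoc m_closed nat_pow_closed signed_closed y_closed \<open>r \<in> carrier G\<close>)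
      then show ?thesis by (simp add: q'_def inv_mult_group m_assoc)
    qed
    moreover define \<theta> where "\<theta> h = inv g \<otimes> \<psi> h \<otimes> g" for h
    have "\<theta> \<in> hom G G" by (auto simp: hom_def \<theta>_def m_assoc)
    moreover have "\<theta> x = signed tw x" "\<theta> y = r \<otimes> signed tw y \<otimes> inv r"
      by (simp_all add: \<theta>_def g \<psi>y m_assoc)
    moreover have "y \<in> \<theta> ` carrier G"
    proof -
      obtain h where "h \<in> carrier G" "\<psi> h = g \<otimes> y \<otimes> inv g"
        using bij by (metis bij_betw_imp_surj_on image_iff inv_closed m_closed y_closed \<open>g \<in> carrier G\<close>)
      then have "\<theta> h = y" by (simp add: \<theta>_def m_assoc)
      then show ?thesis using \<open>h \<in> carrier G\<close> by blast
    qed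
    ultimately show ?thesis using not_surjective[of \<theta> tw q' "a # l"] nf r by auto
  qed
qed

lemma N_inverse_half:
  assumes [simp]: "g \<in> carrier G"
  shows "N (inv g) = inverse_half (N (g \<otimes> signed tw x \<otimes> inv g)) (N (g \<otimes> signed tw y \<otimes> inv g))"
proof -
  have nf: "nf m (N g)" by (simp add: nf_N)
  define e where "e = flip m tw 1"
  have e: "0 < e" "e < m" using m_ge by (auto simp: e_def)
  define P' where "P' P = rev (map (neg_mod m) P)" for P
  have x_side: "N (g' \<otimes> signed tw x \<otimes> inv g') = P @ P' P"
    if [simp]: "g' \<in> carrier G" and P: "N g' = P" "0 < last P \<or> length P = 1" for g' P
  proof -
    have nfP: "nf m P" using P nf_N[of g'] by simp
    have 1: "nf m (P @ [0])"
      using nfP P(2) nf_ends[of m a "b @ [c]" 0 for a b c] by (cases P rule: list_ends_cases) auto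
    have P1: "P \<noteq> []" "last P < m" using nfP by (auto simp: nf_def)
    then have "join_nf m P [0, 0] = P @ [0]" by (simp add: join_nf_def)
    then have "N (g' \<otimes> signed tw x) = P @ [0]" using N_mult[of g' "signed tw x"] 1 P by (simp add: N_signed_x)
    moreover have "N (inv g') = P' P" by (simp add: N_inv P P'_def)
    moreover have "nf m (P @ P' P)"
    proof (cases P rule: list_ends_cases)
      case (3 a l b)
      then have "nf m (a # (l @ [b, neg_mod m b] @ rev (map (neg_mod m) l)) @ [neg_mod m a])"
        using nfP P unfolding nf_ends by auto
      then show ?thesis using 3 by (simp add: P'_def)
    qed (use nfP in \<open>auto simp: P'_def\<close>)
    moreover have "join_nf m (P @ [0]) (P' P) = P @ P' P"
      using \<open>nf m (P @ P' P)\<close> nfP P1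
      by (cases P rule: rev_cases) (auto simp: join_nf_def P'_def butlast_append)
    ultimately show ?thesis using N_mult[of "g' \<otimes> signed tw x" "inv g'"] by simp
  qed
  show ?thesis
  proof (cases "last (N g) = 0 \<and> length (N g) \<ge> 2")
    case False
    then have P: "0 < last (N g) \<or> length (N g) = 1"
      using nf by (cases "N g" rule: list_ends_cases) auto
    obtain P b where b: "N g = P @ [b]" using nf by (cases "N g" rule: rev_cases) auto
    have bm: "b < m" and Pm: "\<forall>d\<in>set P. d < m" using nf b by (auto simp: nf_def)
    have "N (g \<otimes> signed tw y) = P @ [(b + e) mod m]"
      using N_mult[of g "signed tw y"] nf_push_y[OF nf, of e] b
      by (simp add: N_signed_y join_nf_def e_def push_y_def)
    moreover have "N (inv g) = neg_mod m b # P' P" by (simp add: N_inv b P'_def)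
    moreover have "join_nf m (P @ [(b + e) mod m]) (neg_mod m b # P' P) = P @ e # P' P"
    proof -
      have "(b + e + neg_mod m b) mod m = e"
      proof -
        have "(b + e + neg_mod m b) mod m = ((b + neg_mod m b) mod m + e) mod m"
          by (simp add: mod_simps ac_simps)
        then show ?thesis using add_neg_mod[OF bm] e by simp
      qed
      then show ?thesis by (simp add: join_nf_def mod_simps)
    qed
    moreover have "nf m (P @ e # P' P)"
    proof (cases P)
      case (Cons a l)
      have "nf m (a # (l @ e # rev (map (neg_mod m) l)) @ [neg_mod m a])"
        using nf b Cons e nf_ends[of m a l b] unfolding nf_ends by auto
      then show ?thesis by (simp add: Cons P'_def)
    qed (use e in \<open>simp add: P'_def\<close>)
    ultimately have "N (g \<otimes> signed tw y \<otimes> inv g) = P @ e # P' P"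
      using N_mult[of "g \<otimes> signed tw y" "inv g"] by simp
    moreover have "N (g \<otimes> signed tw x \<otimes> inv g) = P @ [b] @ neg_mod m b # P' P"
      using x_side[of g "N g"] P b by (simp add: P'_def)
    moreover have "length (P' P) = length P" by (simp add: P'_def)
    ultimately show ?thesis
      using \<open>N (inv g) = neg_mod m b # P' P\<close> by (simp add: inverse_half_def)
  next
    case True
    then obtain P where P: "N g = P @ [0]" "P \<noteq> []"
      by (metis append_butlast_last_id butlast.simps(1) length_append_singleton list.size(3) nf nf_Nil not_less_eq_eq numeral_2_eq_2 zero_le)
    have P_last: "0 < last P \<or> length P = 1"
      using nf nf_ends[of m a "b @ [c]" 0 for a b c] P(2) unfolding P(1)
      by (cases P rule: list_ends_cases) auto
    define g' where "g' = el P"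
    have nfP: "nf m P"
      using nf nf_ends[of m a "b @ [c]" 0 for a b c] unfolding P(1)
      by (cases P rule: list_ends_cases) (use P in auto)
    have [simp]: "g' \<in> carrier G" and Ng': "N g' = P" by (simp_all add: g'_def N_el nfP)
    have "N g = N (g' \<otimes> x)" using P N_el_N[of g] by (simp add: g'_def el_append)
    then have "N (g \<otimes> signed tw x \<otimes> inv g) = N (g' \<otimes> x \<otimes> signed tw x \<otimes> inv (g' \<otimes> x))"
      by (intro N_mult_cong N_inv_cong) simp_all
    also have "g' \<otimes> x \<otimes> signed tw x \<otimes> inv (g' \<otimes> x) = g' \<otimes> signed tw x \<otimes> inv g'"
      by (simp add: signed_def inv_mult_group m_assoc)
    finally have Nx: "N (g \<otimes> signed tw x \<otimes> inv g) = P @ P' P" using x_side[OF _ Ng' P_last] by simp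
    have "N (g \<otimes> signed tw y) = P @ [e]"
      using N_mult[of g "signed tw y"] nf_push_y[OF nf, of e] P e
      by (simp add: N_signed_y join_nf_def e_def push_y_def)
    moreover have Ni: "N (inv g) = 0 # P' P" by (simp add: N_inv P P'_def)
    moreover have "nf m (P @ e # P' P)"
    proof (cases P)
      case (Cons a l)
      have "nf m (a # (l @ e # rev (map (neg_mod m) l)) @ [neg_mod m a])"
        using nf P(1) Cons e nf_ends[of m a l 0] unfolding nf_ends by auto
      then show ?thesis by (simp add: Cons P'_def)
    qed (use P in simp)
    ultimately have "N (g \<otimes> signed tw y \<otimes> inv g) = P @ e # P' P"
      using N_mult[of "g \<otimes> signed tw y" "inv g"] e by (simp add: join_nf_def)
    moreover have "length (P' P) = length P" by (simp add: P'_def)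
    ultimately show ?thesis using Nx Ni by (simp add: inverse_half_def)
  qed
qed

text \<open>If \<open>\<psi>\<close> is \<open>\<phi>\<close> followed by conjugation with \<open>g\<close>, then \<open>v = \<psi>(w)\<^sup>-\<^sup>1 u w\<close> is the same as
  \<open>g\<^sup>-\<^sup>1 v = \<phi>(w)\<^sup>-\<^sup>1 (g\<^sup>-\<^sup>1 u) w\<close>. The sign of \<open>ab (\<psi> x) = \<plusminus>m\<close> tells the two possible \<open>\<phi>\<close> apart.\<close>

theorem twisted_conjugate_iff_accepts:
  assumes "\<psi> \<in> auto G" and [simp]: "u \<in> carrier G" "v \<in> carrier G"
  shows "\<exists>h\<in>carrier G. N h = inverse_half (N (\<psi> x)) (N (\<psi> y)) \<and>
    (twisted_conjugate G \<psi> u v \<longleftrightarrow>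
       accepts m (ab (\<psi> x) < 0) (N (h \<otimes> u)) (N (h \<otimes> v)) (ab u - ab v))"
proof -
  have hom: "\<psi> \<in> hom G G" using assms by (auto simp: auto_def)
  interpret \<psi>: group_hom G G \<psi> by unfold_locales (rule hom)
  obtain tw g where [simp]: "g \<in> carrier G"
    and g: "\<psi> x = g \<otimes> signed tw x \<otimes> inv g" "\<psi> y = g \<otimes> signed tw y \<otimes> inv g"
    using automorphism_inner[OF assms(1)] by blast
  have tw: "ab (\<psi> x) < 0 \<longleftrightarrow> tw" using m_ge by (simp add: g ab_mult ab_inv signed_def ab_x)
  define \<phi> where "\<phi> h = inv g \<otimes> \<psi> h \<otimes> g" for h
  interpret T: twisted G m x y N ab \<phi> tw
  proof unfold_locales
    show "\<phi> \<in> hom G G" by (auto simp: hom_def \<phi>_def m_assoc)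
    show "\<phi> x = (if tw then inv x else x)" "\<phi> y = (if tw then inv y else y)"
      by (simp_all add: \<phi>_def g m_assoc signed_def)
  qed
  have "twisted_conjugate G \<psi> u v \<longleftrightarrow> T.tw_conj (inv g \<otimes> u) (inv g \<otimes> v)"
  proof -
    have "v = inv (\<psi> w) \<otimes> u \<otimes> w \<longleftrightarrow> inv g \<otimes> v = T.tconj w (inv g \<otimes> u)" if "w \<in> carrier G" for w
    proof -
      have "T.tconj w (inv g \<otimes> u) = inv g \<otimes> (inv (\<psi> w) \<otimes> u \<otimes> w)"
        using that by (simp add: T.tconj_def \<phi>_def inv_mult_group m_assoc)
      then show ?thesis using that by (simp add: l_cancel)
    qed
    then show ?thesis unfolding twisted_conjugate_def T.tw_conj_def by blast
  qed
  also have "\<dots> \<longleftrightarrow> accepts m tw (N (inv g \<otimes> u)) (N (inv g \<otimes> v)) (ab u - ab v)"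
    using T.twisted_conjugacy_test[of "inv g \<otimes> u" "inv g \<otimes> v"] by (simp add: ab_mult)
  finally show ?thesis using N_inverse_half[of g tw] tw by (intro bexI[of _ "inv g"]) (simp_all add: g)
qed

end

section \<open>Words in the generators\<close>

text \<open>Letters are given by their codes on the input tape: \<open>1\<close>, \<open>2\<close>, \<open>3\<close>, \<open>4\<close> for \<open>x\<close>, \<open>x\<^sup>-\<^sup>1\<close>, \<open>y\<close>, \<open>y\<^sup>-\<^sup>1\<close>.
  Modulo the centre \<open>x\<^sup>-\<^sup>1\<close> acts like \<open>x\<close> and \<open>y\<^sup>-\<^sup>1\<close> like \<open>y\<^sup>m\<^sup>-\<^sup>1\<close>.\<close>

definition letter :: "nat \<Rightarrow> nat \<Rightarrow> nat list \<Rightarrow> nat list" where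
  "letter m c l =
     (if c \<le> 2 then push_x l else if c = 3 then push_y m 1 l else push_y m (m - 1) l)"

definition weight :: "nat \<Rightarrow> nat \<Rightarrow> int" where
  "weight m c = (if c = 1 then int m else if c = 2 then - int m else if c = 3 then 2 else - 2)"

definition letter_code :: "nat \<times> bool \<Rightarrow> nat" where
  "letter_code = (\<lambda>(i, e). if e then 2 * i + 2 else 2 * i + 1)"

context torus_knot
begin

lemma N_mult_inv_x: "g \<in> carrier G \<Longrightarrow> N (g \<otimes> inv x) = push_x (N g)"
  using N_mult_cong[of g g "inv x" x] by (simp add: N_inv_x N_x N_mult_x)

lemma N_mult_inv_y: "g \<in> carrier G \<Longrightarrow> N (g \<otimes> inv y) = push_y m (m - 1) (N g)"
proof -
  assume g: "g \<in> carrier G"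
  have "N (inv y) = N (y [^] (m - 1))"
    using N_y_pow_neg[of 1] m_ge by (simp add: N_y_pow neg_mod_def)
  then have "N (g \<otimes> inv y) = N (g \<otimes> y [^] (m - 1))" using g by (intro N_mult_cong) simp_all
  then show ?thesis using g by (simp add: N_mult_y_pow)
qed

lemma word_value_closed [simp]:
  "w \<in> words_over [x, y] \<Longrightarrow> word_value G [x, y] w \<in> carrier G"
  by (induction w) (auto simp: words_over_def less_Suc_eq)

lemma N_mult_word:
  "g \<in> carrier G \<Longrightarrow> w \<in> words_over [x, y] \<Longrightarrow>
    N (g \<otimes> word_value G [x, y] w) = fold (letter m) (map letter_code w) (N g)"
proof (induction w arbitrary: g)
  case (Cons l w)
  obtain i e where l: "l = (i, e)" by fastforce
  define h where "h = (if e then inv ([x, y] ! i) else [x, y] ! i)"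
  have w: "w \<in> words_over [x, y]" and i: "i = 0 \<or> i = 1"
    using Cons.prems by (auto simp: words_over_def l)
  have h: "h \<in> carrier G" using i by (auto simp: h_def)
  have "N (g \<otimes> h) = letter m (letter_code l) (N g)"
    using i Cons.prems(1)
    by (cases e) (auto simp: h_def l letter_def letter_code_def N_mult_x N_mult_y N_mult_inv_x N_mult_inv_y)
  moreover have "N (g \<otimes> h \<otimes> word_value G [x, y] w) = fold (letter m) (map letter_code w) (N (g \<otimes> h))"
    using Cons.IH[of "g \<otimes> h"] Cons.prems w h by simp
  ultimately show ?case using h w Cons.prems(1) by (simp add: l m_assoc flip: h_def)
qed simp

lemma ab_word:
  "w \<in> words_over [x, y] \<Longrightarrow>
    ab (word_value G [x, y] w) = sum_list (map (weight m) (map letter_code w))"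
proof (induction w)
  case (Cons l w)
  obtain i e where l: "l = (i, e)" by fastforce
  have w: "w \<in> words_over [x, y]" and i: "i = 0 \<or> i = 1"
    using Cons.prems by (auto simp: words_over_def l)
  then show ?case using Cons.IH
    by (cases e) (auto simp: l letter_code_def weight_def ab_mult ab_inv ab_x ab_y)
qed (simp add: ab_one)

end

section \<open>The dihedral Artin group is a torus knot group\<close>

text \<open>The action of the Artin generators on normal forms, by \<open>a = y\<^sup>-\<^sup>k x\<close> and \<open>b = x\<^sup>-\<^sup>1 y\<^sup>k\<^sup>+\<^sup>1\<close> for
  \<open>m = 2 k + 1\<close>. Modulo \<open>m\<close> the exponent \<open>- k\<close> is \<open>k + 1\<close>. That this action respects the defining
  relation is what makes the normal form of an element well defined.\<close>

fun artin_step :: "nat \<Rightarrow> artin_gen \<times> bool \<Rightarrow> nat list \<Rightarrow> nat list" where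
  "artin_step m (A, False) l = push_x (push_y m (m div 2 + 1) l)"
| "artin_step m (A, True) l = push_y m (m div 2) (push_x l)"
| "artin_step m (B, False) l = push_y m (m div 2 + 1) (push_x l)"
| "artin_step m (B, True) l = push_x (push_y m (m div 2) l)"

lemma nf_artin_step: "nf m l \<Longrightarrow> nf m (artin_step m c l)"
  by (cases "(m, c, l)" rule: artin_step.cases) (auto intro: nf_push_x nf_push_y)

lemma nf_artin_fold: "nf m l \<Longrightarrow> nf m (fold (artin_step m) u l)"
  by (induction u arbitrary: l) (auto intro: nf_artin_step)

lemma push_y_m: "nf m l \<Longrightarrow> push_y m m l = l"
  using push_y_multiple[of m l 1] by simp

lemma artin_step_cancel:
  assumes "odd m" "nf m l"
  shows "artin_step m (s, \<not> e) (artin_step m (s, e) l) = l"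
proof -
  have "m div 2 + 1 + m div 2 = m" "m div 2 + (m div 2 + 1) = m" using assms(1) by presburger+
  moreover have "l \<noteq> []" using assms(2) by auto
  moreover have "push_x (push_x (push_y m j l)) = push_y m j l" for j
    using push_x_push_x[OF nf_push_y[OF assms(2)]] .
  ultimately show ?thesis using assms(2)
    by (cases s; cases e)
      (simp_all add: push_x_push_x nf_push_x nf_push_y push_y_push_y push_y_m add.commute)
qed

lemma artin_step_AB:
  assumes "odd m" "nf m l"
  shows "artin_step m (B, False) (artin_step m (A, False) l) = push_y m 1 l"
    "artin_step m (A, False) (artin_step m (B, False) l) = push_x (push_y m 1 (push_x l))"
proof -
  have "l \<noteq> []" using assms(2) by auto
  have e: "m div 2 + 1 + (m div 2 + 1) = m + 1" using assms(1) by presburger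
  have *: "push_y m (m + 1) l = push_y m 1 l" for l
    by (metis add.commute add.left_commute mod_add_self1 push_y_def)
  show "artin_step m (B, False) (artin_step m (A, False) l) = push_y m 1 l"
    by (simp only: artin_step.simps push_x_push_x[OF nf_push_y[OF assms(2)]] push_y_push_y[OF \<open>l \<noteq> []\<close>] e *)
  show "artin_step m (A, False) (artin_step m (B, False) l) = push_x (push_y m 1 (push_x l))"
    by (simp only: artin_step.simps push_y_push_y push_nonempty e * not_False_eq_True)
qed

lemma fold_alternating:
  assumes "odd m" "nf m l"
  shows "fold (artin_step m) (alternating (2 * i + 1) A B) l = artin_step m (A, False) (push_y m i l)"
    "fold (artin_step m) (alternating (2 * i + 1) B A) l
      = artin_step m (B, False) (push_x (push_y m i (push_x l)))"
  using assms(2)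
proof (induction i arbitrary: l)
  case 0
  case 1 then show ?case using push_y_multiple[of m l 0] by simp
  case 2 then show ?case using push_y_multiple[of m "push_x l" 0] by (simp add: nf_push_x push_x_push_x)
next
  case (Suc i)
  let ?f = "fold (artin_step m)"
  case 1
  then have "l \<noteq> []" by auto
  have "?f (alternating (2 * Suc i + 1) A B) l = ?f (alternating (2 * i + 1) A B) (push_y m 1 l)"
    unfolding artin_step_AB(1)[OF assms(1) 1, symmetric] by simp
  also have "\<dots> = artin_step m (A, False) (push_y m i (push_y m 1 l))"
    by (rule Suc(1)[OF nf_push_y[OF 1]])
  finally show ?case using \<open>l \<noteq> []\<close> by (simp only: push_y_push_y plus_1_eq_Suc not_False_eq_True)
  case 2
  then have nfx: "nf m (push_x l)" by (rule nf_push_x)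
  have "?f (alternating (2 * Suc i + 1) B A) l
    = ?f (alternating (2 * i + 1) B A) (push_x (push_y m 1 (push_x l)))"
    unfolding artin_step_AB(2)[OF assms(1) 2, symmetric] by simp
  also have "\<dots> = artin_step m (B, False) (push_x (push_y m i (push_x (push_x (push_y m 1 (push_x l))))))"
    by (rule Suc(2)[OF nf_push_x[OF nf_push_y[OF nfx]]])
  finally show ?case
    by (simp only: push_x_push_x[OF nf_push_y[OF nfx]] push_y_push_y push_nonempty plus_1_eq_Suc not_False_eq_True)
qed

text \<open>Both sides of the braid relation act like \<open>x\<close>.\<close>

lemma fold_alternating_m:
  assumes "odd m" "nf m l"
  shows "fold (artin_step m) (alternating m A B) l = push_x l"
    "fold (artin_step m) (alternating m B A) l = push_x l"
proof -
  obtain k where k: "m = 2 * k + 1" using assms(1) by (auto elim: oddE)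
  have e: "k + (m div 2 + 1) = m" by (simp add: k)
  have nfx: "nf m (push_x l)" using assms(2) by (rule nf_push_x)
  have "l \<noteq> []" using assms(2) by auto
  have "fold (artin_step m) (alternating m A B) l = push_x (push_y m (m div 2 + 1) (push_y m k l))"
    using fold_alternating(1)[OF assms, of k] unfolding artin_step.simps k[symmetric] .
  then show "fold (artin_step m) (alternating m A B) l = push_x l"
    by (simp only: push_y_push_y[OF \<open>l \<noteq> []\<close>] e push_y_m[OF assms(2)])
  have "fold (artin_step m) (alternating m B A) l
    = push_y m (m div 2 + 1) (push_x (push_x (push_y m k (push_x l))))"
    using fold_alternating(2)[OF assms, of k] unfolding artin_step.simps k[symmetric] .
  then show "fold (artin_step m) (alternating m B A) l = push_x l"
    by (simp only: push_x_push_x[OF nf_push_y[OF nfx]] push_y_push_y push_nonempty e push_y_m[OF nfx] not_False_eq_True)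
qed

lemma fold_artin_pres_eq:
  assumes "odd m" "pres_eq (artin_rels m) u v" "nf m l"
  shows "fold (artin_step m) u l = fold (artin_step m) v l"
  using assms(2,3)
proof (induction arbitrary: l rule: pres_eq.induct)
  case (app u u' v v')
  then show ?case using nf_artin_fold by simp
next
  case (cancel s e)
  then show ?case using artin_step_cancel[OF assms(1)] by simp
next
  case (rel r s)
  then show ?case using fold_alternating_m[OF assms(1)] by (auto simp: artin_rels_def)
qed auto

definition exponent_sum :: "artin_gen word \<Rightarrow> int" where
  "exponent_sum u = sum_list (map (\<lambda>(_, e). if e then -1 else 1) u)"

lemma exponent_sum_alternating: "exponent_sum (alternating n s t) = int n"
  by (induction n arbitrary: s t) (simp_all add: exponent_sum_def)

lemma exponent_sum_pres_eq: "pres_eq (artin_rels m) u v \<Longrightarrow> exponent_sum u = exponent_sum v"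
proof (induction rule: pres_eq.induct)
  case (rel r s)
  then show ?case by (auto simp: artin_rels_def exponent_sum_alternating)
qed (auto simp: exponent_sum_def)

text \<open>The value on any representative; by \<open>artin_N_class\<close> the choice does not matter.\<close>

definition artin_N :: "nat \<Rightarrow> artin_gen word set \<Rightarrow> nat list" where
  "artin_N m U = fold (artin_step m) (SOME u. U = pres_class (artin_rels m) u) [0]"

definition artin_ab :: "nat \<Rightarrow> artin_gen word set \<Rightarrow> int" where
  "artin_ab m U = exponent_sum (SOME u. U = pres_class (artin_rels m) u)"

lemma artin_rep: "pres_eq (artin_rels m) u (SOME u'. pres_class (artin_rels m) u = pres_class (artin_rels m) u')"
  using someI[of "\<lambda>u'. pres_class (artin_rels m) u = pres_class (artin_rels m) u'" u]
  by (simp add: pres_class_eq_iff)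

lemma artin_N_class:
  "odd m \<Longrightarrow> artin_N m (pres_class (artin_rels m) u) = fold (artin_step m) u [0]"
  unfolding artin_N_def using fold_artin_pres_eq[OF _ artin_rep] by (metis nf_single odd_pos)

lemma artin_ab_class: "artin_ab m (pres_class (artin_rels m) u) = exponent_sum u"
  unfolding artin_ab_def using exponent_sum_pres_eq[OF artin_rep] by metis

lemma alternating_append:
  "alternating (2 * i + 1) A B @ alternating (2 * j + 1) B A
    = concat (replicate (i + j + 1) [(A, False), (B, False)])"
proof (induction i)
  case 0
  have "alternating (2 * j + 1) B A = (B, False) # concat (replicate j [(A, False), (B, False)])"
    by (induction j) simp_all
  then show ?case by simp
qed simp

theorem torus_knot_dihedral_artin:
  assumes "3 \<le> m" "odd m"
  shows "torus_knot (dihedral_artin_group m) m (torus_x m) (torus_y m) (artin_N m) (artin_ab m)"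
proof -
  define G where "G = dihedral_artin_group m"
  define c where "c = pres_class (artin_rels m)"
  interpret group G unfolding G_def dihedral_artin_group_def by (rule group_presented_group)
  have car: "carrier G = range c" and one: "\<one>\<^bsub>G\<^esub> = c []"
    by (simp_all add: G_def c_def dihedral_artin_group_def presented_group_def)
  have mult: "c u \<otimes>\<^bsub>G\<^esub> c v = c (u @ v)" for u v
    by (simp add: G_def c_def dihedral_artin_group_def pres_class_mult)
  have x: "torus_x m = c (alternating m A B)" and y: "torus_y m = c [(A, False), (B, False)]"
    by (simp_all add: torus_x_def torus_y_def c_def)
  have N: "artin_N m (c u) = fold (artin_step m) u [0]" for u
    using artin_N_class assms by (simp add: c_def)
  have ab: "artin_ab m (c u) = exponent_sum u" for u using artin_ab_class by (simp add: c_def)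
  have nf: "nf m (fold (artin_step m) u [0])" for u using assms by (intro nf_artin_fold) simp
  have pow: "c u [^]\<^bsub>G\<^esub> (n::nat) = c (concat (replicate n u))" for u n
  proof (induction n)
    case (Suc n)
    have "concat (replicate n u) @ u = u @ concat (replicate n u)" by (induction n) auto
    then show ?case using Suc by (simp add: mult)
  qed (simp add: one)
  have "torus_knot G m (torus_x m) (torus_y m) (artin_N m) (artin_ab m)"
  proof unfold_locales
    show "torus_x m \<otimes>\<^bsub>G\<^esub> torus_x m = torus_y m [^]\<^bsub>G\<^esub> m"
    proof -
      obtain k where k: "m = 2 * k + 1" using assms by (auto elim: oddE)
      have "c (alternating m A B) = c (alternating m B A)"
        by (simp add: c_def pres_class_eq_iff pres_eq.rel artin_rels_def)
      then have "torus_x m \<otimes>\<^bsub>G\<^esub> torus_x m = c (alternating m A B @ alternating m B A)"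
        by (metis mult x)
      also have "alternating m A B @ alternating m B A = concat (replicate m [(A, False), (B, False)])"
        using alternating_append[of k k] by (simp add: k mult_2)
      finally show ?thesis by (simp add: y pow)
    qed
    show "artin_N m \<one>\<^bsub>G\<^esub> = [0]" by (simp add: one N)
    show "generate G {torus_x m, torus_y m} = carrier G"
      unfolding G_def using assms by (intro generate_torus)
    fix g assume "g \<in> carrier G"
    then obtain u where g: "g = c u" by (auto simp: car)
    show "nf m (artin_N m g)" by (simp add: g N nf)
    show "artin_N m (g \<otimes>\<^bsub>G\<^esub> torus_x m) = push_x (artin_N m g)"
      using fold_alternating_m(1)[OF assms(2) nf] by (simp add: g x mult N)
    show "artin_N m (g \<otimes>\<^bsub>G\<^esub> torus_y m) = push_y m 1 (artin_N m g)"
      using artin_step_AB(1)[OF assms(2) nf] by (simp add: g y mult N)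
    fix h assume "h \<in> carrier G"
    then obtain v where "h = c v" by (auto simp: car)
    then show "artin_ab m (g \<otimes>\<^bsub>G\<^esub> h) = artin_ab m g + artin_ab m h"
      by (simp add: g mult ab) (simp add: exponent_sum_def)
  qed (use assms in \<open>simp_all add: x y car ab exponent_sum_alternating, simp add: exponent_sum_def\<close>)
  then show ?thesis by (simp add: G_def)
qed

section \<open>Structured programs for the random access machine\<close>

text \<open>Jump-free programs. They are compiled to the machine with one test and one jump per branching or
  loop, so that the running times of the source carry over exactly.\<close>

datatype com = Do instr | Seq com com (infixr ";;" 60) | IfZ nat com com | While nat com

fun basic :: "instr \<Rightarrow> bool" where
  "basic (Jump _) = False"
| "basic (JumpZero _ _) = False"
| "basic (Halt _) = False"
| "basic _ = True"

primrec wf_com :: "com \<Rightarrow> bool" where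
  "wf_com (Do i) = basic i"
| "wf_com (a ;; b) = (wf_com a \<and> wf_com b)"
| "wf_com (IfZ r a b) = (wf_com a \<and> wf_com b)"
| "wf_com (While r c) = wf_com c"

primrec code_size :: "com \<Rightarrow> nat" where
  "code_size (Do i) = 1"
| "code_size (a ;; b) = code_size a + code_size b"
| "code_size (IfZ r a b) = code_size a + code_size b + 2"
| "code_size (While r c) = code_size c + 2"

text \<open>The first argument is the address at which the code is placed.\<close>

primrec compile :: "nat \<Rightarrow> com \<Rightarrow> instr list" where
  "compile p (Do i) = [i]"
| "compile p (a ;; b) = compile p a @ compile (p + code_size a) b"
| "compile p (IfZ r a b) =
     JumpZero r (p + code_size b + 2) # compile (p + 1) b
       @ Jump (p + code_size a + code_size b + 2) # compile (p + code_size b + 2) a"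
| "compile p (While r c) =
     JumpZero r (p + code_size c + 2) # compile (p + 1) c @ [Jump p]"

lemma length_compile [simp]: "length (compile p c) = code_size c"
  by (induction c arbitrary: p) simp_all

type_synonym store = "(nat \<Rightarrow> nat) \<times> nat list"

text \<open>The number is the exact running time of the compiled code, jumps included.\<close>

inductive big :: "com \<Rightarrow> store \<Rightarrow> nat \<Rightarrow> store \<Rightarrow> bool" where
  Do: "big (Do i) s 1 (snd (exec i (0, s)))"
| Seq: "big a s t s' \<Longrightarrow> big b s' t' s'' \<Longrightarrow> big (a ;; b) s (t + t') s''"
| IfZ_zero: "fst s r = 0 \<Longrightarrow> big a s t s' \<Longrightarrow> big (IfZ r a b) s (t + 1) s'"
| IfZ_pos: "fst s r \<noteq> 0 \<Longrightarrow> big b s t s' \<Longrightarrow> big (IfZ r a b) s (t + 2) s'"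
| While_end: "fst s r = 0 \<Longrightarrow> big (While r c) s 1 s"
| While_step: "fst s r \<noteq> 0 \<Longrightarrow> big c s t s' \<Longrightarrow> big (While r c) s' t' s'' \<Longrightarrow>
    big (While r c) s (t + t' + 2) s''"

lemma exec_basic: "basic i \<Longrightarrow> exec i (p, s) = (Suc p, snd (exec i (0, s)))"
  by (cases s; cases i) auto

lemma ram_step_at: "p = length pre \<Longrightarrow> ram_step (pre @ i # post) (p, s) = exec i (p, s)"
  by (simp add: ram_step_def)

lemma compile_correct:
  "big c s t s' \<Longrightarrow> wf_com c \<Longrightarrow>
    (ram_step (pre @ compile (length pre) c @ post) ^^ t) (length pre, s) = (length pre + code_size c, s')"
proof (induction arbitrary: pre post rule: big.induct)
  case (Do i s)
  then show ?case using exec_basic[of i "length pre" s] by (simp add: ram_step_at)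
next
  case (Seq a s t s' b t' s'')
  let ?P = "pre @ compile (length pre) (a ;; b) @ post"
  have "(ram_step ?P ^^ t) (length pre, s) = (length pre + code_size a, s')"
    using Seq.IH(1)[of pre "compile (length pre + code_size a) b @ post"] Seq.prems by simp
  moreover have "(ram_step ?P ^^ t') (length pre + code_size a, s') = (length pre + code_size a + code_size b, s'')"
    using Seq.IH(2)[of "pre @ compile (length pre) a" post] Seq.prems by simp
  ultimately show ?case
    unfolding add.commute[of t t'] funpow_add comp_apply by (simp add: add.assoc)
next
  case (IfZ_zero s r a t s' b)
  let ?P = "pre @ compile (length pre) (IfZ r a b) @ post"
  have 1: "ram_step ?P (length pre, s) = (length pre + code_size b + 2, s)"
    using IfZ_zero.hyps(1) by (cases s) (simp add: ram_step_at)
  have "(ram_step ?P ^^ t) (length pre + code_size b + 2, s) = (length pre + code_size (IfZ r a b), s')"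
    using IfZ_zero.IH[of "pre @ JumpZero r (length pre + code_size b + 2) # compile (length pre + 1) b
      @ [Jump (length pre + code_size a + code_size b + 2)]" post] IfZ_zero.prems
    by (simp add: algebra_simps)
  moreover have "(ram_step ?P ^^ (t + 1)) (length pre, s) = (ram_step ?P ^^ t) ((ram_step ?P ^^ 1) (length pre, s))"
    by (simp only: funpow_add comp_apply)
  ultimately show ?case using 1 by (simp del: compile.simps)
next
  case (IfZ_pos s r b t s' a)
  let ?P = "pre @ compile (length pre) (IfZ r a b) @ post"
  have 1: "ram_step ?P (length pre, s) = (length pre + 1, s)"
    using IfZ_pos.hyps(1) by (cases s) (simp add: ram_step_at)
  have 2: "(ram_step ?P ^^ t) (length pre + 1, s) = (length pre + 1 + code_size b, s')"
    using IfZ_pos.IH[of "pre @ [JumpZero r (length pre + code_size b + 2)]"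
      "Jump (length pre + code_size a + code_size b + 2) # compile (length pre + code_size b + 2) a @ post"]
      IfZ_pos.prems by simp
  have 3: "ram_step ?P (length pre + 1 + code_size b, s') = (length pre + code_size (IfZ r a b), s')"
    using ram_step_at[of _ "pre @ JumpZero r (length pre + code_size b + 2) # compile (length pre + 1) b"]
    by (cases s') simp
  have "t + 2 = 1 + (t + 1)" by simp
  then have "(ram_step ?P ^^ (t + 2)) (length pre, s) =
    (ram_step ?P ^^ 1) ((ram_step ?P ^^ t) ((ram_step ?P ^^ 1) (length pre, s)))"
    by (simp only: funpow_add comp_apply)
  then show ?case using 1 2 3 by (simp del: compile.simps)
next
  case (While_end s r c)
  then show ?case by (cases s) (simp add: ram_step_at)
next
  case (While_step s r c t s' t' s'')
  let ?P = "pre @ compile (length pre) (While r c) @ post"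
  have 1: "ram_step ?P (length pre, s) = (length pre + 1, s)"
    using While_step.hyps(1) by (cases s) (simp add: ram_step_at)
  have 2: "(ram_step ?P ^^ t) (length pre + 1, s) = (length pre + 1 + code_size c, s')"
    using While_step.IH(1)[of "pre @ [JumpZero r (length pre + code_size c + 2)]" "Jump (length pre) # post"]
      While_step.prems by simp
  have 3: "ram_step ?P (length pre + 1 + code_size c, s') = (length pre, s')"
    using ram_step_at[of _ "pre @ JumpZero r (length pre + code_size c + 2) # compile (length pre + 1) c"]
    by (cases s') simp
  have 4: "(ram_step ?P ^^ t') (length pre, s') = (length pre + code_size (While r c), s'')"
    using While_step.IH(2)[of pre post] While_step.prems by simp
  have "t + t' + 2 = t' + (1 + (t + 1))" by simp
  then have "(ram_step ?P ^^ (t + t' + 2)) (length pre, s) =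
    (ram_step ?P ^^ t') ((ram_step ?P ^^ 1) ((ram_step ?P ^^ t) ((ram_step ?P ^^ 1) (length pre, s))))"
    by (simp only: funpow_add comp_apply)
  then show ?case using 1 2 3 4 by (simp del: compile.simps)
qed

text \<open>Execution as a predicate transformer on postconditions that also see the elapsed time. For
  programs without loops the equations below let the simplifier run the program symbolically.\<close>

definition wp :: "com \<Rightarrow> (nat \<Rightarrow> nat) \<Rightarrow> nat list \<Rightarrow> (nat \<Rightarrow> (nat \<Rightarrow> nat) \<Rightarrow> nat list \<Rightarrow> bool) \<Rightarrow> bool" where
  "wp c R inp Q \<longleftrightarrow> (\<exists>t s'. big c (R, inp) t s' \<and> Q t (fst s') (snd s'))"

inductive_simps big_Do_iff: "big (Do i) s t s'"
inductive_simps big_Seq_iff: "big (a ;; b) s t s'"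
inductive_simps big_IfZ_iff: "big (IfZ r a b) s t s'"
inductive_simps big_While_iff: "big (While r c) s t s'"

lemma wp_basic [simp]:
  "wp (Do (Const i c)) R inp Q = Q 1 (R(i := c)) inp"
  "wp (Do (Add i j k)) R inp Q = Q 1 (R(i := R j + R k)) inp"
  "wp (Do (Sub i j k)) R inp Q = Q 1 (R(i := R j - R k)) inp"
  "wp (Do (Load i j)) R inp Q = Q 1 (R(i := R (R j))) inp"
  "wp (Do (Store i j)) R inp Q = Q 1 (R(R i := R j)) inp"
  "wp (Do (Read i)) R (c # inp) Q = Q 1 (R(i := c)) inp"
  by (simp_all add: wp_def big_Do_iff)

lemma wp_Seq [simp]: "wp (a ;; b) R inp Q = wp a R inp (\<lambda>t R inp. wp b R inp (\<lambda>t'. Q (t + t')))"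
  unfolding wp_def big_Seq_iff by (auto; blast)

lemma wp_IfZ [simp]:
  "wp (IfZ r a b) R inp Q =
    (if R r = 0 then wp a R inp (\<lambda>t. Q (t + 1)) else wp b R inp (\<lambda>t. Q (t + 2)))"
  unfolding wp_def big_IfZ_iff by auto

lemma wp_While:
  "wp (While r c) R inp Q =
    (if R r = 0 then Q 1 R inp
     else wp c R inp (\<lambda>t R inp. wp (While r c) R inp (\<lambda>t'. Q (t + t' + 2))))"
proof (cases "R r = 0")
  case True
  then show ?thesis unfolding wp_def by (subst big_While_iff) simp
next
  case False
  then show ?thesis unfolding wp_def by (subst big_While_iff) (simp, blast)
qed

lemma wp_mono:
  "wp c R inp Q \<Longrightarrow> (\<And>t R' inp'. Q t R' inp' \<Longrightarrow> Q' t R' inp') \<Longrightarrow> wp c R inp Q'"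
  unfolding wp_def by blast

text \<open>The invariant is indexed by the number of completed passes, which must be known in advance; it
  bounds the time linearly.\<close>

lemma wp_loop:
  assumes step: "\<And>i R inp. i < n \<Longrightarrow> I i R inp \<Longrightarrow>
      R r \<noteq> 0 \<and> wp c R inp (\<lambda>t R' inp'. t \<le> K \<and> I (Suc i) R' inp')"
    and stop: "\<And>R inp. I n R inp \<Longrightarrow> R r = 0"
    and "I i R inp" "i \<le> n"
  shows "wp (While r c) R inp (\<lambda>t R' inp'. t \<le> (K + 2) * (n - i) + 1 \<and> I n R' inp')"
  using assms(3,4)
proof (induction "n - i" arbitrary: i R inp)
  case 0
  then show ?case using stop by (simp add: wp_While)
next
  case (Suc k)
  then have i: "i < n" by simp
  have "wp c R inp (\<lambda>t R' inp'. wp (While r c) R' inp' (\<lambda>t' R' inp'. t + t' + 2 \<le> (K + 2) * (n - i) + 1 \<and> I n R' inp'))"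
  proof (rule wp_mono[OF conjunct2[OF step[OF i Suc.prems(1)]]])
    fix t R' inp'
    assume *: "t \<le> K \<and> I (Suc i) R' inp'"
    have "wp (While r c) R' inp' (\<lambda>t R' inp'. t \<le> (K + 2) * (n - Suc i) + 1 \<and> I n R' inp')"
      using Suc * by (intro Suc.hyps(1)) auto
    moreover have "n - i = Suc (n - Suc i)" using i by simp
    ultimately show "wp (While r c) R' inp' (\<lambda>t' R' inp'. t + t' + 2 \<le> (K + 2) * (n - i) + 1 \<and> I n R' inp')"
      using * by (elim wp_mono) auto
  qed
  then show ?case using step[OF i Suc.prems(1)] by (simp add: wp_While)
qed

section \<open>Arrays\<close>

definition stored :: "(nat \<Rightarrow> nat) \<Rightarrow> nat \<Rightarrow> nat list \<Rightarrow> bool" where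
  "stored R p l \<longleftrightarrow> (\<forall>i<length l. R (p + i) = l ! i)"

lemma stored_Nil [simp]: "stored R p []"
  by (simp add: stored_def)

lemma stored_Cons [simp]: "stored R p (a # l) \<longleftrightarrow> R p = a \<and> stored R (Suc p) l"
  by (auto simp: stored_def less_Suc_eq_0_disj)

lemma stored_append [simp]: "stored R p (l @ l') \<longleftrightarrow> stored R p l \<and> stored R (p + length l) l'"
  by (induction l arbitrary: p) auto

lemma stored_cong: "(\<And>i. p \<le> i \<Longrightarrow> i < p + length l \<Longrightarrow> R' i = R i) \<Longrightarrow> stored R' p l = stored R p l"
  by (auto simp: stored_def)

lemma stored_upd [simp]:
  "i < p \<Longrightarrow> stored (R(i := v)) p l = stored R p l"
  "p + length l \<le> i \<Longrightarrow> stored (R(i := v)) p l = stored R p l"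
  by (rule stored_cong, simp)+

text \<open>Below \<open>b\<close> only the registers in \<open>S\<close> have changed. All arrays lie above the registers and each new
  array is placed above the earlier ones, so this is all that is needed to keep them apart.\<close>

definition frame :: "nat set \<Rightarrow> nat \<Rightarrow> (nat \<Rightarrow> nat) \<Rightarrow> (nat \<Rightarrow> nat) \<Rightarrow> bool" where
  "frame S b R R' \<longleftrightarrow> (\<forall>i<b. i \<notin> S \<longrightarrow> R' i = R i)"

lemma frameD: "frame S b R R' \<Longrightarrow> i < b \<Longrightarrow> i \<notin> S \<Longrightarrow> R' i = R i"
  by (simp add: frame_def)

lemma frame_refl: "frame S b R R"
  by (simp add: frame_def)

lemma frame_trans:
  "frame S b R R' \<Longrightarrow> frame S' b' R' R'' \<Longrightarrow> S \<subseteq> T \<Longrightarrow> S' \<subseteq> T \<Longrightarrow> c \<le> b \<Longrightarrow> c \<le> b' \<Longrightarrow> frame T c R R''"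
  unfolding frame_def by (metis less_le_trans subsetD)

lemma frame_stored:
  "frame S b R R' \<Longrightarrow> p + length l \<le> b \<Longrightarrow> \<forall>i\<in>S. i < p \<Longrightarrow> stored R' p l = stored R p l"
  by (rule stored_cong) (metis frameD less_le_trans not_less)

section \<open>Reading words and computing normal forms\<close>

text \<open>Registers \<open>2\<close> to \<open>43\<close> are variables and memory from address \<open>60\<close> on holds arrays. Their use:
  \<^item> \<open>2\<close>, \<open>8\<close>, \<open>9\<close>, \<open>20\<close>, \<open>21\<close>, \<open>22\<close>, \<open>34\<close> to \<open>39\<close>: scratch; \<open>3\<close>: first free address; \<open>4\<close>, \<open>5\<close>: current
  letter and its address;
  \<^item> \<open>6\<close>, \<open>7\<close>: first and last address of the stack that holds a normal form;
  \<^item> \<open>10\<close>, \<open>11\<close>: positive and negative part of the abelianization;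
  \<^item> \<open>12\<close>, \<open>13\<close>: ends of the normal form of \<open>\<psi> x\<close>; \<open>14\<close>: nonzero if that of \<open>\<psi> y\<close> is
  shorter; \<open>15\<close>: start of the second half of the normal form of \<open>\<psi> x\<close>; \<open>16\<close>: nonzero in the twisted case;
  \<^item> \<open>17\<close>, \<open>18\<close>: address and length of the cyclic word of \<open>v\<close>; \<open>19\<close>: counter for \<open>rounds\<close>;
  \<^item> \<open>23\<close>: answer; \<open>24\<close>: length of the cyclic word of \<open>u\<close>; \<open>25\<close>, \<open>26\<close>: step and value of the counter modulo \<open>4\<close>;
  \<^item> \<open>27\<close>: \<open>m\<^sup>k\<close>; \<open>28\<close>, \<open>30\<close>: numbers that encode the two cyclic words; \<open>29\<close>, \<open>31\<close>, \<open>33\<close>: pointers; \<open>32\<close>: loop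
  counter;
  \<^item> \<open>41\<close>, \<open>42\<close>, \<open>43\<close>: addresses of the words for \<open>v\<close>, \<open>\<psi> x\<close> and \<open>\<psi> y\<close>; the word for \<open>u\<close> is at \<open>60\<close>.\<close>

abbreviation Inc :: "nat \<Rightarrow> com" where "Inc i \<equiv> Do (Const 2 1) ;; Do (Add i i 2)"
abbreviation Dec :: "nat \<Rightarrow> com" where "Dec i \<equiv> Do (Const 2 1) ;; Do (Sub i i 2)"
abbreviation Mov :: "nat \<Rightarrow> nat \<Rightarrow> com" where "Mov i j \<equiv> Do (Const 2 0) ;; Do (Add i j 2)"
abbreviation AddC :: "nat \<Rightarrow> nat \<Rightarrow> com" where "AddC i c \<equiv> Do (Const 2 c) ;; Do (Add i i 2)"
abbreviation Skip :: com where "Skip \<equiv> Do (Const 2 0)"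

lemma frame_upd [simp]:
  "i \<in> S \<Longrightarrow> frame S b R (R'(i := v)) = frame S b R R'"
  "b \<le> i \<Longrightarrow> frame S b R (R'(i := v)) = frame S b R R'"
  by (auto simp: frame_def)

lemma wp_then:
  assumes "wp a R inp Q0"
    and "\<And>t R' inp'. Q0 t R' inp' \<Longrightarrow> wp b R' inp' (\<lambda>t' R inp. Q (t + t') R inp)"
  shows "wp (a ;; b) R inp Q"
  unfolding wp_Seq using assms(1) by (rule wp_mono) (rule assms(2))

text \<open>The end marker \<open>0\<close> is stored as well, so that a word in memory can be read like the tape.\<close>

definition read_word :: com where
  "read_word =
     Do (Read 4) ;; While 4 (Do (Store 3 4) ;; Inc 3 ;; Do (Read 4)) ;; Do (Store 3 4) ;; Inc 3"

lemma read_word: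
  assumes "R 3 = h" "40 \<le> h" "0 \<notin> set w"
  shows "wp read_word R (w @ 0 # rest) (\<lambda>t R' inp'. t \<le> 6 * length w + 5 \<and> inp' = rest \<and>
    R' 3 = h + length w + 1 \<and> stored R' h (w @ [0]) \<and> frame {2,3,4} h R R')"
proof -
  define inp where "inp = w @ [0] @ rest"
  define I where "I i R' inp' \<longleftrightarrow> R' 4 = (w @ [0]) ! i \<and> inp' = drop (Suc i) inp \<and>
    R' 3 = h + i \<and> stored R' h (take i w) \<and> frame {2,3,4} h R R'" for i and R' :: "nat \<Rightarrow> nat" and inp'
  have loop: "wp (While 4 (Do (Store 3 4) ;; Inc 3 ;; Do (Read 4))) R' inp'
     (\<lambda>t R' inp'. t \<le> (4 + 2) * (length w - 0) + 1 \<and> I (length w) R' inp')" if "I 0 R' inp'" for R' inp'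
  proof (rule wp_loop)
    fix i R' inp'
    assume i: "i < length w" and I: "I i R' inp'"
    have "drop (Suc i) inp = (w @ [0]) ! Suc i # drop (Suc (Suc i)) inp"
      using i by (subst Cons_nth_drop_Suc[symmetric]) (auto simp: inp_def nth_append)
    then obtain r where inp': "inp' = (w @ [0]) ! Suc i # r" and r: "drop (Suc (Suc i)) inp = r"
      using I by (simp add: I_def)
    have "w ! i \<noteq> 0" using i assms(3) by (metis nth_mem)
    have I': "R' 4 = w ! i" "R' 3 = h + i" "stored R' h (take i w)" "frame {2,3,4} h R R'"
      using I i by (simp_all add: I_def nth_append)
    show "R' 4 \<noteq> 0 \<and> wp (Do (Store 3 4) ;; Inc 3 ;; Do (Read 4)) R' inp' (\<lambda>t R' inp'. t \<le> 4 \<and> I (Suc i) R' inp')"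
      using \<open>w ! i \<noteq> 0\<close> i I' assms(2) r unfolding inp'
      by (simp add: I_def take_Suc_conv_app_nth frame_def)
  qed (use that in \<open>auto simp: I_def\<close>)
  have "w @ 0 # rest = (w @ [0]) ! 0 # drop 1 inp" by (cases w) (auto simp: inp_def)
  then have first: "wp (Do (Read 4)) R (w @ 0 # rest) (\<lambda>t R' inp'. t = 1 \<and> I 0 R' inp')"
    using assms by (simp add: I_def frame_def)
  show ?thesis unfolding read_word_def
  proof (rule wp_then[OF first], rule wp_then[OF loop], goal_cases)
    case (2 t1 R1 inp1 t2 R2 inp2)
    then have "R2 4 = 0" "inp2 = rest" "R2 3 = h + length w" "stored R2 h w" "frame {2,3,4} h R R2"
      "t1 = 1" "t2 \<le> 6 * length w + 1"
      by (auto simp: I_def inp_def)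
    then show ?case using assms(2) by simp
  qed simp
qed

text \<open>The code of the letter is found by truncated subtraction: \<open>c - 2\<close> vanishes for \<open>x\<^bsup>\<plusminus>1\<^esup>\<close>, and
  then \<open>c - 1\<close>, or else \<open>c - 3\<close>, gives the sign.\<close>

definition push_letter :: "nat \<Rightarrow> com" where
  "push_letter m =
     Do (Load 8 7) ;; Do (Const 9 2) ;; Do (Sub 9 4 9) ;;
     IfZ 9
       (IfZ 8 (Do (Sub 9 7 6) ;; IfZ 9 (Inc 7 ;; Do (Const 8 0) ;; Do (Store 7 8)) (Dec 7))
          (Inc 7 ;; Do (Const 8 0) ;; Do (Store 7 8)) ;;
        Do (Const 9 1) ;; Do (Sub 9 4 9) ;; IfZ 9 (AddC 10 m) (AddC 11 m))
       (Do (Const 9 3) ;; Do (Sub 9 4 9) ;;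
        IfZ 9
          (Inc 8 ;; Do (Const 9 m) ;; Do (Sub 9 9 8) ;; IfZ 9 (Do (Const 8 0)) Skip ;;
           Do (Store 7 8) ;; AddC 10 2)
          (IfZ 8 (Do (Const 8 (m - 1))) (Dec 8) ;; Do (Store 7 8) ;; AddC 11 2))"

definition stack :: "(nat \<Rightarrow> nat) \<Rightarrow> nat \<Rightarrow> nat list \<Rightarrow> bool" where
  "stack R b l \<longleftrightarrow> R 6 = b \<and> R 7 + 1 = b + length l \<and> stored R b l \<and> l \<noteq> []"

lemma stack_upd [simp]:
  "i < b \<Longrightarrow> i \<noteq> 6 \<Longrightarrow> i \<noteq> 7 \<Longrightarrow> stack (R(i := v)) b l = stack R b l"
  by (simp add: stack_def)

lemma push_letter:
  assumes "stack R b l" "40 \<le> b" "R 4 \<in> {1,2,3,4}" "\<forall>d\<in>set l. d < m" "2 \<le> m"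
  shows "wp (push_letter m) R inp (\<lambda>t R' inp'. t \<le> 20 \<and> inp' = inp \<and> stack R' b (letter m (R 4) l) \<and>
    int (R' 10) - int (R' 11) = int (R 10) - int (R 11) + weight m (R 4) \<and>
    R' 10 + R' 11 \<le> R 10 + R 11 + m \<and> frame {2,7,8,9,10,11} b R R')"
proof -
  obtain l' d where l: "l = l' @ [d]" using assms(1) by (cases l rule: rev_cases) (auto simp: stack_def)
  have R: "R 6 = b" "R 7 = b + length l'" "stored R b l'" "R (b + length l') = d" "d < m"
    using assms by (auto simp: stack_def l)
  have y: "Suc d mod m = (if Suc d = m then 0 else Suc d)"
    "(d + (m - Suc 0)) mod m = (if d = 0 then m - 1 else d - 1)"
    using \<open>d < m\<close> assms(5) by (auto simp: mod_if)
  have x: "l' = [] \<or> (\<exists>l'' e. l' = l'' @ [e])" by (metis rev_exhaust)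
  consider "R 4 = 1" | "R 4 = 2" | "R 4 = 3" | "R 4 = 4" using assms(3) by blast
  then show ?thesis
    by cases (use R y x assms(2,5) in \<open>auto simp: push_letter_def l letter_def weight_def push_x_def
        push_y_def stack_def frame_def\<close>)
qed


definition push_word :: "nat \<Rightarrow> com" where
  "push_word m = Do (Load 4 5) ;; While 4 (push_letter m ;; Inc 5 ;; Do (Load 4 5))"

definition letters :: "nat list \<Rightarrow> bool" where
  "letters w \<longleftrightarrow> set w \<subseteq> {1,2,3,4}"

lemma letter_bounded: "\<forall>d\<in>set l. d < m \<Longrightarrow> 0 < m \<Longrightarrow> \<forall>d\<in>set (letter m c l). d < m"
  by (auto simp: letter_def push_x_def push_y_def dest: in_set_butlastD)

lemma fold_letter_bounded: "\<forall>d\<in>set l. d < m \<Longrightarrow> 0 < m \<Longrightarrow> \<forall>d\<in>set (fold (letter m) w l). d < m"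
proof (induction w arbitrary: l)
  case (Cons c w)
  show ?case using Cons.IH[OF letter_bounded[OF Cons.prems]] Cons.prems(2) by simp
qed simp

lemma push_word:
  assumes "stack R b l" "40 \<le> b" "\<forall>d\<in>set l. d < m" "2 \<le> m"
    and w: "letters w" "stored R p (w @ [0])" "R 5 = p" "40 \<le> p" "p + length w < b"
  shows "wp (push_word m) R inp (\<lambda>t R' inp'. t \<le> 25 * length w + 2 \<and> inp' = inp \<and>
    stack R' b (fold (letter m) w l) \<and>
    int (R' 10) - int (R' 11) = int (R 10) - int (R 11) + sum_list (map (weight m) w) \<and>
    R' 10 + R' 11 \<le> R 10 + R 11 + m * length w \<and> frame {2,4,5,7,8,9,10,11} b R R')"
proof -
  define I where "I i R' inp' \<longleftrightarrow> inp' = inp \<and> R' 5 = p + i \<and> R' 4 = (w @ [0]) ! i \<and>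
    stack R' b (fold (letter m) (take i w) l) \<and>
    int (R' 10) - int (R' 11) = int (R 10) - int (R 11) + sum_list (map (weight m) (take i w)) \<and>
    R' 10 + R' 11 \<le> R 10 + R 11 + m * i \<and> frame {2,4,5,7,8,9,10,11} b R R'"
    for i and R' :: "nat \<Rightarrow> nat" and inp'
  have loop: "wp (While 4 (push_letter m ;; Inc 5 ;; Do (Load 4 5))) R' inp'
     (\<lambda>t R' inp'. t \<le> (23 + 2) * (length w - 0) + 1 \<and> I (length w) R' inp')" if "I 0 R' inp'" for R' inp'
  proof (rule wp_loop)
    fix i R' inp'
    assume i: "i < length w" and "I i R' inp'"
    then have I: "inp' = inp" "R' 5 = p + i" "R' 4 = w ! i" "stack R' b (fold (letter m) (take i w) l)"
      "int (R' 10) - int (R' 11) = int (R 10) - int (R 11) + sum_list (map (weight m) (take i w))"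
      "R' 10 + R' 11 \<le> R 10 + R 11 + m * i" "frame {2,4,5,7,8,9,10,11} b R R'"
      by (simp_all add: I_def nth_append)
    have wi: "w ! i \<in> {1,2,3,4}" using w(1) i by (auto simp: letters_def dest!: nth_mem)
    show "R' 4 \<noteq> 0 \<and> wp (push_letter m ;; Inc 5 ;; Do (Load 4 5)) R' inp' (\<lambda>t R' inp'. t \<le> 23 \<and> I (Suc i) R' inp')"
    proof (intro conjI)
      show "R' 4 \<noteq> 0" using wi I by auto
      show "wp (push_letter m ;; Inc 5 ;; Do (Load 4 5)) R' inp' (\<lambda>t R' inp'. t \<le> 23 \<and> I (Suc i) R' inp')"
      proof (rule wp_then[OF push_letter[OF I(4) assms(2)]], goal_cases)
        case (4 t R'' inp'')
        have fr: "frame {2,4,5,7,8,9,10,11} b R R''"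
          by (rule frame_trans[OF I(7), of "{2,7,8,9,10,11}" b]) (use 4 in auto)
        have "stored R'' p (w @ [0])"
          using w assms(2) frame_stored[OF fr, of p "w @ [0]"] by force
        then have ld: "R'' (Suc (p + i)) = (w @ [0]) ! Suc i"
          using i unfolding stored_def by (metis Suc_less_eq add_Suc_right length_append_singleton)
        have R5: "R'' 5 = p + i" using 4 I(2) assms(2) by (auto simp: frame_def)
        have tk: "take (Suc i) w = take i w @ [w ! i]" using i by (rule take_Suc_conv_app_nth)
        have *: "t \<le> 20" "inp'' = inp" "stack R'' b (letter m (w ! i) (fold (letter m) (take i w) l))"
          "int (R'' 10) - int (R'' 11) = int (R' 10) - int (R' 11) + weight m (w ! i)"
          "R'' 10 + R'' 11 \<le> R' 10 + R' 11 + m"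
          using 4 I by simp_all
        then have "int (R'' 10) - int (R'' 11)
            = int (R 10) - int (R 11) + sum_list (map (weight m) (take (Suc i) w))"
          "R'' 10 + R'' 11 \<le> R 10 + R 11 + m * Suc i" using I(5,6) by (simp_all add: tk)
        then show ?case
          using *(1-3) fr ld R5 w(4) assms(2) unfolding I_def by (simp add: tk del: mult_Suc_right)
      qed (use I(3) wi assms(4) in simp, rule fold_letter_bounded, use assms in simp_all)
    qed
  qed (use that in \<open>auto simp: I_def nth_append\<close>)
  have first: "wp (Do (Load 4 5)) R inp (\<lambda>t R' inp'. t = 1 \<and> I 0 R' inp')"
    using assms by (cases w) (simp_all add: I_def frame_refl)
  show ?thesis unfolding push_word_def
  proof (rule wp_then[OF first], rule wp_mono[OF loop], goal_cases)
    case (2 t1 R1 inp1 t2 R2 inp2)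
    then show ?case by (simp add: I_def)
  qed simp
qed

section \<open>The inverse of the conjugating element\<close>

text \<open>Two pointers move towards each other. The array has even length, so they pass without meeting,
  and truncated subtraction detects this.\<close>

definition midpoint :: com where
  "midpoint = Mov 15 12 ;; Mov 9 13 ;; Do (Sub 8 9 15) ;;
     While 8 (Inc 15 ;; Dec 9 ;; Do (Sub 8 9 15))"

lemma midpoint:
  assumes "R 12 = p" "R 13 + 1 = p + 2 * n" "40 \<le> b"
  shows "wp midpoint R inp (\<lambda>t R' inp'. t \<le> 7 * n + 6 \<and> inp' = inp \<and> R' 15 = p + n \<and>
    frame {2,8,9,15} b R R')"
proof -
  define I where "I i R' inp' \<longleftrightarrow> inp' = inp \<and> R' 15 = p + i \<and> R' 9 + 1 + i = p + 2 * n \<and>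
    R' 8 = R' 9 - R' 15 \<and> frame {2,8,9,15} b R R'" for i and R' :: "nat \<Rightarrow> nat" and inp'
  have loop: "wp (While 8 (Inc 15 ;; Dec 9 ;; Do (Sub 8 9 15))) R' inp'
     (\<lambda>t R' inp'. t \<le> (5 + 2) * (n - 0) + 1 \<and> I n R' inp')" if "I 0 R' inp'" for R' inp'
  proof (rule wp_loop)
    fix i R' inp'
    assume "i < n" "I i R' inp'"
    then show "R' 8 \<noteq> 0 \<and> wp (Inc 15 ;; Dec 9 ;; Do (Sub 8 9 15)) R' inp' (\<lambda>t R' inp'. t \<le> 5 \<and> I (Suc i) R' inp')"
      by (simp add: I_def)
  qed (use that in \<open>auto simp: I_def\<close>)
  have I0: "I 0 (R(2 := 0, 15 := p, 2 := 0, 9 := R 13, 8 := R 13 - p)) inp"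
    using assms by (simp add: I_def frame_refl)
  show ?thesis unfolding midpoint_def
    using wp_mono[OF loop[OF I0], of "\<lambda>t R' inp'. 5 + t \<le> 7 * n + 6 \<and> inp' = inp \<and> R' 15 = p + n \<and> frame {2,8,9,15} b R R'"]
    using assms(1) by (simp add: I_def fun_upd_twist)
qed

definition copy_half :: com where
  "copy_half = Mov 6 3 ;; Mov 7 3 ;;
     IfZ 14 (Do (Const 8 0) ;; Do (Store 7 8) ;; Inc 7) Skip ;;
     Mov 5 15 ;; Do (Const 9 1) ;; Do (Add 9 13 9) ;; Do (Sub 8 9 5) ;;
     While 8 (Do (Load 8 5) ;; Do (Store 7 8) ;; Inc 7 ;; Inc 5 ;; Do (Sub 8 9 5)) ;; Dec 7"

lemma copy_half:
  assumes "R 3 = h" "stored R p l" "R 15 = p" "R 13 + 1 = p + length l" "l \<noteq> []" "p + length l \<le> h" "40 \<le> p"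
  shows "wp copy_half R inp (\<lambda>t R' inp'. t \<le> 9 * length l + 20 \<and> inp' = inp \<and>
    stack R' h (if R 14 = 0 then 0 # l else l) \<and> frame {2,5,6,7,8,9} h R R')"
proof -
  define pre :: "nat list" where "pre = (if R 14 = 0 then [0] else [])"
  define I where "I i R' inp' \<longleftrightarrow> inp' = inp \<and> R' 6 = h \<and> R' 7 = h + length pre + i \<and>
    stored R' h (pre @ take i l) \<and> R' 5 = p + i \<and> R' 9 = p + length l \<and> R' 8 = length l - i \<and>
    frame {2,5,6,7,8,9} h R R'" for i and R' :: "nat \<Rightarrow> nat" and inp'
  let ?body = "Do (Load 8 5) ;; Do (Store 7 8) ;; Inc 7 ;; Inc 5 ;; Do (Sub 8 9 5)"
  have loop: "wp (While 8 ?body) R' inp'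
     (\<lambda>t R' inp'. t \<le> (7 + 2) * (length l - 0) + 1 \<and> I (length l) R' inp')" if "I 0 R' inp'" for R' inp'
  proof (rule wp_loop)
    fix i R' inp'
    assume i: "i < length l" and I: "I i R' inp'"
    then have fr: "frame {2,5,6,7,8,9} h R R'" by (simp add: I_def)
    then have "stored R' p l" using frame_stored[OF fr, of p l] assms by force
    then have "R' (p + i) = l ! i" using i by (simp add: stored_def)
    then show "R' 8 \<noteq> 0 \<and> wp ?body R' inp' (\<lambda>t R' inp'. t \<le> 7 \<and> I (Suc i) R' inp')"
      using i I assms by (simp add: I_def take_Suc_conv_app_nth)
  qed (use that in \<open>auto simp: I_def\<close>)
  have first: "wp (Mov 6 3 ;; Mov 7 3 ;;
     IfZ 14 (Do (Const 8 0) ;; Do (Store 7 8) ;; Inc 7) Skip ;;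
     Mov 5 15 ;; Do (Const 9 1) ;; Do (Add 9 13 9) ;; Do (Sub 8 9 5)) R inp (\<lambda>t R' inp'. t \<le> 15 \<and> I 0 R' inp')"
    using assms by (auto simp: I_def pre_def frame_refl)
  have second: "wp (While 8 ?body ;; Dec 7) R' inp' (\<lambda>t R' inp'. t \<le> 9 * length l + 3 \<and> inp' = inp \<and>
    stack R' h (pre @ l) \<and> frame {2,5,6,7,8,9} h R R')" if "I 0 R' inp'" for R' inp'
  proof (rule wp_then[OF loop[OF that]], goal_cases)
    case (1 t R' inp')
    then show ?case using assms by (auto simp: I_def stack_def)
  qed
  have "wp ((Mov 6 3 ;; Mov 7 3 ;;
     IfZ 14 (Do (Const 8 0) ;; Do (Store 7 8) ;; Inc 7) Skip ;;
     Mov 5 15 ;; Do (Const 9 1) ;; Do (Add 9 13 9) ;; Do (Sub 8 9 5)) ;;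
     While 8 ?body ;; Dec 7) R inp (\<lambda>t R' inp'. t \<le> 9 * length l + 20 \<and> inp' = inp \<and>
    stack R' h (pre @ l) \<and> frame {2,5,6,7,8,9} h R R')"
  proof (rule wp_then[OF first], goal_cases)
    case (1 t R' inp')
    then show ?case by (intro wp_mono[OF second]) auto
  qed
  moreover have "pre @ l = (if R 14 = 0 then 0 # l else l)" by (simp add: pre_def)
  ultimately show ?thesis unfolding copy_half_def by (simp only: wp_Seq add.assoc)
qed

section \<open>Cyclic reduction in place\<close>

definition flip_reg :: "nat \<Rightarrow> nat \<Rightarrow> com" where
  "flip_reg m r = IfZ 16 Skip (IfZ r Skip (Do (Const 22 m) ;; Do (Sub r 22 r)))"

lemma neg_mod_if: "j < m \<Longrightarrow> neg_mod m j = (if j = 0 then 0 else m - j)"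
  by (simp add: neg_mod_def)

text \<open>Only the two ends of the array move inwards. The merged exponent is written to the lower end
  before it is known whether it vanishes; in that case the cell is dropped anyway.\<close>

definition reduce_body :: "nat \<Rightarrow> com" where
  "reduce_body m =
     Do (Sub 9 7 6) ;;
     IfZ 9 (Do (Const 20 0))
       (Do (Load 8 6) ;; Do (Load 21 7) ;; flip_reg m 21 ;; Do (Add 8 8 21) ;;
        Do (Const 21 m) ;; Do (Sub 21 21 8) ;;
        IfZ 21 (Do (Const 21 m) ;; Do (Sub 8 8 21)) Skip ;;
        Do (Store 6 8) ;;
        IfZ 8 (Do (Const 8 1) ;; Do (Sub 9 9 8) ;;
               IfZ 9 (Do (Const 20 0)) (Inc 6 ;; Dec 7 ;; Inc 19))
          (Do (Const 20 0)))"

definition reduce :: "nat \<Rightarrow> com" where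
  "reduce m = Do (Const 20 1) ;; While 20 (reduce_body m)"

lemma reduce_body_single:
  assumes "stack R b [d]"
  shows "wp (reduce_body m) R inp (\<lambda>t R' inp'. t = 3 \<and> inp' = inp \<and> R' = R(9 := 0, 20 := 0))"
  using assms by (simp add: reduce_body_def stack_def)

lemma reduce_body_ends:
  assumes "stack R lo (a # l @ [b])" "40 \<le> lo" "a < m" "b < m" "R 16 = 0 \<longleftrightarrow> \<not> tw"
    and d: "(a + flip m tw b) mod m = d"
  shows "wp (reduce_body m) R inp (\<lambda>t R' inp'. t \<le> 30 \<and> inp' = inp \<and> frame {2,6,7,8,9,19,20,21,22} lo R R' \<and>
    R' lo = d \<and> stored R' (lo + 1) l \<and>
    (if d = 0 \<and> l \<noteq> [] then R' 6 = lo + 1 \<and> R' 7 = lo + length l \<and> R' 19 = R 19 + 1 \<and> R' 20 = R 20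
     else R' 6 = lo \<and> R' 7 = lo + length l + 1 \<and> R' 19 = R 19 \<and> R' 20 = 0))"
proof -
  have R: "R 6 = lo" "R 7 = lo + length l + 1" "R lo = a" "stored R (lo + 1) l" "R (Suc (lo + length l)) = b"
    using assms(1) by (auto simp: stack_def)
  define f where "f = flip m tw b"
  have f: "f < m" "flip m tw b = f" using assms(4) by (simp_all add: f_def)
  have d': "d = (if a + f < m then a + f else a + f - m)"
    using d assms(3) f by (auto simp: mod_if[of "a + f"])
  have fl: "f = (if R 16 = 0 then b else if b = 0 then 0 else m - b)"
    using assms(4,5) by (simp add: f_def flip_def neg_mod_if)
  show ?thesis
    unfolding reduce_body_def flip_reg_def
    by (cases "R 16 = 0"; cases "b = 0"; cases "a + f < m"; cases "d = 0"; cases "l = []";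
      use R fl f d' assms(2-4) in \<open>simp add: frame_refl\<close>)
qed

lemma reduce_loop:
  assumes "stack R lo l" "\<forall>d\<in>set l. d < m" "40 \<le> lo" "R 16 = 0 \<longleftrightarrow> \<not> tw" "R 20 = 1"
  shows "wp (While 20 (reduce_body m)) R inp (\<lambda>t R' inp'. t \<le> 32 * length l + 1 \<and> inp' = inp \<and>
    lo \<le> R' 6 \<and> R' 7 + 1 = R' 6 + length (core m tw l) \<and> R' 7 + 1 \<le> lo + length l \<and>
    stored R' (R' 6) (butlast (core m tw l)) \<and>
    R' 19 = R 19 + rounds m tw l \<and> frame {2,6,7,8,9,19,20,21,22} lo R R')"
  using assms
proof (induction "length l" arbitrary: l R lo inp rule: less_induct)
  case less
  show ?case
  proof (cases l rule: list_ends_cases)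
    case 1 then show ?thesis using less.prems by (simp add: stack_def)
  next
    case (2 d)
    then have "stack R lo [d]" using less.prems by simp
    then show ?thesis
    proof (subst wp_While, simp add: less.prems(5), intro wp_mono[OF reduce_body_single], goal_cases)
      case (2 t R' inp')
      then show ?case using less.prems(3) \<open>l = [d]\<close>
        by (simp add: wp_While core_single stack_def frame_refl)
    qed
  next
    case (3 a l' b)
    define d where "d = (a + flip m tw b) mod m"
    have len: "length l = length l' + 2" by (simp add: 3)
    have st: "stack R lo (a # l' @ [b])" and ab: "a < m" "b < m" using less.prems 3 by simp_all
    show ?thesis
    proof (subst wp_While, simp add: less.prems(5), rule wp_mono[OF reduce_body_ends[OF st less.prems(3) ab less.prems(4) d_def[symmetric]]], goal_cases)
      case (1 t R' inp')
      show ?case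
      proof (cases "d = 0 \<and> l' \<noteq> []")
        case True
        have core: "core m tw l = core m tw l'" "rounds m tw l = Suc (rounds m tw l')"
          using True core_ends[OF d_def[symmetric]] unfolding 3 by simp_all
        have R': "R' 6 = lo + 1" "R' 7 = lo + length l'" "R' 19 = R 19 + 1" "R' 20 = 1"
            "stored R' (lo + 1) l'" "frame {2,6,7,8,9,19,20,21,22} lo R R'" "inp' = inp" "t \<le> 30"
          using 1 True less.prems(5) by simp_all
        have "R' 16 = R 16" using R'(6) less.prems(3) by (auto simp: frame_def)
        moreover have "stack R' (lo + 1) l'" using R' True by (simp add: stack_def)
        moreover have "\<forall>d\<in>set l'. d < m" using less.prems(2) 3 by auto
        ultimately have "wp (While 20 (reduce_body m)) R' inp' (\<lambda>t R'' inp''. t \<le> 32 * length l' + 1 \<and> inp'' = inp' \<and>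
            lo + 1 \<le> R'' 6 \<and> R'' 7 + 1 = R'' 6 + length (core m tw l') \<and> R'' 7 + 1 \<le> lo + 1 + length l' \<and>
            stored R'' (R'' 6) (butlast (core m tw l')) \<and>
            R'' 19 = R' 19 + rounds m tw l' \<and> frame {2,6,7,8,9,19,20,21,22} (lo + 1) R' R'')"
          using less.prems(3,4) R' by (intro less.hyps) (simp_all add: 3)
        then show ?thesis
        proof (rule wp_mono, goal_cases)
          case (1 t' R'' inp'')
          have "frame {2,6,7,8,9,19,20,21,22} lo R R''"
            by (rule frame_trans[OF R'(6), of _ "lo + 1"]) (use 1 in auto)
          then show ?case using 1 R' len by (simp add: core)
        qed
      next
        case False
        have core: "core m tw l = d # l' @ [0]" "rounds m tw l = 0"
          unfolding 3 core_ends[OF d_def[symmetric]] by (rule if_not_P[OF False])+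
        have R': "R' 6 = lo" "R' 7 = lo + length l' + 1" "R' 19 = R 19" "R' 20 = 0" "R' lo = d"
            "stored R' (lo + 1) l'" "frame {2,6,7,8,9,19,20,21,22} lo R R'" "inp' = inp" "t \<le> 30"
          using 1 False by auto
        then show ?thesis using len by (simp add: wp_While core)
      qed
    qed
  qed
qed

lemma reduce:
  assumes "stack R lo l" "\<forall>d\<in>set l. d < m" "40 \<le> lo" "R 16 = 0 \<longleftrightarrow> \<not> tw"
  shows "wp (reduce m) R inp (\<lambda>t R' inp'. t \<le> 32 * length l + 2 \<and> inp' = inp \<and>
    lo \<le> R' 6 \<and> R' 7 + 1 = R' 6 + length (core m tw l) \<and> R' 7 + 1 \<le> lo + length l \<and>
    stored R' (R' 6) (butlast (core m tw l)) \<and>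
    R' 19 = R 19 + rounds m tw l \<and> frame {2,6,7,8,9,19,20,21,22} lo R R')"
proof -
  have "stack (R(20 := 1)) lo l" using assms by simp
  then show ?thesis unfolding reduce_def
    using wp_mono[OF reduce_loop[of "R(20 := 1)" lo l m tw inp]] assms
    by (auto simp: frame_def)
qed

section \<open>Comparing the rotations of two cyclic words\<close>

definition mul :: com where
  "mul = While 38 (Do (Add 36 36 37) ;; Dec 38)"

lemma wp_mul [simp]:
  "wp mul R inp Q = Q (5 * R 38 + 1)
     (R(36 := R 36 + R 38 * R 37, 38 := 0, 2 := (if R 38 = 0 then R 2 else 1))) inp"
proof (induction "R 38" arbitrary: R Q)
  case 0
  then have "R(36 := R 36 + R 38 * R 37, 38 := 0, 2 := (if R 38 = 0 then R 2 else 1)) = R" by auto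
  then show ?case using 0 unfolding mul_def by (subst wp_While) simp
next
  case (Suc n)
  define R' where "R' = R(36 := R 36 + R 37, 2 := 1, 38 := n)"
  have R': "R' 38 = n" "R' 36 = R 36 + R 37" "R' 37 = R 37" "R' 2 = 1" by (simp_all add: R'_def)
  have five: "t + 5 = Suc (Suc (Suc (Suc (Suc t))))" for t :: nat by simp
  have "wp mul R inp Q = wp mul R' inp (\<lambda>t. Q (t + 5))"
    using Suc.hyps(2)[symmetric] unfolding mul_def
    by (subst wp_While) (simp add: R'_def fun_upd_twist five)
  also have "\<dots> = Q (5 * n + 6) (R'(36 := R' 36 + n * R' 37, 38 := 0, 2 := 1)) inp"
    using Suc.hyps(1)[of R' "\<lambda>t. Q (t + 5)"] R' by (simp add: add.commute)
  also have "R'(36 := R' 36 + n * R' 37, 38 := 0, 2 := 1) = R(36 := R 36 + Suc n * R 37, 38 := 0, 2 := 1)"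
    by (auto simp: R'_def)
  finally have fin: "wp mul R inp Q = Q (5 * n + 6) (R(36 := R 36 + Suc n * R 37, 38 := 0, 2 := 1)) inp" .
  have "5 * Suc n + 1 = 5 * n + 6" by simp
  then show ?case unfolding fin Suc.hyps(2)[symmetric] by (simp only: nat.distinct if_False)
qed

definition horner :: "nat \<Rightarrow> nat \<Rightarrow> nat \<Rightarrow> com" where
  "horner m r d = Mov 36 d ;; Mov 37 r ;; Do (Const 38 m) ;; mul ;; Mov r 36"

lemma wp_horner [simp]:
  assumes "r \<notin> {2,36,37,38}" "d \<notin> {2,36,37,38}"
  shows "wp (horner m r d) R inp Q =
    Q (5 * m + 8) (R(36 := R d + m * R r, 37 := R r, 38 := 0, 2 := 0, r := R d + m * R r)) inp"
proof -
  have "R(2 := 0, 36 := R d, 2 := 0, 37 := R r, 38 := m, 36 := R d + m * R r, 38 := 0,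
      2 := (if m = 0 then 0 else 1), 2 := 0, r := R d + m * R r)
    = R(36 := R d + m * R r, 37 := R r, 38 := 0, 2 := 0, r := R d + m * R r)"
    by (rule ext) simp
  moreover define T where "T = 5 * m + 8"
  then have "Suc (Suc (Suc (Suc (Suc (Suc (Suc (Suc (5 * m)))))))) = T" by simp
  ultimately show ?thesis using assms unfolding T_def[symmetric] horner_def by simp
qed

text \<open>A sequence of exponents is read as a number in base \<open>m\<close>. Additions of numbers of any size take
  one unit of time, so two sequences can be compared in constant time, and \<open>code_rot\<close> updates the
  number in constant time under rotation.\<close>

definition code :: "nat \<Rightarrow> nat list \<Rightarrow> nat" where
  "code m l = foldl (\<lambda>a d. m * a + d) 0 l"

lemma code_Nil [simp]: "code m [] = 0"
  by (simp add: code_def)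

lemma code_snoc [simp]: "code m (l @ [d]) = m * code m l + d"
  by (simp add: code_def)

lemma code_Cons: "code m (d # l) = d * m ^ length l + code m l"
  by (induction l rule: rev_induct) (simp_all add: algebra_simps flip: append_Cons, simp add: code_def)

lemma code_inject:
  "length l = length l' \<Longrightarrow> \<forall>d\<in>set l. d < m \<Longrightarrow> \<forall>d\<in>set l'. d < m \<Longrightarrow> code m l = code m l' \<longleftrightarrow> l = l'"
proof (induction l arbitrary: l' rule: rev_induct)
  case (snoc d l)
  then obtain k e where l': "l' = k @ [e]" by (cases l' rule: rev_cases) auto
  have "m * code m l + d = m * code m k + e \<longleftrightarrow> code m l = code m k \<and> d = e"
    using snoc.prems l' by (metis div_mult_self4 div_less add.right_neutral less_nat_zero_code
        list.set_intros(1) mod_less mod_mult_self4 rotate1.simps(2) set_rotate1 not_less_zero)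
  then show ?case using snoc l' by simp
qed simp

lemma code_rot:
  assumes "S \<noteq> []" "length S = k"
  shows "m * code m S + flip m tw (hd S) - hd S * m ^ k = code m (rot m tw S)"
  using assms by (cases S) (auto simp: rot_def code_Cons algebra_simps)

definition codes_body :: "nat \<Rightarrow> com" where
  "codes_body m = Do (Const 39 0) ;; horner m 27 39 ;; Do (Load 39 29) ;; horner m 28 39 ;;
     Do (Load 39 31) ;; horner m 30 39 ;; Inc 29 ;; Inc 31 ;; Dec 32"

definition codes :: "nat \<Rightarrow> com" where
  "codes m = Do (Const 27 1) ;; Do (Const 28 0) ;; Do (Const 30 0) ;; Mov 29 17 ;; Mov 31 6 ;; Mov 32 24 ;;
     While 32 (codes_body m)"

lemma codes:
  assumes "stored R q T" "R 17 = q" "stored R p S" "R 6 = p" "length S = k" "length T = k" "R 24 = k"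
    "40 \<le> p" "40 \<le> q" "p + k \<le> b" "q + k \<le> b"
  shows "wp (codes m) R inp (\<lambda>t R' inp'. t \<le> (15 * m + 60) * k + 20 \<and> inp' = inp \<and>
    R' 27 = m ^ k \<and> R' 28 = code m T \<and> R' 30 = code m S \<and> R' 31 = p + k \<and>
    frame {2,27,28,29,30,31,32,36,37,38,39} b R R')" (is "wp _ _ _ ?Q")
proof -
  define I where "I i R' inp' \<longleftrightarrow> inp' = inp \<and>
    R' 27 = m ^ i \<and> R' 28 = code m (take i T) \<and> R' 30 = code m (take i S) \<and> R' 29 = q + i \<and>
    R' 31 = p + i \<and> R' 32 = k - i \<and> frame {2,27,28,29,30,31,32,36,37,38,39} b R R'"
    for i and R' :: "nat \<Rightarrow> nat" and inp'
  have loop: "wp (While 32 (codes_body m)) R' inp'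
     (\<lambda>t R' inp'. t \<le> ((15 * m + 50) + 2) * (k - 0) + 1 \<and> I k R' inp')" if "I 0 R' inp'" for R' inp'
  proof (rule wp_loop)
    fix i R' inp'
    assume i: "i < k" and I: "I i R' inp'"
    have fr: "frame {2,27,28,29,30,31,32,36,37,38,39} b R R'" using I by (simp add: I_def)
    have "stored R' q T" "stored R' p S"
      using frame_stored[OF fr, of q T] frame_stored[OF fr, of p S] assms by force+
    then have ld: "R' (q + i) = T ! i" "R' (p + i) = S ! i"
      using assms(5,6) i by (simp_all add: stored_def)
    have R': "R' 27 = m ^ i" "R' 28 = code m (take i T)" "R' 30 = code m (take i S)" "R' 29 = q + i"
      "R' 31 = p + i" "R' 32 = k - i" "inp' = inp" using I by (simp_all add: I_def)
    show "R' 32 \<noteq> 0 \<and> wp (codes_body m) R' inp' (\<lambda>t R' inp'. t \<le> 15 * m + 50 \<and> I (Suc i) R' inp')"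
    proof
      show "wp (codes_body m) R' inp' (\<lambda>t R' inp'. t \<le> 15 * m + 50 \<and> I (Suc i) R' inp')"
        unfolding codes_body_def I_def
        using R' ld fr i assms(5,6,8,9) by (simp add: take_Suc_conv_app_nth)
    qed (use R' i in simp)
  qed (use that in \<open>auto simp: I_def\<close>)
  have "wp (Do (Const 27 1) ;; Do (Const 28 0) ;; Do (Const 30 0) ;; Mov 29 17 ;; Mov 31 6 ;; Mov 32 24)
      R inp (\<lambda>t R' inp'. t = 9 \<and> I 0 R' inp')"
    using assms(1-7) by (simp add: I_def frame_refl)
  then have "wp ((Do (Const 27 1) ;; Do (Const 28 0) ;; Do (Const 30 0) ;; Mov 29 17 ;; Mov 31 6 ;; Mov 32 24) ;;
      While 32 (codes_body m)) R inp ?Q"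
  proof (rule wp_then, goal_cases)
    case (1 t R' inp')
    then show ?case
      by (intro wp_mono[OF loop]) (use assms(5,6) in \<open>auto simp: I_def algebra_simps\<close>)
  qed
  then show ?thesis unfolding codes_def by (simp only: wp_Seq add.assoc)
qed

definition rotate_store :: "nat \<Rightarrow> com" where
  "rotate_store m = Do (Load 34 33) ;; Mov 35 34 ;; flip_reg m 35 ;; Do (Store 31 35)"

definition rotate_code :: "nat \<Rightarrow> com" where
  "rotate_code m = horner m 30 35 ;; Do (Const 36 0) ;; Mov 37 27 ;; Mov 38 34 ;; mul ;; Do (Sub 30 30 36)"

definition rotate_count :: com where
  "rotate_count = Inc 33 ;; Inc 31 ;; Dec 32 ;;
     Do (Add 26 26 25) ;; Do (Const 9 3) ;; Do (Sub 9 26 9) ;;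
     IfZ 9 Skip (Do (Const 9 4) ;; Do (Sub 26 26 9))"

text \<open>One step of rotation. The flipped exponent is written behind the end of the array, so that the
  array turns into the infinite sequence through which a window of length \<open>k\<close> is moved.\<close>

definition rotations_body :: "nat \<Rightarrow> com" where
  "rotations_body m =
     Do (Sub 8 30 28) ;; Do (Sub 9 28 30) ;; Do (Add 8 8 9) ;;
     IfZ 8 (IfZ 26 (Do (Const 23 1)) Skip) Skip ;;
     rotate_store m ;; rotate_code m ;; rotate_count"

definition rotations :: "nat \<Rightarrow> com" where
  "rotations m = Do (Const 23 0) ;; Mov 33 6 ;; Do (Add 32 24 24) ;; While 32 (rotations_body m)"

lemma rotations_body:
  assumes "R 30 = code m S" "R 28 = code m T" "R 27 = m ^ k" "length S = k" "length T = k" "0 < k"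
    "\<forall>d\<in>set S. d < m" "\<forall>d\<in>set T. d < m"
    "stored R p S" "R 33 = p" "R 31 = p + k" "40 \<le> p" "R 16 = 0 \<longleftrightarrow> \<not> tw" "R 26 < 4" "R 25 = 0 \<or> R 25 = 2"
  shows "wp (rotations_body m) R inp (\<lambda>t R' inp'. t \<le> 10 * m + 70 \<and> inp' = inp \<and>
    R' 30 = code m (rot m tw S) \<and> R' 28 = code m T \<and> R' 27 = m ^ k \<and> stored R' (Suc p) (rot m tw S) \<and>
    R' 33 = Suc p \<and> R' 31 = Suc p + k \<and> R' 16 = R 16 \<and> R' 25 = R 25 \<and> R' 32 = R 32 - 1 \<and>
    R' 26 = (R 26 + R 25) mod 4 \<and> R' 23 = (if S = T \<and> R 26 = 0 then 1 else R 23))" (is "wp _ _ _ ?Q")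
proof -
  obtain s S' where S: "S = s # S'" using assms(4,6) by (cases S) auto
  have s: "s < m" "R p = s" "stored R (Suc p) S'" "length S' = k - 1" using assms S by auto
  have eq: "R 30 - R 28 + (R 28 - R 30) = 0 \<longleftrightarrow> S = T"
    using code_inject[of S T m] assms by auto
  have fl: "flip m tw s = (if R 16 = 0 then s else if s = 0 then 0 else m - s)"
    using s assms(13) by (simp add: flip_def neg_mod_if)
  define f where "f = flip m tw s"
  have rot: "m * R 30 + f - s * m ^ k = code m (rot m tw S)" "rot m tw S = S' @ [f]"
    using code_rot[of S k m tw] assms S by (simp_all add: f_def rot_def)
  have md: "(R 26 + R 25) mod 4 = (if R 26 + R 25 \<le> 3 then R 26 + R 25 else R 26 + R 25 - 4)"
    using assms(14,15) by (auto simp: mod_if[of "R 26 + _"])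
  have pk: "p + k = Suc p + length S'" using s assms(6) by simp
  define e where "e = p + k"
  have e: "40 \<le> e" "Suc p + length S' = e" "R 31 = e" using assms(11,12) pk by (simp_all add: e_def)
  have first: "wp (Do (Sub 8 30 28) ;; Do (Sub 9 28 30) ;; Do (Add 8 8 9) ;;
     IfZ 8 (IfZ 26 (Do (Const 23 1)) Skip) Skip) R inp (\<lambda>t R' inp'. t \<le> 10 \<and> inp' = inp \<and>
       R' 23 = (if S = T \<and> R 26 = 0 then 1 else R 23) \<and> frame {2,8,9,23} e R R')"
    using eq by (auto simp: frame_refl)
  have second: "wp (rotate_store m) R1 inp (\<lambda>t R' inp'. t \<le> 15 \<and> inp' = inp \<and>
      R' 34 = s \<and> R' 35 = f \<and> stored R' (Suc p) (S' @ [f]) \<and> frame {2,22,34,35} e R1 R')"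
    if fr: "frame {2,8,9,23} e R R1" for R1
  proof -
    have R1: "R1 33 = p" "R1 31 = e" "R1 16 = R 16"
      using frameD[OF fr] assms(10) e by simp_all
    have R1p: "R1 p = s" using frameD[OF fr, of p] s(2) e(2) assms(12) by simp
    have "stored R1 (Suc p) S'" using frame_stored[OF fr, of "Suc p" S'] s(3) e(2) assms(12) by auto
    moreover have "e \<noteq> 34" "e \<noteq> 35" "e \<noteq> 2" "e \<noteq> 22" using e by simp_all
    ultimately show ?thesis unfolding rotate_store_def flip_reg_def
      using R1 R1p fl[folded f_def] e(1,2) assms(12)
      by (cases "R 16 = 0"; cases "s = 0") (simp_all add: frame_refl)
  qed
  have third: "wp (rotate_code m) R1 inp (\<lambda>t R' inp'. t \<le> 10 * m + 20 \<and> inp' = inp \<and>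
      R' 30 = code m (rot m tw S) \<and> frame {2,30,36,37,38} b R1 R')"
    if "R1 34 = s" "R1 35 = f" "R1 30 = code m S" "R1 27 = m ^ k" for R1 b
    unfolding rotate_code_def using that s(1) rot(1)[symmetric] assms(1)
    by (simp add: frame_refl add.commute)
  have fourth: "wp rotate_count R1 inp (\<lambda>t R' inp'. t \<le> 20 \<and> inp' = inp \<and>
      R' 33 = Suc p \<and> R' 31 = Suc e \<and> R' 32 = R 32 - 1 \<and> R' 26 = (R 26 + R 25) mod 4 \<and>
      frame {2,9,26,31,32,33} b R1 R')"
    if "R1 33 = p" "R1 31 = e" "R1 32 = R 32" "R1 26 = R 26" "R1 25 = R 25" for R1 b
    unfolding rotate_count_def md using that by (auto simp: frame_refl)
  have "wp ((Do (Sub 8 30 28) ;; Do (Sub 9 28 30) ;; Do (Add 8 8 9) ;;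
      IfZ 8 (IfZ 26 (Do (Const 23 1)) Skip) Skip) ;;
      rotate_store m ;; rotate_code m ;; rotate_count) R inp ?Q"
  proof (rule wp_then[OF first], goal_cases)
    case (1 t1 R1 i1)
    then have 1: "t1 \<le> 10" "i1 = inp" "R1 23 = (if S = T \<and> R 26 = 0 then 1 else R 23)"
      "frame {2,8,9,23} e R R1" by auto
    show ?case unfolding 1(2)
    proof (rule wp_then[OF second[OF 1(4)]], goal_cases)
      case (1 t2 R2 i2)
      then have 2: "t2 \<le> 15" "i2 = inp" "R2 34 = s" "R2 35 = f" "stored R2 (Suc p) (S' @ [f])"
        "frame {2,22,34,35} e R1 R2" by auto
      have R2: "R2 30 = code m S" "R2 27 = m ^ k" "R2 28 = code m T" "R2 16 = R 16" "R2 25 = R 25"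
         "R2 26 = R 26" "R2 31 = e" "R2 32 = R 32" "R2 33 = p" "R2 23 = R1 23"
        using frameD[OF 2(6)] frameD[OF \<open>frame {2,8,9,23} e R R1\<close>] assms(1-3,10) e by simp_all
      show ?case unfolding 2(2)
      proof (rule wp_then[OF third[OF 2(3,4) R2(1,2), of "e + 1"]], goal_cases)
        case (1 t3 R3 i3)
        then have 3: "t3 \<le> 10 * m + 20" "i3 = inp" "R3 30 = code m (rot m tw S)"
          "frame {2,30,36,37,38} (e + 1) R2 R3" by auto
        have R3: "R3 27 = m ^ k" "R3 28 = code m T" "R3 16 = R 16" "R3 25 = R 25" "R3 26 = R 26"
           "R3 31 = e" "R3 32 = R 32" "R3 33 = p" "R3 23 = R1 23"
          using frameD[OF 3(4)] R2 e(1) by simp_all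
        show ?case unfolding 3(2)
        proof (rule wp_mono[OF fourth[OF R3(8,6,7,5,4), of "e + 1"]], goal_cases)
          case (1 t4 R4 i4)
          then have 4: "t4 \<le> 20" "i4 = inp" "R4 33 = Suc p" "R4 31 = Suc e" "R4 32 = R 32 - 1"
            "R4 26 = (R 26 + R 25) mod 4" "frame {2,9,26,31,32,33} (e + 1) R3 R4" by auto
          have R4: "R4 27 = m ^ k" "R4 28 = code m T" "R4 16 = R 16" "R4 25 = R 25" "R4 23 = R1 23"
             "R4 30 = code m (rot m tw S)"
            using frameD[OF 4(7)] R3 3(3) e(1) by simp_all
          have "frame {2,9,26,30,31,32,33,36,37,38} (e + 1) R2 R4"
            by (rule frame_trans[OF 3(4) 4(7)]) auto
          then have "stored R4 (Suc p) (rot m tw S)"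
            using frame_stored[of _ "e + 1" R2 R4 "Suc p" "rot m tw S"] 2(5) e(2) assms(12)
            by (auto simp: rot(2))
          then show ?case
            using \<open>t1 \<le> 10\<close> 2(1) 3(1) 4 R4 \<open>R1 23 = (if S = T \<and> R 26 = 0 then 1 else R 23)\<close>
            by (simp add: e_def)
        qed
      qed
    qed
  qed
  then show ?thesis unfolding rotations_body_def by (simp only: wp_Seq add.assoc)
qed

lemma rotations:
  assumes "R 30 = code m S" "R 28 = code m T" "R 27 = m ^ k" "length S = k" "length T = k" "0 < k"
    "\<forall>d\<in>set S. d < m" "\<forall>d\<in>set T. d < m"
    "stored R p S" "R 6 = p" "R 31 = p + k" "R 24 = k" "40 \<le> p" "R 16 = 0 \<longleftrightarrow> \<not> tw"
    "R 26 < 4" "R 25 = 0 \<or> R 25 = 2"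
  shows "wp (rotations m) R inp (\<lambda>t R' inp'. t \<le> (20 * m + 144) * k + 6 \<and> inp' = inp \<and>
    R' 23 = (if \<exists>r<2 * k. (rot m tw ^^ r) S = T \<and> (R 26 + r * R 25) mod 4 = 0 then 1 else 0))"
proof -
  define rt where "rt r = (rot m tw ^^ r) S" for r
  have rt_Suc: "rt (Suc r) = rot m tw (rt r)" for r by (simp add: rt_def)
  have len: "length (rt r) = k" for r
  proof (induction r)
    case (Suc r)
    then show ?case using assms(6) by (simp add: rt_Suc rot_def)
  qed (simp add: rt_def assms(4))
  have bound: "\<forall>d\<in>set (rt r). d < m" for r
  proof (induction r)
    case (Suc r)
    obtain c l where "rt r = c # l" using len[of r] assms(6) by (cases "rt r") auto
    then show ?case using Suc by (auto simp: rt_Suc rot_def)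
  qed (simp add: rt_def assms(7))
  define found where "found n = (if \<exists>r<n. rt r = T \<and> (R 26 + r * R 25) mod 4 = 0 then 1 else 0 :: nat)" for n
  have found_Suc: "found (Suc n) = (if rt n = T \<and> (R 26 + n * R 25) mod 4 = 0 then 1 else found n)" for n
    by (auto simp: found_def less_Suc_eq)
  define I where "I r R' inp' \<longleftrightarrow> inp' = inp \<and> R' 30 = code m (rt r) \<and> R' 28 = code m T \<and> R' 27 = m ^ k \<and>
    stored R' (p + r) (rt r) \<and> R' 33 = p + r \<and> R' 31 = p + r + k \<and> R' 16 = R 16 \<and> R' 25 = R 25 \<and>
    R' 32 = 2 * k - r \<and> R' 26 = (R 26 + r * R 25) mod 4 \<and> R' 23 = found r"
    for r and R' :: "nat \<Rightarrow> nat" and inp'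
  have loop: "wp (While 32 (rotations_body m)) R' inp'
     (\<lambda>t R' inp'. t \<le> ((10 * m + 70) + 2) * (2 * k - 0) + 1 \<and> I (2 * k) R' inp')" if "I 0 R' inp'" for R' inp'
  proof (rule wp_loop)
    fix r R' inp'
    assume r: "r < 2 * k" and "I r R' inp'"
    then have I: "R' 30 = code m (rt r)" "R' 28 = code m T" "R' 27 = m ^ k"
      "stored R' (p + r) (rt r)" "R' 33 = p + r" "R' 31 = p + r + k" "R' 16 = R 16" "R' 25 = R 25"
      "R' 32 = 2 * k - r" "R' 26 = (R 26 + r * R 25) mod 4" "R' 23 = found r" "inp' = inp"
      by (simp_all add: I_def)
    have "wp (rotations_body m) R' inp' (\<lambda>t R'' inp''. t \<le> 10 * m + 70 \<and> inp'' = inp' \<and>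
      R'' 30 = code m (rot m tw (rt r)) \<and> R'' 28 = code m T \<and> R'' 27 = m ^ k \<and>
      stored R'' (Suc (p + r)) (rot m tw (rt r)) \<and>
      R'' 33 = Suc (p + r) \<and> R'' 31 = Suc (p + r) + k \<and> R'' 16 = R' 16 \<and> R'' 25 = R' 25 \<and> R'' 32 = R' 32 - 1 \<and>
      R'' 26 = (R' 26 + R' 25) mod 4 \<and> R'' 23 = (if rt r = T \<and> R' 26 = 0 then 1 else R' 23))"
      by (rule rotations_body[OF I(1-3) len assms(5,6) bound assms(8) I(4-6)])
        (use assms(13,14,16) I(7,8,10) in simp_all)
    then have "wp (rotations_body m) R' inp' (\<lambda>t R' inp'. t \<le> 10 * m + 70 \<and> I (Suc r) R' inp')"
    proof (rule wp_mono, goal_cases)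
      case (1 t R'' i'')
      have "((R 26 + r * R 25) mod 4 + R 25) mod 4 = (R 26 + Suc r * R 25) mod 4"
        by (simp add: mod_simps algebra_simps)
      then show ?case using 1 I by (simp add: I_def rt_Suc found_Suc)
    qed
    then show "R' 32 \<noteq> 0 \<and> wp (rotations_body m) R' inp' (\<lambda>t R' inp'. t \<le> 10 * m + 70 \<and> I (Suc r) R' inp')"
      using I(9) r by simp
  qed (use that in \<open>auto simp: I_def\<close>)
  have "I 0 (R(23 := 0, 2 := 0, 33 := p, 32 := k + k)) inp"
    using assms by (simp add: I_def rt_def found_def)
  then have first: "wp (Do (Const 23 0) ;; Mov 33 6 ;; Do (Add 32 24 24)) R inp (\<lambda>t R' inp'. t = 4 \<and> I 0 R' inp')"
    using assms(10,12) by simp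
  have "wp ((Do (Const 23 0) ;; Mov 33 6 ;; Do (Add 32 24 24)) ;; While 32 (rotations_body m)) R inp
    (\<lambda>t R' inp'. t \<le> (20 * m + 144) * k + 6 \<and> inp' = inp \<and> R' 23 = found (2 * k))"
  proof (rule wp_then[OF first], goal_cases)
    case (1 t R' inp')
    then show ?case
      by (intro wp_mono[OF loop]) (auto simp: I_def algebra_simps)
  qed
  then show ?thesis unfolding rotations_def found_def rt_def by (simp only: wp_Seq add.assoc)
qed

text \<open>Without twist this compares the abelianizations. With twist it prepares the counter modulo \<open>4\<close>
  for \<open>D + 2 r\<close>; as registers hold no negative numbers, \<open>- n\<close> is replaced by \<open>3 n\<close>.\<close>

definition exponents :: com where
  "exponents = IfZ 16
     (Do (Sub 8 10 11) ;; Do (Sub 9 11 10) ;; Do (Add 8 8 9) ;; Do (Const 26 0) ;; Do (Const 25 0))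
     (Do (Add 26 11 11) ;; Do (Add 26 26 11) ;; Do (Add 26 26 10) ;; Do (Add 26 26 19) ;; Do (Add 26 26 19) ;;
      Do (Const 9 3) ;; Do (Sub 8 26 9) ;;
      While 8 (Do (Const 9 4) ;; Do (Sub 26 26 9) ;; Do (Const 9 3) ;; Do (Sub 8 26 9)) ;;
      Do (Const 25 2))"

lemma exponents:
  fixes R :: "nat \<Rightarrow> nat"
  defines "D \<equiv> int (R 10) - int (R 11)"
  assumes "R 16 = 0 \<longleftrightarrow> \<not> tw"
  shows "wp exponents R inp (\<lambda>t R' inp'. t \<le> 6 * (R 10 + R 11 + R 19) + 20 \<and> inp' = inp \<and>
    (R' 8 = 0 \<longleftrightarrow> (\<not> tw \<longrightarrow> D = 0)) \<and> R' 26 < 4 \<and> (R' 25 = 0 \<or> R' 25 = 2) \<and>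
    (\<forall>r. (R' 26 + r * R' 25) mod 4 = 0 \<longleftrightarrow> (tw \<longrightarrow> 4 dvd D + 2 * (int (R 19) + int r))) \<and>
    frame {2,8,9,25,26} b R R')"
proof (cases tw)
  case False
  then show ?thesis unfolding exponents_def using assms
    by (auto simp: frame_refl)
next
  case True
  define e where "e = R 11 + R 11 + R 11 + R 10 + R 19 + R 19"
  define I where "I i R' inp' \<longleftrightarrow> inp' = inp \<and> R' 26 = e - 4 * i \<and> R' 8 = e - 4 * i - 3 \<and> frame {2,8,9,25,26} b R R'"
    for i and R' :: "nat \<Rightarrow> nat" and inp'
  let ?body = "Do (Const 9 4) ;; Do (Sub 26 26 9) ;; Do (Const 9 3) ;; Do (Sub 8 26 9)"
  have em: "e mod 4 = e - 4 * (e div 4)" by (simp add: minus_mult_div_eq_mod)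
  have loop: "wp (While 8 ?body) R' inp' (\<lambda>t R' inp'. t \<le> (4 + 2) * (e div 4 - 0) + 1 \<and> I (e div 4) R' inp')"
    if "I 0 R' inp'" for R' inp'
  proof (rule wp_loop)
    fix i R' inp'
    assume i: "i < e div 4" and I: "I i R' inp'"
    have "4 * (i + 1) \<le> e" using i by presburger
    then show "R' 8 \<noteq> 0 \<and> wp ?body R' inp' (\<lambda>t R' inp'. t \<le> 4 \<and> I (Suc i) R' inp')"
      using I by (auto simp: I_def)
  next
    fix R' inp' assume "I (e div 4) R' inp'"
    then show "R' 8 = 0" using em mod_less_divisor[of 4 e] unfolding I_def by linarith
  qed (use that in simp_all)
  have first: "wp (Do (Add 26 11 11) ;; Do (Add 26 26 11) ;; Do (Add 26 26 10) ;; Do (Add 26 26 19) ;; Do (Add 26 26 19) ;;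
      Do (Const 9 3) ;; Do (Sub 8 26 9)) R inp (\<lambda>t R' inp'. t = 7 \<and> I 0 R' inp')"
    by (simp add: I_def e_def frame_refl)
  have key: "(e mod 4 + r * 2) mod 4 = 0 \<longleftrightarrow> 4 dvd D + 2 * (int (R 19) + int r)" for r
  proof -
    have "(e mod 4 + r * 2) mod 4 = 0 \<longleftrightarrow> 4 dvd e + r * 2" by (simp add: mod_simps dvd_eq_mod_eq_0)
    also have "\<dots> \<longleftrightarrow> 4 dvd int (e + r * 2)" by (metis int_dvd_int_iff of_nat_numeral)
    also have "int (e + r * 2) = D + 2 * (int (R 19) + int r) + 4 * int (R 11)" by (simp add: e_def D_def)
    also have "4 dvd \<dots> \<longleftrightarrow> 4 dvd D + 2 * (int (R 19) + int r)" by presburger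
    finally show ?thesis .
  qed
  have "wp ((Do (Add 26 11 11) ;; Do (Add 26 26 11) ;; Do (Add 26 26 10) ;; Do (Add 26 26 19) ;; Do (Add 26 26 19) ;;
      Do (Const 9 3) ;; Do (Sub 8 26 9)) ;; While 8 ?body ;; Do (Const 25 2)) R inp
      (\<lambda>t R' inp'. t \<le> 6 * (e div 4) + 9 \<and> inp' = inp \<and> R' 8 = 0 \<and> R' 26 = e mod 4 \<and> R' 25 = 2 \<and>
         frame {2,8,9,25,26} b R R')"
  proof (rule wp_then[OF first], rule wp_then[OF loop], goal_cases)
    case (2 t R' i' t2 R2 i2)
    then have "R2 26 = e mod 4" "R2 8 = e mod 4 - 3" "frame {2,8,9,25,26} b R R2" "i2 = inp" "t2 \<le> 6 * (e div 4) + 1"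
      "t = 7" using em by (auto simp: I_def)
    moreover have "e mod 4 - 3 = 0" using mod_less_divisor[of 4 e] by linarith
    ultimately show ?case by simp
  qed simp
  then have *: "wp (Do (Add 26 11 11) ;; Do (Add 26 26 11) ;; Do (Add 26 26 10) ;; Do (Add 26 26 19) ;; Do (Add 26 26 19) ;;
      Do (Const 9 3) ;; Do (Sub 8 26 9) ;; While 8 ?body ;; Do (Const 25 2)) R inp
      (\<lambda>t R' inp'. t \<le> 6 * (e div 4) + 9 \<and> inp' = inp \<and> R' 8 = 0 \<and> R' 26 = e mod 4 \<and> R' 25 = 2 \<and>
         frame {2,8,9,25,26} b R R')"
    by (simp only: wp_Seq add.assoc)
  have "R 16 \<noteq> 0" using assms True by simp
  have time: "6 * (e div 4) + 9 + 2 \<le> 6 * (R 10 + R 11 + R 19) + 20" by (simp add: e_def)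
  show ?thesis unfolding exponents_def wp_IfZ if_not_P[OF \<open>R 16 \<noteq> 0\<close>]
  proof (rule wp_mono[OF *], goal_cases)
    case (1 t R' i')
    then show ?case using time key True by simp
  qed
qed

text \<open>The branch for \<open>k = 0\<close> answers at once, in accordance with the case of length one in \<open>accepts\<close>.\<close>

definition decide :: "nat \<Rightarrow> com" where
  "decide m = Do (Const 23 0) ;; Do (Sub 24 7 6) ;;
     Do (Sub 8 24 18) ;; Do (Sub 9 18 24) ;; Do (Add 8 8 9) ;;
     IfZ 8 (exponents ;; IfZ 8 (IfZ 24 (Do (Const 23 1)) (codes m ;; rotations m)) Skip) Skip"

lemma decide:
  assumes "R 6 = p" "R 7 + 1 = p + length cu" "stored R p (butlast cu)"
    and "R 17 = q" "R 18 + 1 = length cv" "stored R q (butlast cv)"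
    and "cu \<noteq> []" "cv \<noteq> []" "\<forall>d\<in>set cu. d < m" "\<forall>d\<in>set cv. d < m"
    and "40 \<le> p" "40 \<le> q" "R 16 = 0 \<longleftrightarrow> \<not> tw"
    and D: "D = int (R 10) - int (R 11)"
  shows "wp (decide m) R inp (\<lambda>t R' inp'.
    t \<le> (35 * m + 204) * length cu + 6 * (R 10 + R 11 + R 19) + 70 \<and> inp' = inp \<and>
    (R' 23 \<noteq> 0 \<longleftrightarrow> length cu = length cv \<and> (\<not> tw \<longrightarrow> D = 0) \<and>
      (length cu = 1 \<or>
       (\<exists>r < 2 * (length cu - 1). (rot m tw ^^ r) (butlast cu) = butlast cv \<and>
          (tw \<longrightarrow> 4 dvd D + 2 * (int (R 19) + int r))))))"
proof -
  define k where "k = length cu - 1"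
  have k: "length cu = k + 1" using assms(7) by (simp add: k_def Suc_leI)
  have R7: "R 7 = p + k" using assms(2) k by simp
  have R18: "R 18 = length cv - 1" using assms(5) by simp
  define R1 where "R1 = R(23 := 0, 24 := k, 8 := (k - R 18) + (R 18 - k), 9 := R 18 - k)"
  have first: "wp (Do (Const 23 0) ;; Do (Sub 24 7 6) ;; Do (Sub 8 24 18) ;; Do (Sub 9 18 24) ;; Do (Add 8 8 9))
     R inp (\<lambda>t R' inp'. t = 5 \<and> inp' = inp \<and> R' = R1)"
    using R7 assms(1) by (auto simp: R1_def fun_upd_twist)
  have eq8: "R1 8 = 0 \<longleftrightarrow> length cu = length cv" using assms(5) k by (auto simp: R1_def)
  define G where "G = (length cu = length cv \<and> (\<not> tw \<longrightarrow> D = 0) \<and>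
      (length cu = 1 \<or>
       (\<exists>r < 2 * (length cu - 1). (rot m tw ^^ r) (butlast cu) = butlast cv \<and>
          (tw \<longrightarrow> 4 dvd D + 2 * (int (R 19) + int r)))))"
  define C where "C = (35 * m + 204) * length cu + 6 * (R 10 + R 11 + R 19)"
  have second: "wp (IfZ 8 (exponents ;; IfZ 8 (IfZ 24 (Do (Const 23 1)) (codes m ;; rotations m)) Skip) Skip) R1 inp
     (\<lambda>t R' inp'. t \<le> C + 60 \<and> inp' = inp \<and> (R' 23 \<noteq> 0 \<longleftrightarrow> G))"
  proof (cases "length cu = length cv")
    case False
    then show ?thesis using eq8 by (simp add: G_def) (simp add: R1_def)
  next
    case True
    then have "R1 8 = 0" using eq8 by simp
    define b where "b = p + q + k"
    have R1: "R1 10 = R 10" "R1 11 = R 11" "R1 19 = R 19" "R1 16 = R 16" "R1 6 = p" "R1 17 = q" "R1 24 = k" "R1 23 = 0"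
      using assms(1,4) by (simp_all add: R1_def)
    have st1: "stored R1 p (butlast cu)" "stored R1 q (butlast cv)"
      using assms(3,6,11,12) by (simp_all add: R1_def)
    note ex = exponents[of R1 tw inp b, unfolded R1, OF assms(13)]
    have "wp (exponents ;; IfZ 8 (IfZ 24 (Do (Const 23 1)) (codes m ;; rotations m)) Skip) R1 inp
     (\<lambda>t R' inp'. t \<le> C + 50 \<and> inp' = inp \<and> (R' 23 \<noteq> 0 \<longleftrightarrow> G))"
    proof (rule wp_then[OF ex], goal_cases)
      case (1 t R2 i2)
      then have R2: "t \<le> 6 * (R 10 + R 11 + R 19) + 20" "i2 = inp" "R2 8 = 0 \<longleftrightarrow> (\<not> tw \<longrightarrow> D = 0)" "R2 26 < 4"
         "R2 25 = 0 \<or> R2 25 = 2"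
         "\<And>r. (R2 26 + r * R2 25) mod 4 = 0 \<longleftrightarrow> (tw \<longrightarrow> 4 dvd D + 2 * (int (R 19) + int r))"
         "frame {2,8,9,25,26} b R1 R2" unfolding D by auto
      have b: "40 \<le> b" "p + k \<le> b" "q + k \<le> b" using assms(11) by (simp_all add: b_def)
      have R2': "R2 16 = R 16" "R2 6 = p" "R2 17 = q" "R2 24 = k" "R2 23 = 0"
        using frameD[OF R2(7)] R1 b by simp_all
      have st2: "stored R2 p (butlast cu)" "stored R2 q (butlast cv)"
        using frame_stored[OF R2(7), of p "butlast cu"] frame_stored[OF R2(7), of q "butlast cv"] st1 b
          assms(11,12) k True by simp_all
      have bd: "\<forall>d\<in>set (butlast cu). d < m" "\<forall>d\<in>set (butlast cv). d < m"
        using assms(9,10) by (auto dest: in_set_butlastD)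
      show ?case
      proof (cases "R2 8 = 0 \<and> k \<noteq> 0")
        case False
        then show ?thesis using R2(1-3) R2' k True by (auto simp: G_def C_def)
      next
        case kpos: True
        have len: "length (butlast cu) = k" "length (butlast cv) = k" using k True by simp_all
        note cod = codes[OF st2(2) R2'(3) st2(1) R2'(2) len R2'(4) assms(11,12) b(2,3), of m inp]
        have "wp (codes m ;; rotations m) R2 inp
          (\<lambda>t R' inp'. t \<le> (35 * m + 204) * k + 26 \<and> inp' = inp \<and> (R' 23 \<noteq> 0 \<longleftrightarrow> G))"
        proof (rule wp_then[OF cod], goal_cases)
          case (1 t3 R3 i3)
          then have R3: "t3 \<le> (15 * m + 60) * k + 20" "i3 = inp" "R3 27 = m ^ k" "R3 28 = code m (butlast cv)"
            "R3 30 = code m (butlast cu)" "R3 31 = p + k" "frame {2,27,28,29,30,31,32,36,37,38,39} b R2 R3" by auto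
          have R3': "R3 16 = 0 \<longleftrightarrow> \<not> tw" "R3 6 = p" "R3 24 = k" "R3 26 = R2 26" "R3 25 = R2 25"
            using frameD[OF R3(7)] R2' assms(13) b by simp_all
          have st3: "stored R3 p (butlast cu)"
            using frame_stored[OF R3(7), of p "butlast cu"] st2 b assms(11) len by simp
          show ?case unfolding R3(2)
          proof (rule wp_mono[OF rotations[OF R3(5,4,3) len _ bd st3 R3'(2) R3(6) R3'(3) assms(11) R3'(1)]], goal_cases)
            case (4 t4 R4 i4)
            then have "R4 23 \<noteq> 0 \<longleftrightarrow> (\<exists>r<2 * k. (rot m tw ^^ r) (butlast cu) = butlast cv \<and>
                (tw \<longrightarrow> 4 dvd D + 2 * (int (R 19) + int r)))"
              using R3' R2(6) by auto
            moreover have "length cu \<noteq> 1" using kpos k by simp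
            ultimately have "R4 23 \<noteq> 0 \<longleftrightarrow> G"
              using kpos R2(3) True unfolding G_def k_def[symmetric] by blast
            moreover have "t3 + t4 \<le> (35 * m + 204) * k + 26" using R3(1) 4 by (auto simp: algebra_simps)
            ultimately show ?case using 4 by simp
          qed (use kpos R3' R2(4,5) in simp_all)
        qed
        then show ?thesis unfolding wp_IfZ R2(2)
          using kpos R2(1) R2' k by (auto elim!: wp_mono simp: C_def algebra_simps)
      qed
    qed
    then show ?thesis unfolding wp_IfZ if_P[OF \<open>R1 8 = 0\<close>] by (rule wp_mono) auto
  qed
  have "wp ((Do (Const 23 0) ;; Do (Sub 24 7 6) ;; Do (Sub 8 24 18) ;; Do (Sub 9 18 24) ;; Do (Add 8 8 9)) ;;
     IfZ 8 (exponents ;; IfZ 8 (IfZ 24 (Do (Const 23 1)) (codes m ;; rotations m)) Skip) Skip) R inp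
     (\<lambda>t R' inp'. t \<le> C + 70 \<and> inp' = inp \<and> (R' 23 \<noteq> 0 \<longleftrightarrow> G))"
  proof (rule wp_then[OF first], goal_cases)
    case (1 t R' i')
    then have "t = 5" "i' = inp" "R' = R1" by auto
    then show ?case by (simp only:) (rule wp_mono[OF second], auto)
  qed
  then show ?thesis unfolding decide_def C_def G_def by (simp only: wp_Seq add.assoc)
qed

section \<open>The whole program\<close>

definition tape :: "(nat \<Rightarrow> nat) \<Rightarrow> nat list \<Rightarrow> nat list \<Rightarrow> nat list \<Rightarrow> nat list \<Rightarrow> nat \<Rightarrow> bool" where
  "tape R u v a b h \<longleftrightarrow> stored R 60 (u @ [0]) \<and> R 41 = 60 + length u + 1 \<and>
     stored R (R 41) (v @ [0]) \<and> R 42 = R 41 + length v + 1 \<and>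
     stored R (R 42) (a @ [0]) \<and> R 43 = R 42 + length a + 1 \<and>
     stored R (R 43) (b @ [0]) \<and> h = R 43 + length b + 1"

lemma frame_weaken: "frame S b R R' \<Longrightarrow> S \<subseteq> T \<Longrightarrow> frame T b R R'"
  by (auto simp: frame_def)

lemma tape_frame:
  assumes "tape R u v a b h0" "frame S h R R'" "\<forall>i\<in>S. i < 40" "h0 \<le> h"
  shows "tape R' u v a b h0"
proof -
  have "60 \<le> h" using assms(1,4) by (simp add: tape_def)
  then have "41 \<notin> S" "42 \<notin> S" "43 \<notin> S" using assms(3) by auto
  then have R: "R' 41 = R 41" "R' 42 = R 42" "R' 43 = R 43"
    using frameD[OF assms(2)] \<open>60 \<le> h\<close> by simp_all
  have S: "\<forall>i\<in>S. i < p" if "40 \<le> p" for p using assms(3) that by auto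
  have keep: "stored R' p l = stored R p l" if "40 \<le> p" "p + length l \<le> h" for p l
    using frame_stored[OF assms(2) that(2) S[OF that(1)]] .
  have "stored R' 60 (u @ [0]) = stored R 60 (u @ [0])" "stored R' (R 41) (v @ [0]) = stored R (R 41) (v @ [0])"
    "stored R' (R 42) (a @ [0]) = stored R (R 42) (a @ [0])" "stored R' (R 43) (b @ [0]) = stored R (R 43) (b @ [0])"
    by (rule keep; use assms(1,4) in \<open>simp add: tape_def\<close>)+
  then show ?thesis using assms(1) unfolding tape_def R by blast
qed

definition load_input :: com where
  "load_input = Do (Const 3 60) ;; read_word ;; Mov 41 3 ;; read_word ;; Mov 42 3 ;;
     read_word ;; Mov 43 3 ;; read_word"

lemma load_input:
  assumes "letters u" "letters v" "letters a" "letters b"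
  shows "wp load_input R (u @ 0 # v @ 0 # a @ 0 # b @ [0]) (\<lambda>t R' inp'.
    t \<le> 6 * (length u + length v + length a + length b) + 30 \<and> tape R' u v a b (R' 3))"
proof -
  have nz: "0 \<notin> set w" if "letters w" for w using that by (auto simp: letters_def)
  define R0 where "R0 = R(3 := 60)"
  have R0: "R0 3 = 60" by (simp add: R0_def)
  have "wp (read_word ;; Mov 41 3 ;; read_word ;; Mov 42 3 ;; read_word ;; Mov 43 3 ;; read_word)
    R0 (u @ 0 # v @ 0 # a @ 0 # b @ [0]) (\<lambda>t R' inp'.
    t \<le> 6 * (length u + length v + length a + length b) + 29 \<and> tape R' u v a b (R' 3))"
  proof (rule wp_then[OF read_word[where R = R0 and h = 60 and w = u, OF R0]], simp, rule nz[OF assms(1)], elim conjE, goal_cases)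
    case (1 t1 R1 i1)
    note A = 1
    define R1' where "R1' = R1(2 := 0, 41 := R1 3)"
    have R1: "R1' 3 = 60 + length u + 1" "R1' 41 = 60 + length u + 1" "stored R1' 60 (u @ [0])"
      using A by (simp_all add: R1'_def)
    have "wp (read_word ;; Mov 42 3 ;; read_word ;; Mov 43 3 ;; read_word) R1' i1 (\<lambda>t R' inp'.
       t \<le> 6 * (length v + length a + length b) + 22 \<and> tape R' u v a b (R' 3))"
      unfolding \<open>i1 = _\<close>
    proof (rule wp_then[OF read_word[where R = R1' and h = "60 + length u + 1" and w = v, OF R1(1)]], simp, rule nz[OF assms(2)], elim conjE, goal_cases)
      case (1 t2 R2 i2)
      note B = 1
      define R2' where "R2' = R2(2 := 0, 42 := R2 3)"
      have fr: "frame {2,3,4} (60 + length u + 1) R1' R2" using B by simp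
      have "R2 41 = R1' 41" "stored R2 60 (u @ [0])"
        using frameD[OF fr, of 41] frame_stored[OF fr, of 60 "u @ [0]"] R1 by simp_all
      then have R2: "R2' 3 = 60 + length u + 1 + length v + 1" "R2' 41 = 60 + length u + 1"
        "R2' 42 = 60 + length u + 1 + length v + 1" "stored R2' 60 (u @ [0])"
        "stored R2' (60 + length u + 1) (v @ [0])"
        using B R1 by (simp_all add: R2'_def)
      have "wp (read_word ;; Mov 43 3 ;; read_word) R2' i2 (\<lambda>t R' inp'.
         t \<le> 6 * (length a + length b) + 15 \<and> tape R' u v a b (R' 3))"
        unfolding \<open>i2 = _\<close>
      proof (rule wp_then[OF read_word[where R = R2' and h = "60 + length u + 1 + length v + 1" and w = a, OF R2(1)]], simp, rule nz[OF assms(3)], elim conjE, goal_cases)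
        case (1 t3 R3 i3)
        note C = 1
        define h where "h = 60 + length u + 1 + length v + 1"
        define R3' where "R3' = R3(2 := 0, 43 := R3 3)"
        have fr: "frame {2,3,4} h R2' R3" using C by (simp add: h_def)
        have "R3 41 = R2' 41" "R3 42 = R2' 42" "stored R3 60 (u @ [0])" "stored R3 (60 + length u + 1) (v @ [0])"
          using frameD[OF fr, of 41] frameD[OF fr, of 42] frame_stored[OF fr, of 60 "u @ [0]"]
            frame_stored[OF fr, of "60 + length u + 1" "v @ [0]"] R2 by (simp_all add: h_def)
        then have R3: "R3' 3 = h + length a + 1" "R3' 41 = 60 + length u + 1"
          "R3' 42 = h" "R3' 43 = h + length a + 1" "stored R3' 60 (u @ [0])"
          "stored R3' (60 + length u + 1) (v @ [0])" "stored R3' h (a @ [0])"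
          using C R2 by (simp_all add: R3'_def h_def)
        have "wp read_word R3' i3 (\<lambda>t R' inp'.
           t \<le> 6 * length b + 8 \<and> tape R' u v a b (R' 3))"
          unfolding \<open>i3 = _\<close>
        proof (rule wp_mono[OF read_word[where R = R3' and h = "h + length a + 1" and w = b and rest = "[]", OF R3(1)]], simp add: h_def, rule nz[OF assms(4)], elim conjE, goal_cases)
          case (1 t4 R4 i4)
          define h' where "h' = h + length a + 1"
          have fr: "frame {2,3,4} h' R3' R4" using 1 by (simp add: h'_def)
          have "R4 41 = R3' 41" "R4 42 = R3' 42" "R4 43 = R3' 43" "stored R4 60 (u @ [0])"
            "stored R4 (60 + length u + 1) (v @ [0])" "stored R4 h (a @ [0])"
            using frameD[OF fr, of 41] frameD[OF fr, of 42] frameD[OF fr, of 43] frame_stored[OF fr, of 60 "u @ [0]"]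
              frame_stored[OF fr, of "60 + length u + 1" "v @ [0]"] frame_stored[OF fr, of h "a @ [0]"] R3
            by (simp_all add: h_def h'_def)
          then show ?case using 1 R3 by (simp add: tape_def h'_def h_def)
        qed
        then show ?case unfolding wp_Seq using C by (auto elim!: wp_mono simp: R3'_def)
      qed
      then show ?case unfolding wp_Seq using B by (auto elim!: wp_mono simp: R2'_def)
    qed
    then show ?case unfolding wp_Seq using A by (auto elim!: wp_mono simp: R1'_def)
  qed
  then show ?thesis unfolding load_input_def wp_Seq by (auto elim!: wp_mono simp: R0_def)
qed

lemma letter_nonempty [simp]: "letter m c l \<noteq> []"
  by (simp add: letter_def)

lemma length_letter: "length (letter m c l) \<le> Suc (length l)"
  by (cases l rule: rev_cases) (auto simp: letter_def push_x_def push_y_def)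

lemma length_fold_letter: "length (fold (letter m) w l) \<le> length l + length w"
proof (induction w arbitrary: l)
  case (Cons c w)
  show ?case using Cons[of "letter m c l"] length_letter[of m c l] by simp
qed simp

definition start_stack :: com where
  "start_stack = Mov 6 3 ;; Mov 7 3 ;; Do (Const 8 0) ;; Do (Store 7 8)"

definition stage_a :: "nat \<Rightarrow> com" where
  "stage_a m = start_stack ;; Do (Const 10 0) ;; Do (Const 11 0) ;; Mov 5 42 ;; push_word m ;;
     Mov 12 6 ;; Mov 13 7 ;; Do (Sub 16 11 10) ;; Mov 3 7 ;; Inc 3"

lemma stage_a:
  assumes "tape R u v a b h" "R 3 = h" "letters a" "2 \<le> m"
  defines "la \<equiv> fold (letter m) a [0]"
  shows "wp (stage_a m) R inp (\<lambda>t R' inp'. t \<le> 25 * length a + 30 \<and> tape R' u v a b h \<and>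
    stored R' h la \<and> R' 12 = h \<and> R' 13 + 1 = h + length la \<and> R' 3 = h + length la \<and>
    (R' 16 = 0 \<longleftrightarrow> \<not> sum_list (map (weight m) a) < 0))"
proof -
  have h: "60 \<le> R 42" "R 42 + length a < h" "stored R (R 42) (a @ [0])" using assms(1) by (auto simp: tape_def)
  define R1 where "R1 = R(6 := h, 7 := h, 8 := 0, h := 0, 10 := 0, 11 := 0, 2 := 0, 5 := R 42)"
  have fr1: "frame {2,5,6,7,8,10,11} h R R1" by (simp add: R1_def frame_refl)
  have R1: "stack R1 h [0]" "R1 5 = R 42" "R1 10 = 0" "R1 11 = 0"
    using h by (simp_all add: R1_def stack_def)
  have st: "stored R1 (R 42) (a @ [0])" using frame_stored[OF fr1, of "R 42" "a @ [0]"] h by simp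
  have "wp (push_word m) R1 inp (\<lambda>t R' inp'. t \<le> 25 * length a + 2 \<and> inp' = inp \<and>
    stack R' h la \<and>
    int (R' 10) - int (R' 11) = int (R1 10) - int (R1 11) + sum_list (map (weight m) a) \<and>
    R' 10 + R' 11 \<le> R1 10 + R1 11 + m * length a \<and> frame {2,4,5,7,8,9,10,11} h R1 R')"
    unfolding la_def using h assms(3,4) R1 st by (intro push_word[where p = "R 42"]) simp_all
  then have "wp (push_word m ;; Mov 12 6 ;; Mov 13 7 ;; Do (Sub 16 11 10) ;; Mov 3 7 ;; Inc 3) R1 inp
    (\<lambda>t R' inp'. t \<le> 25 * length a + 15 \<and> tape R' u v a b h \<and>
    stored R' h la \<and> R' 12 = h \<and> R' 13 + 1 = h + length la \<and> R' 3 = h + length la \<and>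
    (R' 16 = 0 \<longleftrightarrow> \<not> sum_list (map (weight m) a) < 0))"
  proof (rule wp_then, goal_cases)
    case (1 t R2 i2)
    have sg: "R2 11 - R2 10 = 0 \<longleftrightarrow> \<not> sum_list (map (weight m) a) < 0" using 1 R1 by auto
    define R3 where "R3 = R2(2 := 1, 12 := R2 6, 13 := R2 7, 16 := R2 11 - R2 10, 3 := Suc (R2 7))"
    have "frame {2,3,4,5,6,7,8,9,10,11,12,13,16} h R R2"
      by (rule frame_trans[OF fr1, of "{2,4,5,7,8,9,10,11}" h]) (use 1 in auto)
    then have "frame {2,3,4,5,6,7,8,9,10,11,12,13,16} h R R3" by (simp add: R3_def)
    then have "tape R3 u v a b h" by (rule tape_frame[OF assms(1)]) simp_all
    moreover have "wp (Mov 12 6 ;; Mov 13 7 ;; Do (Sub 16 11 10) ;; Mov 3 7 ;; Inc 3) R2 i2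
      (\<lambda>t R' inp'. t = 9 \<and> R' = R3)" using h by (simp add: R3_def fun_upd_twist)
    ultimately show ?case
      by (elim wp_mono) (use 1 sg h in \<open>auto simp: R3_def stack_def\<close>)
  qed
  then show ?thesis unfolding stage_a_def start_stack_def wp_Seq
    using h assms(2) by (auto elim!: wp_mono simp: R1_def fun_upd_twist)
qed


text \<open>What the stages for \<open>v\<close> and \<open>u\<close> share: the input words, and the half \<open>l\<close> of the normal form of \<open>\<psi> x\<close>
  from which both start.\<close>

definition prepared where
  "prepared R u v a b h p l fl tw \<longleftrightarrow> tape R u v a b h \<and> h \<le> p \<and> stored R p l \<and> l \<noteq> [] \<and>
     R 15 = p \<and> R 13 + 1 = p + length l \<and> (R 14 = 0 \<longleftrightarrow> fl) \<and> (R 16 = 0 \<longleftrightarrow> \<not> tw)"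

lemma prepared_frame:
  assumes "prepared R u v a b h p l fl tw" "frame S h' R R'" "\<forall>i\<in>S. i < 40 \<and> i \<notin> {13,14,15,16}" "p + length l \<le> h'"
  shows "prepared R' u v a b h p l fl tw"
proof -
  have hp: "h \<le> p" "60 \<le> h" using assms(1) by (auto simp: prepared_def tape_def)
  have nin: "13 \<notin> S" "14 \<notin> S" "15 \<notin> S" "16 \<notin> S" using assms(3) by auto
  have S: "\<forall>i\<in>S. i < p" using assms(3) hp by auto
  have "R' 13 = R 13" "R' 14 = R 14" "R' 15 = R 15" "R' 16 = R 16"
    using frameD[OF assms(2)] hp assms(4) nin by simp_all
  moreover have "stored R' p l = stored R p l" using frame_stored[OF assms(2,4) S] .
  moreover have "tape R' u v a b h"
    by (rule tape_frame[OF _ assms(2)]) (use assms hp in \<open>auto simp: prepared_def\<close>)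
  ultimately show ?thesis using assms(1) by (simp add: prepared_def)
qed

text \<open>The normal form of \<open>\<psi> y\<close> is needed for its length only, so its array is overwritten afterwards.\<close>

definition stage_b :: "nat \<Rightarrow> com" where
  "stage_b m = start_stack ;; Do (Const 10 0) ;; Do (Const 11 0) ;; Mov 5 43 ;; push_word m ;;
     Do (Sub 8 13 12) ;; Do (Sub 9 7 6) ;; Do (Sub 14 8 9) ;; midpoint"

lemma stage_b:
  assumes "tape R u v a b h" "R 3 = h + length la" "letters b" "2 \<le> m"
    and "stored R h la" "R 12 = h" "R 13 + 1 = h + length la" "R 16 = 0 \<longleftrightarrow> \<not> tw"
    and la: "length la = 2 * n" "0 < n"
  defines "lb \<equiv> fold (letter m) b [0]"
  shows "wp (stage_b m) R inp (\<lambda>t R' inp'. t \<le> 25 * length b + 7 * n + 40 \<and> R' 3 = h + length la \<and>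
    prepared R' u v a b h (h + n) (drop n la) (\<not> length lb < length la) tw)"
proof -
  define h1 where "h1 = h + length la"
  have h: "60 \<le> R 43" "R 43 + length b < h" "stored R (R 43) (b @ [0])" "h \<le> h1"
    using assms(1) by (auto simp: tape_def h1_def)
  define R1 where "R1 = R(6 := h1, 7 := h1, 8 := 0, h1 := 0, 10 := 0, 11 := 0, 2 := 0, 5 := R 43)"
  have fr1: "frame {2,5,6,7,8,10,11} h1 R R1" by (simp add: R1_def frame_refl)
  have R1: "stack R1 h1 [0]" "R1 5 = R 43"
    using h by (simp_all add: R1_def stack_def)
  have st: "stored R1 (R 43) (b @ [0])" using frame_stored[OF fr1, of "R 43" "b @ [0]"] h by simp
  have "wp (push_word m) R1 inp (\<lambda>t R' inp'. t \<le> 25 * length b + 2 \<and> inp' = inp \<and>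
    stack R' h1 lb \<and>
    int (R' 10) - int (R' 11) = int (R1 10) - int (R1 11) + sum_list (map (weight m) b) \<and>
    R' 10 + R' 11 \<le> R1 10 + R1 11 + m * length b \<and> frame {2,4,5,7,8,9,10,11} h1 R1 R')"
    unfolding lb_def using h assms(3,4) R1 st by (intro push_word[where p = "R 43"]) simp_all
  then have "wp (push_word m ;; Do (Sub 8 13 12) ;; Do (Sub 9 7 6) ;; Do (Sub 14 8 9) ;; midpoint) R1 inp
    (\<lambda>t R' inp'. t \<le> 25 * length b + 7 * n + 20 \<and> R' 3 = h1 \<and>
    prepared R' u v a b h (h + n) (drop n la) (\<not> length lb < length la) tw)"
  proof (rule wp_then, goal_cases)
    case (1 t R2 i2)
    have fr2: "frame {2,4,5,6,7,8,9,10,11} h1 R R2"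
      by (rule frame_trans[OF fr1, of "{2,4,5,7,8,9,10,11}" h1]) (use 1 in auto)
    have R2: "R2 12 = h" "R2 13 + 1 = h + length la" "R2 16 = R 16" "R2 3 = h1"
      using frameD[OF fr2] assms(2,6,7) h by (simp_all add: h1_def)
    have R2': "R2 7 + 1 = R2 6 + length lb" "lb \<noteq> []" using 1 by (auto simp: stack_def)
    define R3 where "R3 = R2(8 := R2 13 - R2 12, 9 := R2 7 - R2 6, 14 := (R2 13 - R2 12) - (R2 7 - R2 6))"
    have fl: "R3 14 = 0 \<longleftrightarrow> \<not> length lb < length la"
    proof -
      have "R2 13 - R2 12 = length la - 1" using R2 by simp
      moreover have "R2 7 - R2 6 = length lb - 1" using R2' by simp
      moreover have "0 < length lb" using R2'(2) by simp
      ultimately show ?thesis by (auto simp: R3_def)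
    qed
    have "wp midpoint R3 i2 (\<lambda>t R' inp'. t \<le> 7 * n + 6 \<and> inp' = i2 \<and> R' 15 = h + n \<and>
       frame {2,8,9,15} h1 R3 R')"
      using R2 la h by (intro midpoint) (simp_all add: R3_def)
    then have "wp midpoint R3 i2 (\<lambda>t R' inp'. t \<le> 7 * n + 6 \<and> R' 3 = h1 \<and>
        prepared R' u v a b h (h + n) (drop n la) (\<not> length lb < length la) tw)"
    proof (rule wp_mono, goal_cases)
      case (1 t R4 i4)
      then have fr4: "frame {2,8,9,15} h1 R3 R4" "R4 15 = h + n" "t \<le> 7 * n + 6" by auto
      have R4: "R4 14 = R3 14" "R4 16 = R 16" "R4 13 = R2 13" "R4 3 = h1"
        using frameD[OF fr4(1)] R2 h by (simp_all add: R3_def)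
      have "frame {2,4,5,6,7,8,9,10,11,14} h1 R R3"
        using frame_weaken[OF fr2, of "{2,4,5,6,7,8,9,10,11,14}"] by (simp add: R3_def)
      then have fr: "frame {2,4,5,6,7,8,9,10,11,14,15} h1 R R4"
        by (rule frame_trans[OF _ fr4(1)]) auto
      have tp: "tape R4 u v a b h" by (rule tape_frame[OF assms(1) fr]) (use h in simp_all)
      have "stored R4 h la" using frame_stored[OF fr, of h la] assms(5) h by (simp add: h1_def)
      then have "stored R4 h (take n la @ drop n la)" by simp
      then have "stored R4 (h + n) (drop n la)" unfolding stored_append using la by simp
      then show ?case using fr4 R4 fl R2 la tp assms(8) by (simp add: prepared_def)
    qed
    then have "wp (Do (Sub 8 13 12) ;; Do (Sub 9 7 6) ;; Do (Sub 14 8 9) ;; midpoint) R2 i2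
      (\<lambda>t R' inp'. t \<le> 7 * n + 9 \<and> R' 3 = h1 \<and>
        prepared R' u v a b h (h + n) (drop n la) (\<not> length lb < length la) tw)"
      unfolding R3_def by (auto elim!: wp_mono)
    then show ?case by (rule wp_mono) (use 1 in auto)
  qed
  then show ?thesis unfolding stage_b_def start_stack_def wp_Seq
    using h assms(2) by (auto elim!: wp_mono simp: R1_def fun_upd_twist h1_def)
qed

definition stage_v :: "nat \<Rightarrow> com" where
  "stage_v m = copy_half ;; Do (Const 10 0) ;; Do (Const 11 0) ;; Mov 5 41 ;; push_word m ;;
     Mov 3 7 ;; Inc 3 ;; Do (Const 19 0) ;; reduce m ;; Mov 17 6 ;; Do (Sub 18 7 6)"

text \<open>Exchanging the two counters changes the sign of the abelianization of \<open>v\<close>, so that afterwards they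
  hold the difference of the two abelianizations. The array for \<open>u\<close> comes last because its cyclic
  word is extended by \<open>rotations\<close>.\<close>

definition stage_u :: "nat \<Rightarrow> com" where
  "stage_u m = copy_half ;; Mov 8 10 ;; Mov 10 11 ;; Mov 11 8 ;; Do (Const 5 60) ;; push_word m ;; reduce m"

text \<open>Pushing the letters of a word on the normal form of \<open>g\<^sup>-\<^sup>1\<close> gives that of \<open>g\<^sup>-\<^sup>1\<close> times the word.\<close>

lemma copy_and_push:
  assumes "prepared R u v a b h p l fl tw" "R 3 = h1" "p + length l \<le> h1" "letters w" "2 \<le> m"
    and "\<forall>d\<in>set l. d < m"
    and "stored R q (w @ [0])" "60 \<le> q" "q + length w < h"
    and pre: "\<And>R1. stack R1 h1 (if fl then 0 # l else l) \<Longrightarrow> frame {2,5,6,7,8,9} h1 R R1 \<Longrightarrow>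
      wp pre R1 inp (\<lambda>t R2 inp'. t \<le> 10 \<and> inp' = inp \<and> stack R2 h1 (if fl then 0 # l else l) \<and>
        frame {2,5,6,7,8,9,10,11} h1 R R2 \<and> R2 5 = q \<and> int (R2 10) - int (R2 11) = P \<and> R2 10 + R2 11 \<le> K)"
  defines "lw \<equiv> fold (letter m) w (if fl then 0 # l else l)"
  shows "wp (copy_half ;; pre ;; push_word m) R inp (\<lambda>t R' inp'. t \<le> 9 * length l + 25 * length w + 35 \<and>
     inp' = inp \<and> stack R' h1 lw \<and> (\<forall>d\<in>set lw. d < m) \<and>
     int (R' 10) - int (R' 11) = P + sum_list (map (weight m) w) \<and> R' 10 + R' 11 \<le> K + m * length w \<and>
     frame {2,4,5,6,7,8,9,10,11} h1 R R')"
proof -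
  have h: "60 \<le> h" "h \<le> h1" using assms(1,3) by (auto simp: prepared_def tape_def)
  have bd: "\<forall>d\<in>set (if fl then 0 # l else l). d < m" using assms(5,6) by auto
  have cp: "wp copy_half R inp (\<lambda>t R' inp'. t \<le> 9 * length l + 20 \<and> inp' = inp \<and>
    stack R' h1 (if R 14 = 0 then 0 # l else l) \<and> frame {2,5,6,7,8,9} h1 R R')"
    using assms(1-3) h by (intro copy_half[where p = p]) (auto simp: prepared_def)
  show ?thesis
  proof (rule wp_then[OF cp], goal_cases)
    case (1 t1 R1 i1)
    then have 1: "t1 \<le> 9 * length l + 20" "i1 = inp" "stack R1 h1 (if fl then 0 # l else l)"
      "frame {2,5,6,7,8,9} h1 R R1" using assms(1) by (auto simp: prepared_def)
    show ?case unfolding 1(2)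
    proof (rule wp_then[OF pre[OF 1(3,4)]], goal_cases)
      case (1 t2 R2 i2)
      then have 2: "t2 \<le> 10" "i2 = inp" "stack R2 h1 (if fl then 0 # l else l)"
         "frame {2,5,6,7,8,9,10,11} h1 R R2" "R2 5 = q" "int (R2 10) - int (R2 11) = P" "R2 10 + R2 11 \<le> K" by auto
      have st: "stored R2 q (w @ [0])" using frame_stored[OF 2(4), of q "w @ [0]"] assms(7-9) h by simp
      have pw: "wp (push_word m) R2 inp (\<lambda>t R' inp'. t \<le> 25 * length w + 2 \<and> inp' = inp \<and>
        stack R' h1 lw \<and>
        int (R' 10) - int (R' 11) = int (R2 10) - int (R2 11) + sum_list (map (weight m) w) \<and>
        R' 10 + R' 11 \<le> R2 10 + R2 11 + m * length w \<and> frame {2,4,5,7,8,9,10,11} h1 R2 R')"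
        unfolding lw_def using h assms(4,5,8,9) 2 st bd by (intro push_word[where p = q]) simp_all
      show ?case unfolding 2(2)
      proof (rule wp_mono[OF pw], goal_cases)
        case (1 t3 R3 i3)
        have "frame {2,4,5,6,7,8,9,10,11} h1 R R3"
          by (rule frame_trans[OF 2(4), of "{2,4,5,7,8,9,10,11}" h1]) (use 1 in auto)
        moreover have "\<forall>d\<in>set lw. d < m" unfolding lw_def by (rule fold_letter_bounded[OF bd]) (use assms(5) in simp)
        ultimately show ?case using 1 2 \<open>t1 \<le> _\<close> by auto
      qed
    qed
  qed
qed

lemma stage_v:
  assumes "prepared R u v a b h p l fl tw" "R 3 = h1" "p + length l \<le> h1" "letters v" "2 \<le> m"
    and "\<forall>d\<in>set l. d < m"
  defines "lv \<equiv> fold (letter m) v (if fl then 0 # l else l)"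
  shows "wp (stage_v m) R inp (\<lambda>t R' inp'. t \<le> 9 * length l + 25 * length v + 32 * length lv + 60 \<and>
     inp' = inp \<and> prepared R' u v a b h p l fl tw \<and> R' 3 = h1 + length lv \<and>
     int (R' 10) - int (R' 11) = sum_list (map (weight m) v) \<and> R' 10 + R' 11 \<le> m * length v \<and>
     R' 19 = rounds m tw lv \<and> (\<forall>d\<in>set lv. d < m) \<and>
     h1 \<le> R' 17 \<and> R' 18 + 1 = length (core m tw lv) \<and> R' 17 + length (core m tw lv) \<le> h1 + length lv \<and>
     stored R' (R' 17) (butlast (core m tw lv)))" (is "wp _ _ _ ?Q")
proof -
  have h: "60 \<le> h" "h \<le> h1" "stored R (R 41) (v @ [0])" "60 \<le> R 41" "R 41 + length v < h" "R 16 = 0 \<longleftrightarrow> \<not> tw"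
    using assms(1,3) by (auto simp: prepared_def tape_def)
  let ?pre = "Do (Const 10 0) ;; Do (Const 11 0) ;; Mov 5 41"
  have first: "wp (copy_half ;; ?pre ;; push_word m) R inp (\<lambda>t R' inp'. t \<le> 9 * length l + 25 * length v + 35 \<and>
     inp' = inp \<and> stack R' h1 lv \<and> (\<forall>d\<in>set lv. d < m) \<and>
     int (R' 10) - int (R' 11) = 0 + sum_list (map (weight m) v) \<and> R' 10 + R' 11 \<le> 0 + m * length v \<and>
     frame {2,4,5,6,7,8,9,10,11} h1 R R')"
    unfolding lv_def
  proof (rule copy_and_push[OF assms(1-6) h(3-5)], goal_cases)
    case (1 R1)
    then have "R1 41 = R 41" using frameD[OF 1(2), of 41] h by simp
    moreover have "frame {2,5,6,7,8,9,10,11} h1 R R1" by (rule frame_weaken[OF 1(2)]) auto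
    ultimately show ?case using 1 h by simp
  qed
  have "wp ((copy_half ;; ?pre ;; push_word m) ;; Mov 3 7 ;; Inc 3 ;; Do (Const 19 0) ;; reduce m ;; Mov 17 6 ;; Do (Sub 18 7 6))
     R inp ?Q"
  proof (rule wp_then[OF first], goal_cases)
    case (1 t1 R1 i1)
    then have 1: "t1 \<le> 9 * length l + 25 * length v + 35" "i1 = inp" "stack R1 h1 lv" "\<forall>d\<in>set lv. d < m"
      "int (R1 10) - int (R1 11) = sum_list (map (weight m) v)" "R1 10 + R1 11 \<le> m * length v"
      "frame {2,4,5,6,7,8,9,10,11} h1 R R1" by auto
    define R2 where "R2 = R1(2 := 1, 3 := Suc (R1 7), 19 := 0)"
    have st2: "stack R2 h1 lv" using 1(3) h by (simp add: R2_def)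
    have fr2: "frame {2,3,4,5,6,7,8,9,10,11,19} h1 R R2"
      using frame_weaken[OF 1(7), of "{2,3,4,5,6,7,8,9,10,11,19}"] by (simp add: R2_def)
    have R2: "R2 16 = 0 \<longleftrightarrow> \<not> tw" "R2 19 = 0" "R2 3 = h1 + length lv" "R2 10 = R1 10" "R2 11 = R1 11"
      using frameD[OF fr2, of 16] h 1(3) by (simp_all add: R2_def stack_def)
    have red: "wp (reduce m) R2 inp (\<lambda>t R' inp'. t \<le> 32 * length lv + 2 \<and> inp' = inp \<and>
      h1 \<le> R' 6 \<and> R' 7 + 1 = R' 6 + length (core m tw lv) \<and> R' 7 + 1 \<le> h1 + length lv \<and>
      stored R' (R' 6) (butlast (core m tw lv)) \<and>
      R' 19 = R2 19 + rounds m tw lv \<and> frame {2,6,7,8,9,19,20,21,22} h1 R2 R')"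
      by (rule reduce[OF st2 1(4) _ R2(1)]) (use h in simp)
    have "wp (reduce m ;; Mov 17 6 ;; Do (Sub 18 7 6)) R2 inp (\<lambda>t R' inp'. t \<le> 32 * length lv + 6 \<and>
     inp' = inp \<and> prepared R' u v a b h p l fl tw \<and> R' 3 = h1 + length lv \<and>
     int (R' 10) - int (R' 11) = sum_list (map (weight m) v) \<and> R' 10 + R' 11 \<le> m * length v \<and>
     R' 19 = rounds m tw lv \<and> (\<forall>d\<in>set lv. d < m) \<and>
     h1 \<le> R' 17 \<and> R' 18 + 1 = length (core m tw lv) \<and> R' 17 + length (core m tw lv) \<le> h1 + length lv \<and>
     stored R' (R' 17) (butlast (core m tw lv)))"
    proof (rule wp_then[OF red], goal_cases)
      case (1 t3 R3 i3)
      then have 3: "t3 \<le> 32 * length lv + 2" "i3 = inp" "h1 \<le> R3 6" "R3 7 + 1 = R3 6 + length (core m tw lv)"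
        "R3 7 + 1 \<le> h1 + length lv" "stored R3 (R3 6) (butlast (core m tw lv))"
        "R3 19 = rounds m tw lv" "frame {2,6,7,8,9,19,20,21,22} h1 R2 R3" using R2 by auto
      have R3: "R3 3 = h1 + length lv" "R3 10 = R1 10" "R3 11 = R1 11"
        using frameD[OF 3(8)] R2 h by simp_all
      define R4 where "R4 = R3(2 := 0, 17 := R3 6, 18 := R3 7 - R3 6)"
      have "frame {2,3,4,5,6,7,8,9,10,11,17,18,19,20,21,22} h1 R R3"
        by (rule frame_trans[OF fr2 3(8)]) auto
      then have fr4: "frame {2,3,4,5,6,7,8,9,10,11,17,18,19,20,21,22} h1 R R4" by (simp add: R4_def)
      have "prepared R4 u v a b h p l fl tw" by (rule prepared_frame[OF assms(1) fr4]) (use assms(3) in simp_all)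
      moreover have "stored R4 (R3 6) (butlast (core m tw lv))" using 3(3,6) h by (simp add: R4_def)
      moreover have "core m tw lv \<noteq> []" using st2 by (intro core_nonempty) (simp add: stack_def)
      then have "R3 7 - R3 6 + 1 = length (core m tw lv)" using 3(4) by (cases "core m tw lv") auto
      moreover have "wp (Mov 17 6 ;; Do (Sub 18 7 6)) R3 inp (\<lambda>t R' inp'. t = 3 \<and> R' = R4 \<and> inp' = inp)"
        by (simp add: R4_def fun_upd_twist)
      ultimately show ?case unfolding 3(2)
        apply (elim wp_mono)
        using 3 R3 \<open>int (R1 10) - int (R1 11) = _\<close> \<open>R1 10 + R1 11 \<le> _\<close> \<open>\<forall>d\<in>set lv. d < m\<close>
        by (auto simp: R4_def Suc_le_eq)
    qed
    then show ?case unfolding 1(2) using h 1(1) by (auto elim!: wp_mono simp: R2_def fun_upd_twist)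
  qed
  then show ?thesis unfolding stage_v_def by (simp only: wp_Seq add.assoc)
qed


lemma stage_u:
  assumes "prepared R u v a b h p l fl tw" "R 3 = h1" "p + length l \<le> h1" "letters u" "2 \<le> m"
    and "\<forall>d\<in>set l. d < m"
  defines "lu \<equiv> fold (letter m) u (if fl then 0 # l else l)"
  shows "wp (stage_u m) R inp (\<lambda>t R' inp'. t \<le> 9 * length l + 25 * length u + 32 * length lu + 60 \<and>
     inp' = inp \<and> (R' 16 = 0 \<longleftrightarrow> \<not> tw) \<and>
     int (R' 10) - int (R' 11) = sum_list (map (weight m) u) - (int (R 10) - int (R 11)) \<and>
     R' 10 + R' 11 \<le> R 10 + R 11 + m * length u \<and>
     R' 19 = R 19 + rounds m tw lu \<and> (\<forall>d\<in>set lu. d < m) \<and>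
     h1 \<le> R' 6 \<and> R' 7 + 1 = R' 6 + length (core m tw lu) \<and>
     stored R' (R' 6) (butlast (core m tw lu)) \<and> frame {2,4,5,6,7,8,9,10,11,19,20,21,22} h1 R R')" (is "wp _ _ _ ?Q")
proof -
  have h: "60 \<le> h" "h \<le> h1" "stored R 60 (u @ [0])" "60 + length u < h" "R 16 = 0 \<longleftrightarrow> \<not> tw"
    using assms(1,3) by (auto simp: prepared_def tape_def)
  let ?pre = "Mov 8 10 ;; Mov 10 11 ;; Mov 11 8 ;; Do (Const 5 60)"
  have first: "wp (copy_half ;; ?pre ;; push_word m) R inp (\<lambda>t R' inp'. t \<le> 9 * length l + 25 * length u + 35 \<and>
     inp' = inp \<and> stack R' h1 lu \<and> (\<forall>d\<in>set lu. d < m) \<and>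
     int (R' 10) - int (R' 11) = - (int (R 10) - int (R 11)) + sum_list (map (weight m) u) \<and>
     R' 10 + R' 11 \<le> R 10 + R 11 + m * length u \<and> frame {2,4,5,6,7,8,9,10,11} h1 R R')"
    unfolding lu_def
  proof (rule copy_and_push[OF assms(1-6) h(3) _ h(4)], simp, goal_cases)
    case (1 R1)
    then have "R1 10 = R 10" "R1 11 = R 11" using frameD[OF 1(2)] h by simp_all
    moreover have "frame {2,5,6,7,8,9,10,11} h1 R R1" by (rule frame_weaken[OF 1(2)]) auto
    ultimately show ?case using 1 h by simp
  qed
  have "wp ((copy_half ;; ?pre ;; push_word m) ;; reduce m)
     R inp ?Q"
  proof (rule wp_then[OF first], goal_cases)
    case (1 t1 R1 i1)
    then have 1: "t1 \<le> 9 * length l + 25 * length u + 35" "i1 = inp" "stack R1 h1 lu" "\<forall>d\<in>set lu. d < m"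
      "int (R1 10) - int (R1 11) = sum_list (map (weight m) u) - (int (R 10) - int (R 11))"
      "R1 10 + R1 11 \<le> R 10 + R 11 + m * length u"
      "frame {2,4,5,6,7,8,9,10,11} h1 R R1" by auto
    have R1: "R1 16 = 0 \<longleftrightarrow> \<not> tw" "R1 19 = R 19" "R1 16 = R 16" using frameD[OF 1(7)] h by simp_all
    have red: "wp (reduce m) R1 inp (\<lambda>t R' inp'. t \<le> 32 * length lu + 2 \<and> inp' = inp \<and>
      h1 \<le> R' 6 \<and> R' 7 + 1 = R' 6 + length (core m tw lu) \<and> R' 7 + 1 \<le> h1 + length lu \<and>
      stored R' (R' 6) (butlast (core m tw lu)) \<and>
      R' 19 = R1 19 + rounds m tw lu \<and> frame {2,6,7,8,9,19,20,21,22} h1 R1 R')"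
      by (rule reduce[OF 1(3,4) _ R1(1)]) (use h in simp)
    show ?case unfolding 1(2)
    proof (rule wp_mono[OF red], goal_cases)
      case (1 t2 R2 i2)
      then have fr: "frame {2,6,7,8,9,19,20,21,22} h1 R1 R2" by auto
      have "frame {2,4,5,6,7,8,9,10,11,19,20,21,22} h1 R R2"
        by (rule frame_trans[OF \<open>frame {2,4,5,6,7,8,9,10,11} h1 R R1\<close> fr]) auto
      moreover have "R2 16 = R1 16" "R2 10 = R1 10" "R2 11 = R1 11" using frameD[OF fr] h by simp_all
      ultimately show ?case using 1 R1 \<open>t1 \<le> _\<close> \<open>int (R1 10) - int (R1 11) = _\<close> \<open>R1 10 + R1 11 \<le> _\<close>
          \<open>\<forall>d\<in>set lu. d < m\<close> by simp
    qed
  qed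
  then show ?thesis unfolding stage_u_def by (simp only: wp_Seq add.assoc)
qed

definition tcp_program :: "nat \<Rightarrow> com" where
  "tcp_program m = load_input ;; stage_a m ;; stage_b m ;; stage_v m ;; stage_u m ;; decide m"

lemma tcp_program:
  fixes m :: nat
  assumes w: "letters u" "letters v" "letters a" "letters b" and m: "2 \<le> m"
  defines "la \<equiv> fold (letter m) a [0]" and "lb \<equiv> fold (letter m) b [0]"
  assumes la: "even (length la)"
  defines "g \<equiv> inverse_half la lb"
  shows "wp (tcp_program m) R (u @ 0 # v @ 0 # a @ 0 # b @ [0]) (\<lambda>t R' inp'.
    t \<le> 500 * (m + 1) * (length u + length v + length a + length b + 3) \<and>
    (R' 23 \<noteq> 0 \<longleftrightarrow> accepts m (sum_list (map (weight m) a) < 0) (fold (letter m) u g) (fold (letter m) v g)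
       (sum_list (map (weight m) u) - sum_list (map (weight m) v))))"
proof -
  define tw where "tw = (sum_list (map (weight m) a) < 0)"
  define n where "n = length la div 2"
  define L where "L = length u + length v + length a + length b"
  have la0: "la \<noteq> []" "length la \<le> length a + 1"
    using length_fold_letter[of m a "[0]"] by (auto simp: la_def, induction a rule: rev_induct) auto
  have n: "length la = 2 * n" using la by (simp add: n_def)
  moreover have "0 < length la" using la0 by simp
  ultimately have n: "length la = 2 * n" "0 < n" by linarith+
  define l where "l = drop n la"
  define fl where "fl = (\<not> length lb < length la)"
  have l: "length l = n" "l \<noteq> []" using n by (auto simp: l_def)
  have g: "g = (if fl then 0 # l else l)" by (simp add: g_def inverse_half_def fl_def l_def n_def Let_def)
  have "\<forall>d\<in>set la. d < m" unfolding la_def by (rule fold_letter_bounded) (use m in simp_all)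
  then have bd: "\<forall>d\<in>set l. d < m" unfolding l_def by (meson in_set_dropD)
  define lu where "lu = fold (letter m) u g"
  define lv where "lv = fold (letter m) v g"
  have len: "length lu \<le> L + 3" "length lv \<le> L + 3" "n \<le> L + 1"
    using length_fold_letter[of m u g] length_fold_letter[of m v g] l n la0
    by (simp_all add: lu_def lv_def L_def g split: if_splits)
  have ne: "lu \<noteq> []" "lv \<noteq> []"
  proof -
    have "g \<noteq> []" using l by (simp add: g)
    then show "lu \<noteq> []" "lv \<noteq> []" unfolding lu_def lv_def
      by (induction u rule: rev_induct, auto, induction v rule: rev_induct) auto
  qed
  note ld = load_input[OF w, of R]
  show ?thesis unfolding tcp_program_def
  proof (rule wp_then[OF ld], goal_cases)
    case (1 t1 R1 i1)
    then have 1: "t1 \<le> 6 * L + 30" "tape R1 u v a b (R1 3)" by (simp_all add: L_def)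
    define h where "h = R1 3"
    have h: "60 \<le> h" using 1(2) by (auto simp: tape_def h_def)
    note st = stage_a[OF 1(2) HOL.refl w(3) m, of i1, folded la_def tw_def h_def]
    show ?case
    proof (rule wp_then[OF st], goal_cases)
      case (1 t2 R2 i2)
      then have 2: "t2 \<le> 25 * length a + 30" "tape R2 u v a b h" "stored R2 h la" "R2 12 = h"
        "R2 13 + 1 = h + length la" "R2 3 = h + length la" "R2 16 = 0 \<longleftrightarrow> \<not> tw" by auto
      note st = stage_b[OF 2(2,6) w(4) m 2(3-5,7) n, of i2, folded lb_def l_def fl_def]
      show ?case
      proof (rule wp_then[OF st], goal_cases)
        case (1 t3 R3 i3)
        then have 3: "t3 \<le> 25 * length b + 7 * n + 40" "R3 3 = h + length la"
          "prepared R3 u v a b h (h + n) l fl tw" by auto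
        have le: "h + n + length l \<le> h + length la" using n l by simp
        note st = stage_v[OF 3(3,2) le w(2) m bd, of i3, folded g lv_def]
        show ?case
        proof (rule wp_then[OF st], goal_cases)
          case (1 t4 R4 i4)
          then have 4: "t4 \<le> 9 * length l + 25 * length v + 32 * length lv + 60"
            "prepared R4 u v a b h (h + n) l fl tw" "R4 3 = h + length la + length lv"
            "int (R4 10) - int (R4 11) = sum_list (map (weight m) v)" "R4 10 + R4 11 \<le> m * length v"
            "R4 19 = rounds m tw lv" "\<forall>d\<in>set lv. d < m" "h + length la \<le> R4 17"
            "R4 18 + 1 = length (core m tw lv)"
            "R4 17 + length (core m tw lv) \<le> h + length la + length lv"
            "stored R4 (R4 17) (butlast (core m tw lv))" by auto
          have le: "h + n + length l \<le> h + length la + length lv" using n l by simp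
          note st = stage_u[OF 4(2,3) le w(1) m bd, of i4, folded g lu_def]
          show ?case
          proof (rule wp_then[OF st], goal_cases)
            case (1 t5 R5 i5)
            define e where "e = h + length la + length lv"
            have 5: "t5 \<le> 9 * length l + 25 * length u + 32 * length lu + 60" "R5 16 = 0 \<longleftrightarrow> \<not> tw"
              "sum_list (map (weight m) u) - sum_list (map (weight m) v) = int (R5 10) - int (R5 11)"
              "R5 10 + R5 11 \<le> m * length v + m * length u"
              "R5 19 = rounds m tw lv + rounds m tw lu" "\<forall>d\<in>set lu. d < m" "40 \<le> R5 6"
              "R5 7 + 1 = R5 6 + length (core m tw lu)" "stored R5 (R5 6) (butlast (core m tw lu))"
              "frame {2,4,5,6,7,8,9,10,11,19,20,21,22} e R4 R5"
              using 1 4(4-6) h by (auto simp: e_def)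
            have R5: "R5 17 = R4 17" "R5 18 = R4 18" using frameD[OF 5(10)] h by (simp_all add: e_def)
            have st5: "stored R5 (R4 17) (butlast (core m tw lv))"
              using frame_stored[OF 5(10), of "R4 17" "butlast (core m tw lv)"] 4(8,10,11) h
              by (simp add: e_def)
            have R17: "40 \<le> R4 17" using 4(8) h by simp
            have R518: "R5 18 + 1 = length (core m tw lv)" using R5 4(9) by simp
            have m0: "0 < m" using m by simp
            note dc = decide[OF HOL.refl 5(8,9) R5(1) R518 st5 core_nonempty[OF ne(1)] core_nonempty[OF ne(2)]
                core_bounded[OF 5(6) m0] core_bounded[OF 4(7) m0] 5(7) R17 5(2,3), of i5]
            show ?case
            proof (rule wp_mono[OF dc], goal_cases)
              case (1 t6 R6 i6)
              have acc: "R6 23 \<noteq> 0 \<longleftrightarrow> accepts m tw lu lv (sum_list (map (weight m) u) - sum_list (map (weight m) v))"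
                using 1 5(5) unfolding accepts_def Let_def by (simp add: algebra_simps)
              \<comment> \<open>A common bound for the lengths, in which the running times of all stages are expressed.\<close>
              define Y where "Y = L + 3"
              have Y: "length (core m tw lu) \<le> Y" "length lu \<le> Y" "length lv \<le> Y" "n \<le> Y" "length l \<le> Y"
                "R5 19 \<le> 2 * Y" "length u + length v \<le> Y" "length a \<le> Y" "length b \<le> Y" "L \<le> Y" "3 \<le> Y"
                using len length_core[of m tw lu] rounds_le[of m tw lu] rounds_le[of m tw lv] 5(5) l
                by (simp_all add: Y_def) (simp_all add: L_def)
              have "(35 * m + 204) * length (core m tw lu) \<le> (35 * m + 204) * Y"
                using Y(1) by (rule mult_le_mono2)
              then have t6: "t6 \<le> 35 * (m * Y) + 204 * Y + 6 * (R5 10 + R5 11 + R5 19) + 70"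
                using 1 by (simp add: algebra_simps)
              have "m * length v + m * length u \<le> m * Y"
                using mult_le_mono2[OF Y(7), of m] by (simp add: algebra_simps)
              then have "R5 10 + R5 11 \<le> m * Y" using 5(4) by linarith
              moreover have "t \<le> 41 * M + 240 * k" if "t \<le> 35 * M + 204 * k + 6 * (i + j + r) + 70"
                  "i + j \<le> M" "r \<le> 2 * k" "3 \<le> k" for t M k i j r :: nat
                using that by simp
              ultimately have "t6 \<le> 41 * (m * Y) + 240 * Y" using t6 Y(6,11) by blast
              moreover have "2 * Y \<le> m * Y" using m by simp
              moreover have "t1 \<le> 16 * Y" using \<open>t1 \<le> _\<close> Y(10,11) by linarith
              moreover have "t2 \<le> 35 * Y" using 2(1) Y(8,11) by linarith
              moreover have "t3 \<le> 46 * Y" using 3(1) Y(4,9,11) by linarith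
              moreover have "t4 \<le> 86 * Y" using 4(1) Y(3,5,7,11) by linarith
              moreover have "t5 \<le> 86 * Y" using 5(1) Y(2,5,7,11) by linarith
              ultimately have "t1 + (t2 + (t3 + (t4 + (t5 + t6)))) \<le> 500 * (m * Y) + 500 * Y"
                by linarith
              then have "t1 + (t2 + (t3 + (t4 + (t5 + t6)))) \<le> 500 * (m + 1) * (L + 3)"
                by (simp add: Y_def algebra_simps)
              then show ?case using acc unfolding tw_def lu_def lv_def L_def by (simp add: add.assoc)
            qed
          qed
        qed
      qed
    qed
  qed
qed


section \<open>Correctness and running time\<close>

context torus_knot
begin

lemma parity_el: "l \<noteq> [] \<Longrightarrow> even (ab (el l)) \<longleftrightarrow> odd (length l)"
  by (induction l rule: el.induct) (use m_odd in \<open>auto simp: ab_mult ab_y_pow ab_x\<close>)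

text \<open>Each letter \<open>x\<close> changes both parities, as \<open>m\<close> is odd, and a letter \<open>y\<close> changes neither.\<close>

lemma parity_length_N: "g \<in> carrier G \<Longrightarrow> even (length (N g)) \<longleftrightarrow> odd (ab g)"
proof -
  assume g: "g \<in> carrier G"
  then obtain c :: int where "g = el (N g) \<otimes> z [^] c" using normal_form by blast
  then have "ab g = ab (el (N g)) + c * ab z" by (metis ab_int_pow ab_mult el_closed int_pow_closed z_closed)
  then show ?thesis using parity_el[of "N g"] g by (simp add: ab_z)
qed

text \<open>This is what \<open>midpoint\<close> relies on.\<close>

lemma automorphism_x_even:
  assumes "\<psi> \<in> auto G"
  shows "even (length (N (\<psi> x)))"
proof -
  obtain tw g where g: "g \<in> carrier G" "\<psi> x = g \<otimes> signed tw x \<otimes> inv g" using automorphism_inner[OF assms] by blast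
  then have "ab (\<psi> x) = (if tw then - int m else int m)" by (simp add: ab_mult ab_inv signed_def ab_x)
  then show ?thesis using g m_odd by (simp add: parity_length_N)
qed

lemma letters_word: "w \<in> words_over [x, y] \<Longrightarrow> letters (map letter_code w)"
  by (force simp: letters_def words_over_def letter_code_def less_Suc_eq)

lemma tcp_yes_iff_accepts:
  assumes "(u, v, \<psi>, ws) \<in> tcp_instances G [x, y]"
  obtains a b where "ws = [a, b]"
    "letters (map letter_code u)" "letters (map letter_code v)"
    "letters (map letter_code a)" "letters (map letter_code b)"
    "even (length (fold (letter m) (map letter_code a) [0]))"
    "tcp_yes G [x, y] (u, v, \<psi>, ws) \<longleftrightarrow>
      (let g = inverse_half (fold (letter m) (map letter_code a) [0]) (fold (letter m) (map letter_code b) [0]) in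
       accepts m (sum_list (map (weight m) (map letter_code a)) < 0)
         (fold (letter m) (map letter_code u) g) (fold (letter m) (map letter_code v) g)
         (sum_list (map (weight m) (map letter_code u)) - sum_list (map (weight m) (map letter_code v))))"
proof -
  have I: "u \<in> words_over [x, y]" "v \<in> words_over [x, y]" "\<psi> \<in> auto G" "set ws \<subseteq> words_over [x, y]"
    "map (word_value G [x, y]) ws = [\<psi> x, \<psi> y]"
    using assms by (auto simp: tcp_instances_def)
  obtain a b where ws: "ws = [a, b]" using I(5) by (auto simp: map_eq_Cons_conv)
  have ab: "a \<in> words_over [x, y]" "b \<in> words_over [x, y]"
    "word_value G [x, y] a = \<psi> x" "word_value G [x, y] b = \<psi> y" using I(4,5) ws by auto
  have N: "N (\<psi> x) = fold (letter m) (map letter_code a) [0]" "N (\<psi> y) = fold (letter m) (map letter_code b) [0]"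
    using N_mult_word[OF one_closed ab(1)] N_mult_word[OF one_closed ab(2)] ab(3,4)
      l_one[OF word_value_closed[OF ab(1)]] l_one[OF word_value_closed[OF ab(2)]] by (simp_all add: N_one)
  obtain h where h: "h \<in> carrier G" "N h = inverse_half (N (\<psi> x)) (N (\<psi> y))"
    "twisted_conjugate G \<psi> (word_value G [x, y] u) (word_value G [x, y] v) \<longleftrightarrow>
       accepts m (ab (\<psi> x) < 0) (N (h \<otimes> word_value G [x, y] u)) (N (h \<otimes> word_value G [x, y] v))
         (ab (word_value G [x, y] u) - ab (word_value G [x, y] v))"
    using twisted_conjugate_iff_accepts[OF I(3) word_value_closed[OF I(1)] word_value_closed[OF I(2)]] by blast
  show thesis
  proof (rule that[OF ws letters_word[OF I(1)] letters_word[OF I(2)] letters_word[OF ab(1)] letters_word[OF ab(2)]])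
    show "even (length (fold (letter m) (map letter_code a) [0]))"
      using automorphism_x_even[OF I(3)] N by simp
    have "ab (\<psi> x) = sum_list (map (weight m) (map letter_code a))" using ab_word[OF ab(1)] ab(3) by simp
    then show "tcp_yes G [x, y] (u, v, \<psi>, ws) \<longleftrightarrow>
      (let g = inverse_half (fold (letter m) (map letter_code a) [0]) (fold (letter m) (map letter_code b) [0]) in
       accepts m (sum_list (map (weight m) (map letter_code a)) < 0)
         (fold (letter m) (map letter_code u) g) (fold (letter m) (map letter_code v) g)
         (sum_list (map (weight m) (map letter_code u)) - sum_list (map (weight m) (map letter_code v))))"
      using h N N_mult_word[OF h(1) I(1)] N_mult_word[OF h(1) I(2)] ab_word[OF I(1)] ab_word[OF I(2)]
      by (simp add: Let_def)
  qed
qed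

end

lemma wf_tcp_program: "wf_com (tcp_program m)"
  by (simp add: tcp_program_def load_input_def read_word_def stage_a_def start_stack_def push_word_def
      push_letter_def stage_b_def midpoint_def stage_v_def copy_half_def reduce_def reduce_body_def
      flip_reg_def stage_u_def decide_def exponents_def codes_def codes_body_def horner_def mul_def
      rotations_def rotations_body_def rotate_store_def rotate_code_def rotate_count_def)

definition answer_program :: "com \<Rightarrow> nat \<Rightarrow> instr list" where
  "answer_program c r = compile 0 c @ [JumpZero r (code_size c + 2), Halt True, Halt False]"

lemma answer_program:
  assumes "wf_com c" "wp c (\<lambda>_. 0) inp (\<lambda>t R' inp'. t \<le> T \<and> (R' r \<noteq> 0 \<longleftrightarrow> b))"
  shows "ram_answers_within (answer_program c r) inp b (T + 1)"
proof -
  let ?P = "answer_program c r"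
  obtain t R' inp' where run: "big c (\<lambda>_. 0, inp) t (R', inp')" and t: "t \<le> T" "R' r \<noteq> 0 \<longleftrightarrow> b"
    using assms(2) unfolding wp_def by force
  have "(ram_step ?P ^^ t) (0, \<lambda>_. 0, inp) = (code_size c, R', inp')"
    using compile_correct[OF run assms(1), of "[]" "[JumpZero r (code_size c + 2), Halt True, Halt False]"]
    by (simp add: answer_program_def)
  moreover have "ram_step ?P (code_size c, R', inp') = (if b then code_size c + 1 else code_size c + 2, R', inp')"
    using ram_step_at[of "code_size c" "compile 0 c" "JumpZero r (code_size c + 2)" "[Halt True, Halt False]"] t(2)
    by (auto simp: answer_program_def)
  ultimately have "(ram_step ?P ^^ (Suc t)) (0, \<lambda>_. 0, inp) = (if b then code_size c + 1 else code_size c + 2, R', inp')"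
    by simp
  moreover have "?P ! (code_size c + 1) = Halt True" "?P ! (code_size c + 2) = Halt False" "length ?P = code_size c + 3"
    by (simp_all add: answer_program_def nth_append)
  ultimately show ?thesis
    unfolding ram_answers_within_def using t(1) by (intro exI[of _ "Suc t"]) (auto simp del: funpow.simps)
qed

theorem theorem4p4:
  fixes m :: nat
  assumes "m \<ge> 3" and "odd m"
  shows "tcp_linear_time (dihedral_artin_group m) [torus_x m, torus_y m]"
proof -
  interpret torus_knot "dihedral_artin_group m" m "torus_x m" "torus_y m" "artin_N m" "artin_ab m"
    by (rule torus_knot_dihedral_artin[OF assms])
  define T where "T n = 500 * (m + 1) * (n + 3) + 1" for n
  have "(\<lambda>n. real (T n)) \<in> O(\<lambda>n. real n)"
  proof (rule bigoI)
    have "real (T n) \<le> real (2001 * (m + 1)) * real n" if "n \<ge> 1" for n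
    proof -
      have "500 * (m + 1) * (n + 3) \<le> 500 * (m + 1) * (4 * n)" using that by (intro mult_le_mono2) simp
      moreover have "1 \<le> (m + 1) * n" using that by simp
      ultimately have "T n \<le> 2001 * (m + 1) * n" unfolding T_def by (simp add: algebra_simps)
      then show ?thesis by (metis of_nat_le_iff of_nat_mult)
    qed
    then show "\<forall>\<^sub>F n in at_top. norm (real (T n)) \<le> real (2001 * (m + 1)) * norm (real n)"
      by (intro eventually_mono[OF eventually_ge_at_top[of "1::nat"]]) simp
  qed
  moreover have "ram_answers_within (answer_program (tcp_program m) 23) (tcp_encode i)
      (tcp_yes (dihedral_artin_group m) [torus_x m, torus_y m] i) (T (tcp_size i))"
    if i: "i \<in> tcp_instances (dihedral_artin_group m) [torus_x m, torus_y m]" for i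
  proof -
    obtain u v \<psi> ws where i': "i = (u, v, \<psi>, ws)" by (cases i) auto
    obtain a b where ab: "ws = [a, b]"
      "letters (map letter_code u)" "letters (map letter_code v)"
      "letters (map letter_code a)" "letters (map letter_code b)"
      "even (length (fold (letter m) (map letter_code a) [0]))"
      "tcp_yes (dihedral_artin_group m) [torus_x m, torus_y m] (u, v, \<psi>, ws) \<longleftrightarrow>
      (let g = inverse_half (fold (letter m) (map letter_code a) [0]) (fold (letter m) (map letter_code b) [0]) in
       accepts m (sum_list (map (weight m) (map letter_code a)) < 0)
         (fold (letter m) (map letter_code u) g) (fold (letter m) (map letter_code v) g)
         (sum_list (map (weight m) (map letter_code u)) - sum_list (map (weight m) (map letter_code v))))"
      using i unfolding i' by (rule tcp_yes_iff_accepts)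
    have enc: "tcp_encode i = map letter_code u @ 0 # map letter_code v @ 0 # map letter_code a @ 0 # map letter_code b @ [0]"
      by (simp add: i' ab(1) encode_word_def letter_code_def)
    have size: "length (map letter_code u) + length (map letter_code v) + length (map letter_code a)
      + length (map letter_code b) = tcp_size i" by (simp add: i' ab(1))
    have "2 \<le> m" using assms by simp
    note prog = tcp_program[OF ab(2-5) \<open>2 \<le> m\<close> ab(6), of "\<lambda>_. 0", folded enc]
    show ?thesis unfolding T_def
    proof (rule answer_program[OF wf_tcp_program], rule wp_mono[OF prog], goal_cases)
      case (1 t R' inp')
      then show ?case using ab(7) unfolding size i' Let_def by simp
    qed
  qed
  ultimately show ?thesis unfolding tcp_linear_time_def linear_time_decidable_def by blast
qed

end
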